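(* Let $g$ be the Littlewood--Paley $g$-function defined by $$g(f)(x)=\left(\int_0^\infty|t\partial_tW_tf(x)|^2\,\frac{dt}{t}\right)^{1/2}.$$ There is a constant $C>0$ depending only on the dimension $n$ such that for any $f\in\mathrm{BMO}(\mathbb{R}^n)$ with $g(f)(x)<\infty$ for a.e. $x\in\mathbb{R}^n$, the function $[g(f)]^2$ belongs to $\mathrm{BLO}(\mathbb{R}^n)$ and $$\|[g(f)]^2\|_{\mathrm{BLO}(\mathbb{R}^n)}\le C\,\|f\|_{\mathrm{BMO}(\mathbb{R}^n)}^2.$$
   Context: $\mathrm{BLO}(\mathbb{R}^n)$ is the set of real-valued locally integrable functions $f$ on $\mathbb{R}^n$ with $\|f\|_{\mathrm{BLO}(\mathbb{R}^n)}:=\sup_B\frac1{|B|}\int_B\big[f(x)-\operatorname{ess\,inf}_B f\big]\,dx<\infty$, and $\mathrm{BMO}(\mathbb{R}^n)$ is the set of locally integrable $f$ with $\|f\|_{\mathrm{BMO}(\mathbb{R}^n)}:=\sup_B\frac1{|B|}\int_B|f-f_B|\,dx<\infty$, $f_B=\frac1{|B|}\int_Bf$, the suprema being over all balls $B\subset\mathbb{R}^n$. The heat semigroup is $W_tf(x)=\int_{\mathbb{R}^n}(4\pi t)^{-n/2}\exp(-|x-y|^2/(4t))f(y)\,dy$, $t>0$. *)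

theory Defs
  imports "HOL-Analysis.Analysis"
begin

definition locally_integrable ::
    "('a::euclidean_space \<Rightarrow> 'b::{banach, second_countable_topology}) \<Rightarrow> bool" where
  "locally_integrable f \<longleftrightarrow> (\<forall>K. compact K \<longrightarrow> set_integrable lebesgue K f)"

definition average ::
    "'a::euclidean_space set \<Rightarrow> ('a \<Rightarrow> 'b::{banach, second_countable_topology}) \<Rightarrow> 'b" where
  "average B f = (LINT x:B|lebesgue. f x) /\<^sub>R measure lebesgue B"

text \<open>The BMO and BLO norms take values in \<open>[0, \<infinity>]\<close>; the mean values inside the suprema are
  written with the nonnegative integral, so that a divergent integral counts as \<open>\<infinity>\<close>.
  Membership in BMO and BLO is local integrability together with finiteness of the norm.\<close>

definition BMO_norm ::
    "('a::euclidean_space \<Rightarrow> 'b::{banach, second_countable_topology}) \<Rightarrow> ennreal" where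
  "BMO_norm f = (SUP (z, r) \<in> UNIV \<times> {0<..}.
     (\<integral>\<^sup>+x\<in>ball z r. ennreal (norm (f x - average (ball z r) f)) \<partial>lebesgue)
       / emeasure lebesgue (ball z r))"

definition BMO :: "('a::euclidean_space \<Rightarrow> 'b::{banach, second_countable_topology}) set" where
  "BMO = {f. locally_integrable f \<and> BMO_norm f < \<infinity>}"

text \<open>The essential infimum over \<open>B\<close> is the largest almost everywhere lower bound on \<open>B\<close>; it is
  \<open>-\<infinity>\<close> if \<open>f\<close> is not essentially bounded below on \<open>B\<close>.\<close>

definition ess_inf :: "'a::euclidean_space set \<Rightarrow> ('a \<Rightarrow> real) \<Rightarrow> ereal" where
  "ess_inf B f = Sup {c. AE x in lebesgue. x \<in> B \<longrightarrow> c \<le> ereal (f x)}"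

text \<open>The difference below is nonnegative for almost every \<open>x\<close> in the ball, so the truncation of
  negative values by \<^const>\<open>e2ennreal\<close> does not affect the integral. If the essential infimum is
  \<open>-\<infinity>\<close>, the integrand is \<open>\<infinity>\<close>, and so is the norm.\<close>

definition BLO_norm :: "('a::euclidean_space \<Rightarrow> real) \<Rightarrow> ennreal" where
  "BLO_norm f = (SUP (z, r) \<in> UNIV \<times> {0<..}.
     (\<integral>\<^sup>+x\<in>ball z r. e2ennreal (ereal (f x) - ess_inf (ball z r) f) \<partial>lebesgue)
       / emeasure lebesgue (ball z r))"

definition BLO :: "('a::euclidean_space \<Rightarrow> real) set" where
  "BLO = {f. locally_integrable f \<and> BLO_norm f < \<infinity>}"

definition heat_semigroup ::
    "real \<Rightarrow> (real^'n \<Rightarrow> 'b::{banach, second_countable_topology}) \<Rightarrow> real^'n \<Rightarrow> 'b" where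
  "heat_semigroup t f x =
     (LINT y|lebesgue.
        ((4 * pi * t) powr (- (real CARD('n) / 2)) * exp (- (norm (x - y))\<^sup>2 / (4 * t))) *\<^sub>R f y)"

definition ennreal_sqrt :: "ennreal \<Rightarrow> ennreal" where
  "ennreal_sqrt a = (if a = \<infinity> then \<infinity> else ennreal (sqrt (enn2real a)))"

text \<open>The Littlewood--Paley function takes values in \<open>[0, \<infinity>]\<close>. The time derivative is that of
  \<open>s \<mapsto> W\<^sub>s f(x)\<close> at \<open>s = t\<close>, with \<open>x\<close> fixed.\<close>

definition g_function ::
    "(real^'n \<Rightarrow> 'b::{banach, second_countable_topology}) \<Rightarrow> real^'n \<Rightarrow> ennreal" where
  "g_function f x = ennreal_sqrt
     (\<integral>\<^sup>+t\<in>{0<..}.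
        ennreal ((norm (t *\<^sub>R vector_derivative (\<lambda>s. heat_semigroup s f x) (at t)))\<^sup>2 / t)
      \<partial>lebesgue)"

text \<open>\<open>[g(f)]\<^sup>2\<close> as a real-valued function, for \<open>g(f)\<close> finite almost everywhere; its value on the
  exceptional null set, where \<^const>\<open>enn2real\<close> returns \<open>0\<close>, is immaterial.\<close>

definition g_function_sq ::
    "(real^'n \<Rightarrow> 'b::{banach, second_countable_topology}) \<Rightarrow> real^'n \<Rightarrow> real" where
  "g_function_sq f x = (enn2real (g_function f x))\<^sup>2"

end

theory Submission
  imports Defs "HOL-Probability.Distributions"
begin

text \<open>
  Write \<open>u\<^sub>t = W\<^sub>t f\<close> and split the integral in \<open>g(f)\<^sup>2\<close> on a ball of radius \<open>r\<close> at \<open>t = r\<^sup>2\<close>.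
  For \<open>t > r\<^sup>2\<close>, the bounds \<open>|t \<partial>\<^sub>t u\<^sub>t| \<le> C \<parallel>f\<parallel>\<close> and \<open>|t \<nabla>\<partial>\<^sub>t u\<^sub>t| \<le> C \<parallel>f\<parallel> / \<surd>t\<close> (with the BMO norm)
  show that this part oscillates by at most \<open>C \<parallel>f\<parallel>\<^sup>2\<close> over the ball. The part \<open>t \<le> r\<^sup>2\<close> has mean
  at most \<open>C \<parallel>f\<parallel>\<^sup>2\<close> by a Carleson estimate that needs neither Plancherel's theorem nor an
  integration by parts: since \<open>\<partial>\<^sub>t\<close> of the heat kernel has mean zero, the Cauchy-Schwarz inequality gives
  \<open>|t \<partial>\<^sub>t u\<^sub>t|\<^sup>2 \<le> C (W\<^bsub>t/2\<^esub> |u\<^bsub>t/2\<^esub> - c|\<^sup>2 - |u\<^sub>t - c|\<^sup>2)\<close>, and applying \<open>W\<^bsub>T-t\<^esub>\<close> with \<open>T = 2 r\<^sup>2\<close> turns the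
  right-hand side into \<open>h(t/2) - h(t)\<close> for \<open>h(t) = W\<^bsub>T-t\<^esub> |u\<^sub>t - c|\<^sup>2\<close>, which telescopes in
  \<open>dt / t\<close>. The uniform bound \<open>h \<le> C \<parallel>f\<parallel>\<^sup>2\<close> is the \<open>L\<^sup>2\<close> form of the John-Nirenberg inequality,
  obtained from the martingale of dyadic means.
\<close>

section \<open>Kernel estimates\<close>

text \<open>The squared function is an integral over \<open>t\<close>, so it splits additively. If
  the tail over \<open>t > r\<^sup>2\<close> varies by at most \<open>M\<close> on a ball, then the
  tail at \<open>x\<close> minus \<open>M\<close> is an almost everywhere lower bound of the whole
  square there, and only the part \<open>t \<le> r\<^sup>2\<close> at \<open>x\<close>, up to
  \<open>M\<close>, can exceed the essential infimum. The horizon \<open>T = 2 r\<^sup>2\<close>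
  keeps the remaining time \<open>T - t\<close> between \<open>r\<^sup>2\<close> and
  \<open>2 r\<^sup>2\<close>, where the heat kernel is at most a multiple of \<open>decay r\<close>
  and, on the ball, at least a multiple of the inverse volume. The obstacle is that \<open>h\<close>
  must be bounded uniformly in \<open>t\<close>: the centre \<open>c\<close> is a mean at scale
  \<open>r\<close>, while \<open>t\<close> may be arbitrarily small, and the hypothesis on
  \<open>f\<close> is only an average of first powers. Finiteness of \<open>h\<close> is also what
  allows the common integrals to be cancelled in \<open>ennreal\<close>. The estimates are made for
  Borel functions into a Euclidean space with an explicit bound \<open>a > 0\<close> on the
  oscillation; letting \<open>a\<close> decrease to the norm at the end also covers norm
  zero.\<close>

definition heat_kernel :: "real \<Rightarrow> 'a::euclidean_space \<Rightarrow> real" where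
  "heat_kernel t w = (4 * pi * t) powr (- (real DIM('a) / 2)) * exp (- (norm w)\<^sup>2 / (4 * t))"

text \<open>The derivative in time, see \<open>heat_kernel_has_derivative\<close>. Its spatial
  gradient never appears; a difference estimate takes its place.\<close>

definition heat_kernel_deriv :: "real \<Rightarrow> 'a::euclidean_space \<Rightarrow> real" where
  "heat_kernel_deriv t w = heat_kernel t w * ((norm w)\<^sup>2 / (4 * t\<^sup>2) - real DIM('a) / (2 * t))"

text \<open>A polynomial majorant instead of a Gaussian one: two scales differ only by a constant
  factor, whereas Gaussians of different widths are not comparable. One weight thus controls the
  kernel, its time derivative and their differences at all nearby times.\<close>

definition decay :: "real \<Rightarrow> 'a::euclidean_space \<Rightarrow> real" where
  "decay r w = inverse (r ^ DIM('a)) * inverse ((1 + norm w / r) ^ (DIM('a) + 3))"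

lemma heat_kernel_measurable [measurable]:
  "(\<lambda>(t, w). heat_kernel t (w::'a::euclidean_space)) \<in> borel_measurable (borel \<Otimes>\<^sub>M borel)"
  unfolding heat_kernel_def by measurable

lemma heat_kernel_deriv_measurable [measurable]:
  "(\<lambda>(t, w). heat_kernel_deriv t (w::'a::euclidean_space)) \<in> borel_measurable (borel \<Otimes>\<^sub>M borel)"
  unfolding heat_kernel_deriv_def by measurable

lemma decay_measurable [measurable]: "decay r \<in> borel_measurable borel"
  unfolding decay_def by measurable

lemma heat_kernel_nonneg [simp]: "0 \<le> heat_kernel t w"
  by (simp add: heat_kernel_def)

lemma decay_nonneg [simp]: "0 \<le> r \<Longrightarrow> 0 \<le> decay r w"
  by (simp add: decay_def)

lemma heat_kernel_commute: "heat_kernel t (x - y) = heat_kernel t (y - x)"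
  by (simp add: heat_kernel_def norm_minus_commute)

text \<open>Writing time as \<open>r\<^sup>2\<close> turns the real power into \<open>r ^ n\<close>
  and exhibits the kernel as a dilated profile in \<open>norm w / r\<close>.\<close>

lemma heat_kernel_square:
  fixes w :: "'a::euclidean_space"
  assumes "r > 0"
  shows "heat_kernel (r\<^sup>2) w
    = (4 * pi) powr (- (real DIM('a) / 2)) * inverse (r ^ DIM('a)) * exp (- (norm w / r)\<^sup>2 / 4)"
proof -
  have "(r\<^sup>2) powr (- (real DIM('a) / 2)) = r powr (- real DIM('a))"
    using assms powr_powr[of r 2 "- (real DIM('a) / 2)"] by (simp add: powr_numeral)
  also have "\<dots> = inverse (r ^ DIM('a))"
    using assms by (simp add: powr_minus powr_realpow)
  finally have "(4 * pi * r\<^sup>2) powr (- (real DIM('a) / 2))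
      = (4 * pi) powr (- (real DIM('a) / 2)) * inverse (r ^ DIM('a))"
    by (simp add: powr_mult)
  then show ?thesis
    by (simp add: heat_kernel_def power_divide field_simps)
qed

lemma heat_kernel_deriv_square:
  fixes w :: "'a::euclidean_space"
  assumes "r > 0"
  shows "r\<^sup>2 * heat_kernel_deriv (r\<^sup>2) w
    = (4 * pi) powr (- (real DIM('a) / 2)) * inverse (r ^ DIM('a))
      * (((norm w / r)\<^sup>2 / 4 - real DIM('a) / 2) * exp (- (norm w / r)\<^sup>2 / 4))"
proof -
  have "r\<^sup>2 * ((norm w)\<^sup>2 / (4 * (r\<^sup>2)\<^sup>2) - real DIM('a) / (2 * r\<^sup>2)) = (norm w / r)\<^sup>2 / 4 - real DIM('a) / 2"
    using assms by (simp add: field_simps power2_eq_square)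
  then show ?thesis
    unfolding heat_kernel_deriv_def heat_kernel_square[OF assms]
    by (simp add: mult_ac)
qed

lemma power_le_fact_exp:
  fixes x :: real
  assumes "0 \<le> x"
  shows "x ^ k \<le> fact k * exp x"
proof -
  have "(\<Sum>j\<in>{k}. x ^ j /\<^sub>R fact j) \<le> (\<Sum>j. x ^ j /\<^sub>R fact j)"
    using assms summable_exp_generic[of x] by (intro sum_le_suminf) auto
  then show ?thesis
    by (simp add: exp_def field_simps)
qed

lemma power_times_gaussian_le:
  fixes q c :: real
  assumes "0 \<le> q" "0 \<le> c"
  shows "(c + q) ^ k * exp (- q\<^sup>2 / 8) \<le> fact k * exp (c + 2)"
proof -
  have "(c + q) ^ k * exp (- q\<^sup>2 / 8) \<le> fact k * exp (c + q) * exp (- q\<^sup>2 / 8)"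
    using assms by (intro mult_right_mono power_le_fact_exp) auto
  also have "\<dots> = fact k * exp (c + q - q\<^sup>2 / 8)"
    by (simp add: mult.assoc flip: exp_add)
  also have "\<dots> \<le> fact k * exp (c + 2)"
  proof -
    \<comment> \<open>The maximum of \<open>q - q\<^sup>2 / 8\<close> is 2, attained at
      \<open>q = 4\<close>; this is the 2 in \<open>exp (c + 2)\<close>.\<close>
    have "0 \<le> (q - 4)\<^sup>2" by simp
    then have "q - q\<^sup>2 / 8 \<le> 2" by (simp add: power2_eq_square algebra_simps)
    then show ?thesis by simp
  qed
  finally show ?thesis .
qed

lemma power_times_gaussian_quarter_le:
  fixes q c :: real
  assumes "0 \<le> q" "0 \<le> c"
  shows "(c + q) ^ k * exp (- q\<^sup>2 / 4) \<le> fact k * exp (c + 2)"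
proof -
  have "(c + q) ^ k * exp (- q\<^sup>2 / 4) \<le> (c + q) ^ k * exp (- q\<^sup>2 / 8)"
    using assms by (intro mult_left_mono) auto
  then show ?thesis using power_times_gaussian_le[OF assms, of k] by linarith
qed

text \<open>The spare fourth power absorbs polynomial factors later: degree 2 for the time
  derivative, and degree 4 for the square of its quadratic factor in
  \<open>heat_deriv_le_variance\<close>.\<close>

lemma heat_kernel_le_decay:
  "\<exists>C>0. \<forall>r>0. \<forall>w::'a::euclidean_space.
     heat_kernel (r\<^sup>2) w * (1 + norm w / r) ^ 4 \<le> C * decay r w"
proof (intro exI conjI allI impI)
  let ?c = "(4 * pi) powr (- (real DIM('a) / 2))" and ?k = "DIM('a) + 3"
  show "?c * (fact (?k + 4) * exp 3) > 0" by simp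
  fix r :: real and w :: 'a assume r: "r > 0"
  define q where "q = norm w / r"
  have q: "q \<ge> 0" using r by (simp add: q_def)
  have "heat_kernel (r\<^sup>2) w * (1 + q) ^ 4
      = ?c * inverse (r ^ DIM('a)) * (((1 + q) ^ (?k + 4) * exp (- q\<^sup>2 / 4)) * inverse ((1 + q) ^ ?k))"
  proof -
    have "(1 + q) ^ ?k > 0" using q by simp
    then show ?thesis
      unfolding heat_kernel_square[OF r] q_def[symmetric] power_add[of "1 + q" ?k]
      by (simp add: field_simps del: power_Suc)
  qed
  also have "\<dots> \<le> ?c * inverse (r ^ DIM('a)) * ((fact (?k + 4) * exp (1 + 2)) * inverse ((1 + q) ^ ?k))"
    using q r by (intro mult_left_mono mult_right_mono power_times_gaussian_quarter_le) auto
  finally show "heat_kernel (r\<^sup>2) w * (1 + norm w / r) ^ 4 \<le> ?c * (fact (?k + 4) * exp 3) * decay r w"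
    by (simp add: decay_def q_def mult_ac)
qed

lemma inverse_le_inverse_mult:
  fixes x y k :: real
  assumes "0 < x" "0 < y" "y \<le> k * x"
  shows "inverse x \<le> k * inverse y"
  using assms by (simp add: field_simps)

text \<open>Covers both quadratic factors that occur: \<open>c = - n / 2\<close> in the time
  derivative of the kernel, and \<open>c = - 1 - n / 2\<close> in the derivative of its radial
  profile.\<close>

lemma quadratic_abs_le:
  fixes A X n c :: real
  assumes "0 \<le> A" "A \<le> X" "1 \<le> X" "0 \<le> n" "- 1 - n / 2 \<le> c" "c \<le> 0"
  shows "\<bar>A / 4 + c\<bar> \<le> (n + 1) * X"
proof -
  have "n * 1 \<le> n * X" using assms by (intro mult_left_mono) auto
  then have "n + X \<le> (n + 1) * X" by (simp add: algebra_simps)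
  with assms show ?thesis by linarith
qed

lemma decay_comparable:
  fixes w :: "'a::euclidean_space"
  assumes "0 < r" "r / 2 \<le> s" "s \<le> 2 * r"
  shows "decay s w \<le> 2 ^ (2 * DIM('a) + 3) * decay r w"
proof -
  let ?n = "DIM('a)"
  have s: "s > 0" using assms by linarith
  have "(r / 2) ^ ?n \<le> s ^ ?n" using assms by (intro power_mono) auto
  then have "r ^ ?n \<le> 2 ^ ?n * s ^ ?n" by (simp add: field_simps power_divide)
  then have 1: "inverse (s ^ ?n) \<le> 2 ^ ?n * inverse (r ^ ?n)"
    using assms s by (intro inverse_le_inverse_mult) auto
  have "norm w / r \<le> 2 * (norm w / s)"
    using mult_left_mono[OF assms(3), of "norm w"] assms s by (simp add: field_simps)
  then have "1 + norm w / r \<le> 2 * (1 + norm w / s)" by simp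
  then have "(1 + norm w / r) ^ (?n + 3) \<le> (2 * (1 + norm w / s)) ^ (?n + 3)"
    using assms by (intro power_mono) auto
  then have X: "(1 + norm w / r) ^ (?n + 3) \<le> 2 ^ (?n + 3) * (1 + norm w / s) ^ (?n + 3)"
    by (simp only: power_mult_distrib)
  have 2: "inverse ((1 + norm w / s) ^ (?n + 3)) \<le> 2 ^ (?n + 3) * inverse ((1 + norm w / r) ^ (?n + 3))"
  proof (rule inverse_le_inverse_mult)
    show "0 < (1 + norm w / s) ^ (?n + 3)" "0 < (1 + norm w / r) ^ (?n + 3)"
      by (intro zero_less_power add_pos_nonneg divide_nonneg_pos norm_ge_zero zero_less_one s assms)+
    show "(1 + norm w / r) ^ (?n + 3) \<le> 2 ^ (?n + 3) * (1 + norm w / s) ^ (?n + 3)" by (fact X)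
  qed
  have "decay s w \<le> (2 ^ ?n * inverse (r ^ ?n)) * (2 ^ (?n + 3) * inverse ((1 + norm w / r) ^ (?n + 3)))"
    unfolding decay_def using 1 2 assms s by (intro mult_mono) auto
  also have "\<dots> = 2 ^ (2 * ?n + 3) * decay r w"
    unfolding decay_def mult_2 power_add by (simp only: mult_ac)
  finally show ?thesis .
qed

lemma heat_kernel_deriv_le_decay:
  "\<exists>C>0. \<forall>r>0. \<forall>w::'a::euclidean_space. r\<^sup>2 * \<bar>heat_kernel_deriv (r\<^sup>2) w\<bar> \<le> C * decay r w"
proof -
  obtain C where C: "C > 0" "\<And>r w. r > 0 \<Longrightarrow> heat_kernel (r\<^sup>2) (w::'a) * (1 + norm w / r) ^ 4 \<le> C * decay r w"
    using heat_kernel_le_decay by metis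
  have "r\<^sup>2 * \<bar>heat_kernel_deriv (r\<^sup>2) w\<bar> \<le> (real DIM('a) + 1) * C * decay r w" if r: "r > 0" for r and w :: 'a
  proof -
    define q where "q = norm w / r"
    have q: "q \<ge> 0" using r by (simp add: q_def)
    have e: "r\<^sup>2 * ((norm w)\<^sup>2 / (4 * (r\<^sup>2)\<^sup>2) - real DIM('a) / (2 * r\<^sup>2)) = q\<^sup>2 / 4 - real DIM('a) / 2"
      using r by (simp add: q_def field_simps power2_eq_square)
    have "q\<^sup>2 \<le> (1 + q) ^ 2" "1 \<le> (1 + q) ^ 2" "(1 + q)^2 \<le> (1 + q) ^ 4"
      using q by (auto intro!: power_mono power_increasing)
    then have "\<bar>q\<^sup>2 / 4 - real DIM('a) / 2\<bar> \<le> (real DIM('a) + 1) * (1 + q) ^ 4"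
      using quadratic_abs_le[of "q\<^sup>2" "(1 + q) ^ 4" "real DIM('a)" "- (real DIM('a) / 2)"] by simp
    then have "heat_kernel (r\<^sup>2) w * \<bar>q\<^sup>2 / 4 - real DIM('a) / 2\<bar>
       \<le> heat_kernel (r\<^sup>2) w * ((real DIM('a) + 1) * (1 + q) ^ 4)"
      by (intro mult_left_mono) auto
    also have "\<dots> \<le> (real DIM('a) + 1) * (C * decay r w)"
      using mult_left_mono[OF C(2)[OF r, of w], of "real DIM('a) + 1"] by (simp add: q_def mult_ac)
    finally show ?thesis
      unfolding heat_kernel_deriv_def
      by (simp add: abs_mult mult.left_commute[of "r\<^sup>2"] e[symmetric] mult.assoc)
  qed
  with C(1) show ?thesis by (intro exI[of _ "(real DIM('a) + 1) * C"]) auto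
qed

text \<open>The kernel is radial, so the mean value theorem is applied to the one-dimensional
  profile \<open>\<theta>\<close> in the variable \<open>norm w / r\<close>, and the reverse
  triangle inequality returns to \<open>norm (x - y)\<close>. The distance \<open>2 * r\<close> is
  that of two points of a ball of radius \<open>r\<close>.\<close>

lemma heat_kernel_deriv_diff_le_decay:
  "\<exists>C>0. \<forall>r>0. \<forall>x y::'a::euclidean_space. norm (x - y) \<le> 2 * r \<longrightarrow>
     r\<^sup>2 * \<bar>heat_kernel_deriv (r\<^sup>2) x - heat_kernel_deriv (r\<^sup>2) y\<bar> \<le> C * (norm (x - y) / r) * decay r x"
proof (intro exI conjI allI impI)
  let ?c = "(4 * pi) powr (- (real DIM('a) / 2))" and ?n = "DIM('a)"
  \<comment> \<open>The exponent \<open>n + 6\<close> is the decay exponent \<open>n + 3\<close>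
    plus the degree 3 of the polynomial factor of \<open>\<theta>'\<close>; \<open>exp 5\<close> is
    \<open>exp (c + 2)\<close> for the shift \<open>c = 3\<close>.\<close>
  let ?K = "(real ?n + 1) * (fact (?n + 6) * exp 5)"
  show "?c * ?K > 0" by simp
  define \<theta> where "\<theta> q = (q\<^sup>2 / 4 - real ?n / 2) * exp (- q\<^sup>2 / 4)" for q
  define \<theta>' where "\<theta>' q = (q / 2) * (1 + real ?n / 2 - q\<^sup>2 / 4) * exp (- q\<^sup>2 / 4)" for q
  have d: "(\<theta> has_real_derivative \<theta>' q) (at q)" for q
    unfolding \<theta>_def \<theta>'_def
    by (auto intro!: derivative_eq_intros simp: field_simps power2_eq_square)
  have \<theta>'_bd: "(3 + q) ^ (?n + 3) * \<bar>\<theta>' q\<bar> \<le> ?K" if q: "q \<ge> 0" for q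
  proof -
    have "q \<le> 3 + q" "q\<^sup>2 \<le> (3 + q)\<^sup>2" "1 \<le> (3 + q)\<^sup>2" using q
      by (auto intro!: power_mono one_le_power)
    then have "\<bar>1 + real ?n / 2 - q\<^sup>2 / 4\<bar> \<le> (real ?n + 1) * (3 + q)\<^sup>2"
      using quadratic_abs_le[of "q\<^sup>2" "(3 + q)\<^sup>2" "real ?n" "- 1 - real ?n / 2"]
      by (simp add: abs_minus_commute algebra_simps)
    then have "\<bar>(q / 2) * (1 + real ?n / 2 - q\<^sup>2 / 4)\<bar> \<le> (3 + q) * ((real ?n + 1) * (3 + q)\<^sup>2)"
      using q unfolding abs_mult by (intro mult_mono) auto
    then have "\<bar>\<theta>' q\<bar> \<le> (3 + q) * ((real ?n + 1) * (3 + q)\<^sup>2) * exp (- q\<^sup>2 / 4)"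
      unfolding \<theta>'_def abs_mult by (simp add: mult_right_mono)
    then have "(3 + q) ^ (?n + 3) * \<bar>\<theta>' q\<bar>
        \<le> (3 + q) ^ (?n + 3) * ((3 + q) * ((real ?n + 1) * (3 + q)\<^sup>2) * exp (- q\<^sup>2 / 4))"
      using q by (intro mult_left_mono) auto
    also have "\<dots> = (real ?n + 1) * ((3 + q) ^ (?n + 6) * exp (- q\<^sup>2 / 4))"
      by (simp add: power_add power2_eq_square power3_eq_cube eval_nat_numeral mult_ac)
    also have "\<dots> \<le> (real ?n + 1) * (fact (?n + 6) * exp (3 + 2))"
      using q by (intro mult_left_mono power_times_gaussian_quarter_le) auto
    finally show ?thesis by simp
  qed
  fix r :: real and x y :: 'a assume r: "r > 0" and xy: "norm (x - y) \<le> 2 * r"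
  define a where "a = norm x / r"
  define b where "b = norm y / r"
  have ab: "0 \<le> a" "0 \<le> b" using r by (auto simp: a_def b_def)
  have dist: "\<bar>a - b\<bar> \<le> norm (x - y) / r"
    using norm_triangle_ineq3[of x y] r unfolding a_def b_def diff_divide_distrib[symmetric]
    by (simp add: divide_right_mono)
  also have "\<dots> \<le> 2" using xy r by (simp add: field_simps)
  finally have ab2: "\<bar>a - b\<bar> \<le> 2" .
  have key: "\<bar>\<theta> a - \<theta> b\<bar> \<le> \<bar>a - b\<bar> * (?K * inverse ((1 + a) ^ (?n + 3)))"
  proof -
    \<comment> \<open>Since \<open>a\<close> and \<open>b\<close> differ by at most 2, the
      intermediate point is at least \<open>a - 2\<close>. Hence
      \<open>1 + a \<le> 3 + \<xi>\<close>, and the bound at \<open>\<xi>\<close> becomes decay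
      centred at \<open>x\<close>; this is why \<open>\<theta>'_bd\<close> is weighted by
      \<open>3 + q\<close>.\<close>
    have "\<exists>\<xi>\<ge>0. \<xi> \<ge> a - 2 \<and> \<bar>\<theta> a - \<theta> b\<bar> = \<bar>a - b\<bar> * \<bar>\<theta>' \<xi>\<bar>"
    proof (cases a b rule: linorder_cases)
      case less
      with MVT2[of a b \<theta> \<theta>'] d obtain \<xi> where "a < \<xi>" "\<xi> < b" "\<theta> b - \<theta> a = (b - a) * \<theta>' \<xi>" by blast
      moreover from this have "\<bar>\<theta> a - \<theta> b\<bar> = \<bar>a - b\<bar> * \<bar>\<theta>' \<xi>\<bar>"
        by (metis abs_minus_commute abs_mult)
      ultimately show ?thesis using ab by (intro exI[of _ \<xi>]) auto
    next
      case equal then show ?thesis using ab by (intro exI[of _ a]) auto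
    next
      case greater
      with MVT2[of b a \<theta> \<theta>'] d obtain \<xi> where "b < \<xi>" "\<xi> < a" "\<theta> a - \<theta> b = (a - b) * \<theta>' \<xi>" by blast
      then show ?thesis using ab ab2 by (intro exI[of _ \<xi>]) (auto simp: abs_mult)
    qed
    then obtain \<xi> where \<xi>: "\<xi> \<ge> 0" "\<xi> \<ge> a - 2" "\<bar>\<theta> a - \<theta> b\<bar> = \<bar>a - b\<bar> * \<bar>\<theta>' \<xi>\<bar>" by blast
    have "(1 + a) ^ (?n + 3) * \<bar>\<theta>' \<xi>\<bar> \<le> (3 + \<xi>) ^ (?n + 3) * \<bar>\<theta>' \<xi>\<bar>"
      using \<xi> ab by (intro mult_right_mono power_mono) auto
    also have "\<dots> \<le> ?K" using \<theta>'_bd[OF \<xi>(1)] .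
    finally have "\<bar>\<theta>' \<xi>\<bar> \<le> ?K * inverse ((1 + a) ^ (?n + 3))"
      using ab by (simp add: field_simps)
    then show ?thesis unfolding \<xi>(3) by (intro mult_left_mono) auto
  qed
  also have "\<dots> \<le> (norm (x - y) / r) * (?K * inverse ((1 + a) ^ (?n + 3)))"
    using dist ab by (intro mult_right_mono mult_nonneg_nonneg) auto
  finally have key2: "\<bar>\<theta> a - \<theta> b\<bar> \<le> (norm (x - y) / r) * (?K * inverse ((1 + a) ^ (?n + 3)))" .
  have "r\<^sup>2 * \<bar>heat_kernel_deriv (r\<^sup>2) x - heat_kernel_deriv (r\<^sup>2) y\<bar>
      = \<bar>r\<^sup>2 * heat_kernel_deriv (r\<^sup>2) x - r\<^sup>2 * heat_kernel_deriv (r\<^sup>2) y\<bar>"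
    by (simp add: abs_mult flip: right_diff_distrib)
  also have "\<dots> = ?c * inverse (r ^ ?n) * \<bar>\<theta> a - \<theta> b\<bar>"
    unfolding heat_kernel_deriv_square[OF r] \<theta>_def a_def b_def
    using r by (simp add: abs_mult flip: right_diff_distrib)
  also have "\<dots> \<le> ?c * inverse (r ^ ?n) * ((norm (x - y) / r) * (?K * inverse ((1 + a) ^ (?n + 3))))"
    using r by (intro mult_left_mono key2) auto
  finally show "r\<^sup>2 * \<bar>heat_kernel_deriv (r\<^sup>2) x - heat_kernel_deriv (r\<^sup>2) y\<bar>
      \<le> ?c * ?K * (norm (x - y) / r) * decay r x"
    by (simp add: decay_def a_def mult_ac)
qed

text \<open>At these times the kernel dominates a multiple of the normalised indicator of the ball,
  so an average over the ball is bounded by a heat average.\<close>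

lemma heat_kernel_lower_bound:
  "\<exists>c>0. \<forall>r>0. \<forall>s w::'a::euclidean_space. norm w \<le> r \<longrightarrow> r\<^sup>2 \<le> s \<longrightarrow> s \<le> 2 * r\<^sup>2 \<longrightarrow>
     c * inverse (r ^ DIM('a)) \<le> heat_kernel s w"
proof (intro exI conjI allI impI)
  let ?c = "(4 * pi) powr (- (real DIM('a) / 2))" and ?n = "DIM('a)"
  show "?c * inverse (2 ^ ?n) * exp (- 1 / 4) > 0" by simp
  fix r s :: real and w :: 'a
  assume r: "r > 0" and w: "norm w \<le> r" and s1: "r\<^sup>2 \<le> s" and s2: "s \<le> 2 * r\<^sup>2"
  define t where "t = sqrt s"
  have "0 < r\<^sup>2" using r by simp
  then have st: "s = t\<^sup>2" using s1 unfolding t_def by (intro real_sqrt_pow2[symmetric]) linarith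
  have t: "r \<le> t" "t > 0" using r s1 \<open>0 < r\<^sup>2\<close> order_less_le_trans[OF \<open>0 < r\<^sup>2\<close> s1]
    by (auto simp: t_def intro: real_le_rsqrt)
  have "s \<le> (2 * r)\<^sup>2" 
  proof -
    have "s \<le> 4 * r\<^sup>2" using s2 \<open>0 < r\<^sup>2\<close> by linarith
    then show ?thesis by (simp add: power_mult_distrib)
  qed
  then have t2: "t \<le> 2 * r" using r by (simp add: t_def real_le_lsqrt)
  have "t ^ ?n \<le> 2 ^ ?n * r ^ ?n"
    using t t2 by (metis less_eq_real_def power_mono power_mult_distrib)
  then have 1: "inverse (2 ^ ?n) * inverse (r ^ ?n) \<le> inverse (t ^ ?n)"
    using r t by (simp add: field_simps)
  have "norm w / t \<le> 1" using w t by (simp add: field_simps)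
  then have "(norm w / t)\<^sup>2 \<le> 1" using t by (intro power_le_one) auto
  then have 2: "exp (- 1 / 4) \<le> exp (- (norm w / t)\<^sup>2 / 4)" by simp
  have "?c * ((inverse (2 ^ ?n) * inverse (r ^ ?n)) * exp (- 1 / 4))
     \<le> ?c * (inverse (t ^ ?n) * exp (- (norm w / t)\<^sup>2 / 4))"
    using 1 2 r t by (intro mult_left_mono mult_mono) auto
  then show "?c * inverse (2 ^ ?n) * exp (- 1 / 4) * inverse (r ^ ?n) \<le> heat_kernel s w"
    unfolding st heat_kernel_square[OF t(2)] by (simp add: mult_ac)
qed

text \<open>The factor \<open>4 ^ j\<close> admits the quadratic growth in \<open>j\<close> of the mean squares of a BMO function over
  the balls of radius \<open>2 ^ j r\<close>; the exponent \<open>n + 3\<close> in \<^const>\<open>decay\<close> still leaves a convergent series.\<close>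

lemma decay_nn_integral_le:
  "\<exists>C>0. \<forall>r>0. \<forall>z::'a::euclidean_space. \<forall>K\<ge>0. \<forall>F\<in>borel_measurable borel.
     (\<forall>j. (\<integral>\<^sup>+y\<in>ball z (2 ^ j * r). F y \<partial>lborel) \<le> ennreal (K * 4 ^ j * (2 ^ j * r) ^ DIM('a))) \<longrightarrow>
     (\<integral>\<^sup>+y. ennreal (decay r (z - y)) * F y \<partial>lborel) \<le> ennreal (C * K)"
proof (intro exI conjI allI impI ballI)
  let ?n = "DIM('a)"
  show "0 < (2::real) ^ (?n + 4)" by simp
  fix r K :: real and z :: 'a and F :: "'a \<Rightarrow> ennreal"
  assume r: "r > 0" and K: "K \<ge> 0" and F[measurable]: "F \<in> borel_measurable borel"
    and bd: "\<forall>j. (\<integral>\<^sup>+y\<in>ball z (2 ^ j * r). F y \<partial>lborel) \<le> ennreal (K * 4 ^ j * (2 ^ j * r) ^ ?n)"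
  have [measurable]: "ball z e \<in> sets borel" for e by simp
  \<comment> \<open>\<open>w j\<close> bounds the weight on the annulus between
    \<open>2 ^ (j - 1) * r\<close> and \<open>2 ^ j * r\<close>; the factor
    \<open>2 ^ (n + 3)\<close> pays for using the outer radius where the inner one governs the
    decay.\<close>
  define w where "w j = inverse (r ^ ?n) * 2 ^ (?n + 3) * inverse ((2 ^ (?n + 3)) ^ j)" for j :: nat
  have w0: "w j \<ge> 0" for j using r by (simp add: w_def)
  have pointwise: "ennreal (decay r (z - y)) \<le> (\<Sum>j. ennreal (w j) * indicator (ball z (2 ^ j * r)) y)" for y
  proof -
    define P where "P j \<longleftrightarrow> norm (z - y) < 2 ^ j * r" for j :: nat
    obtain i :: nat where "norm (z - y) / r < 2 ^ i" using real_arch_pow[of 2] by auto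
    then have "P i" using r by (simp add: P_def field_simps)
    define j where "j = (LEAST j. P j)"
    have j: "P j" unfolding j_def by (rule LeastI[of P, OF \<open>P i\<close>])
    have "decay r (z - y) \<le> w j"
    proof (cases j)
      case 0
      have "inverse ((1 + norm (z - y) / r) ^ (?n + 3)) \<le> 2 ^ (?n + 3)"
        using r order_trans[OF inverse_le_1_iff[THEN iffD2] one_le_power[of "2::real" "?n + 3"]]
        by (auto intro!: one_le_power)
      then show ?thesis using r by (simp add: decay_def w_def 0)
    next
      case (Suc i)
      then have "\<not> P i" unfolding j_def using not_less_Least[of i P] by simp
      then have "2 ^ i \<le> 1 + norm (z - y) / r" using r by (simp add: P_def field_simps)
      then have "(2 ^ i) ^ (?n + 3) \<le> (1 + norm (z - y) / r) ^ (?n + 3)" by (intro power_mono) auto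
      then have "inverse ((1 + norm (z - y) / r) ^ (?n + 3)) \<le> inverse ((2 ^ i) ^ (?n + 3))"
        by (intro le_imp_inverse_le) auto
      also have "\<dots> = 2 ^ (?n + 3) * inverse ((2 ^ (?n + 3)) ^ j)"
        unfolding Suc by (simp add: power_mult[symmetric] mult.commute power_add[symmetric] field_simps)
      finally show ?thesis using r unfolding decay_def w_def by (simp add: mult.assoc)
    qed
    then have "ennreal (decay r (z - y)) \<le> ennreal (w j) * indicator (ball z (2 ^ j * r)) y"
      using j by (simp add: P_def dist_norm ennreal_leI)
    also have "\<dots> \<le> (\<Sum>j. ennreal (w j) * indicator (ball z (2 ^ j * r)) y)"
      using sum_le_suminf[of "\<lambda>j. ennreal (w j) * indicator (ball z (2 ^ j * r)) y" "{j}"]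
      by (simp del: sum_mult_indicator)
    finally show ?thesis .
  qed
  have "(\<integral>\<^sup>+y. ennreal (decay r (z - y)) * F y \<partial>lborel)
      \<le> (\<integral>\<^sup>+y. (\<Sum>j. ennreal (w j) * indicator (ball z (2 ^ j * r)) y) * F y \<partial>lborel)"
    by (intro nn_integral_mono mult_right_mono pointwise) auto
  also have "\<dots> = (\<integral>\<^sup>+y. (\<Sum>j. ennreal (w j) * (F y * indicator (ball z (2 ^ j * r)) y)) \<partial>lborel)"
    by (simp add: ennreal_suminf_multc[symmetric] mult_ac)
  also have "\<dots> = (\<Sum>j. ennreal (w j) * (\<integral>\<^sup>+y\<in>ball z (2 ^ j * r). F y \<partial>lborel))"
    by (subst nn_integral_suminf) (auto simp: nn_integral_cmult)
  also have "\<dots> \<le> (\<Sum>j. ennreal (w j) * ennreal (K * 4 ^ j * (2 ^ j * r) ^ ?n))"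
    using bd by (intro suminf_le mult_left_mono) auto
  also have "\<dots> = (\<Sum>j. ennreal (2 ^ (?n + 3) * K * (1 / 2) ^ j))"
  proof (intro suminf_cong)
    fix j :: nat
    have "(2 ^ (?n + 3)) ^ j = (2 ^ j) ^ ?n * 4 ^ j * (2::real) ^ j"
      by (simp add: power_add power_mult_distrib power_mult[symmetric] mult.commute)
        (simp flip: power_mult_distrib)
    then have "w j * (K * 4 ^ j * (2 ^ j * r) ^ ?n) = 2 ^ (?n + 3) * K * (1 / 2) ^ j"
      unfolding w_def using r by (simp add: power_mult_distrib power_divide field_simps)
    then show "ennreal (w j) * ennreal (K * 4 ^ j * (2 ^ j * r) ^ ?n) = ennreal (2 ^ (?n + 3) * K * (1 / 2) ^ j)"
      using w0 by (simp only: ennreal_mult'[symmetric])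
  qed
  also have "\<dots> = ennreal (\<Sum>j. 2 ^ (?n + 3) * K * (1 / 2) ^ j)"
    using K by (intro suminf_ennreal2 summable_mult summable_geometric) auto
  also have "(\<Sum>j. 2 ^ (?n + 3) * K * (1 / 2) ^ j) = 2 ^ (?n + 4) * K"
    by (subst suminf_mult) (auto simp: suminf_geometric summable_geometric power_add)
  finally show "(\<integral>\<^sup>+y. ennreal (decay r (z - y)) * F y \<partial>lborel) \<le> ennreal (2 ^ (?n + 4) * K)" .
qed

section \<open>Total mass and semigroup law of the heat kernel\<close>

lemma nn_integral_lborel_translate:
  fixes c :: "'a::euclidean_space"
  assumes [measurable]: "f \<in> borel_measurable borel"
  shows "(\<integral>\<^sup>+y. f (y - c) \<partial>lborel) = (\<integral>\<^sup>+y. f y \<partial>lborel)"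
proof -
  have "(\<integral>\<^sup>+y. f y \<partial>lborel) = (\<integral>\<^sup>+y. f y \<partial>(distr lborel borel ((+) (- c))))"
    by (simp add: lborel_distr_plus)
  also have "\<dots> = (\<integral>\<^sup>+y. f (y - c) \<partial>lborel)"
    by (subst nn_integral_distr) auto
  finally show ?thesis by simp
qed

text \<open>In each coordinate the kernel is a centred normal density of variance
  \<open>2 * t\<close>, which reduces the total mass to dimension one.\<close>

lemma heat_kernel_eq_prod:
  fixes w :: "'a::euclidean_space"
  assumes "t > 0"
  shows "heat_kernel t w = (\<Prod>b\<in>Basis. normal_density 0 (sqrt (2 * t)) (w \<bullet> b))"
proof -
  have "norm w ^ 2 = (\<Sum>b\<in>Basis. (w \<bullet> b)\<^sup>2)"
    unfolding power2_norm_eq_inner by (subst euclidean_inner) (simp add: power2_eq_square)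
  then have "- (norm w)\<^sup>2 / (4 * t) = (\<Sum>b\<in>Basis. - (w \<bullet> b)\<^sup>2 / (4 * t))"
    by (simp add: sum_divide_distrib sum_negf)
  moreover have "(4 * pi * t) powr (- (real DIM('a) / 2)) = (1 / sqrt (4 * pi * t)) ^ DIM('a)"
  proof -
    have "(1 / sqrt (4 * pi * t)) ^ DIM('a) = ((4 * pi * t) powr (- (1/2))) powr real DIM('a)"
      using assms by (subst powr_realpow) (auto simp: powr_minus powr_half_sqrt field_simps)
    then show ?thesis by (simp add: powr_powr)
  qed
  moreover have "(\<Prod>b\<in>Basis. normal_density 0 (sqrt (2 * t)) (w \<bullet> b))
      = (\<Prod>b\<in>(Basis::'a set). (1 / sqrt (4 * pi * t)) * exp (- (w \<bullet> b)\<^sup>2 / (4 * t)))"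
    using assms by (intro prod.cong refl) (simp add: normal_density_def mult_ac)
  ultimately show ?thesis
    by (simp only: heat_kernel_def prod.distrib prod_constant exp_sum finite_Basis)
qed

lemma nn_integral_heat_kernel_0:
  assumes "t > 0"
  shows "(\<integral>\<^sup>+w. heat_kernel t (w::'a::euclidean_space) \<partial>lborel) = 1"
proof -
  have *: "(\<integral>\<^sup>+x. ennreal (normal_density 0 (sqrt (2 * t)) x) \<partial>lborel) = 1"
    using assms by (subst nn_integral_eq_integral) auto
  have "(\<integral>\<^sup>+w. heat_kernel t (w::'a) \<partial>lborel)
      = (\<integral>\<^sup>+w. (\<Prod>b\<in>Basis. ennreal (normal_density 0 (sqrt (2 * t)) ((w::'a) \<bullet> b))) \<partial>lborel)"
    using assms by (intro nn_integral_cong) (simp add: heat_kernel_eq_prod prod_ennreal)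
  also have "\<dots> = (\<Prod>b\<in>(Basis::'a set). (\<integral>\<^sup>+x. ennreal (normal_density 0 (sqrt (2 * t)) x) \<partial>lborel))"
    by (rule nn_integral_lborel_prod) auto
  finally show ?thesis by (simp add: *)
qed

lemma nn_integral_heat_kernel:
  fixes x :: "'a::euclidean_space"
  assumes "t > 0"
  shows "(\<integral>\<^sup>+y. heat_kernel t (x - y) \<partial>lborel) = 1"
    and "(\<integral>\<^sup>+y. heat_kernel t (y - x) \<partial>lborel) = 1"
proof -
  show "(\<integral>\<^sup>+y. heat_kernel t (y - x) \<partial>lborel) = 1"
    using nn_integral_lborel_translate[of "\<lambda>w. ennreal (heat_kernel t w)" x]
    by (simp add: nn_integral_heat_kernel_0[OF assms])
  then show "(\<integral>\<^sup>+y. heat_kernel t (x - y) \<partial>lborel) = 1"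
    by (simp add: heat_kernel_commute)
qed

text \<open>Completing the square in \<open>y\<close>: inverse times add up, which gives
  \<open>s * t / (s + t)\<close>, and the new centre is the weighted mean of \<open>x\<close> and
  \<open>w\<close>. The second factor then has mass one, and the semigroup law follows at
  once.\<close>

lemma heat_kernel_mult:
  fixes x y w :: "'a::euclidean_space"
  assumes "s > 0" "t > 0"
  shows "heat_kernel s (x - y) * heat_kernel t (y - w)
    = heat_kernel (s + t) (x - w) * heat_kernel (s * t / (s + t)) (y - (t *\<^sub>R x + s *\<^sub>R w) /\<^sub>R (s + t))"
proof -
  define d where "d = (x - w) /\<^sub>R (s + t)"
  define e where "e = y - (t *\<^sub>R x + s *\<^sub>R w) /\<^sub>R (s + t)"
  have st: "s + t > 0" using assms by simp
  have xw: "x - w = (s + t) *\<^sub>R d" using st by (simp add: d_def)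
  have yd: "y - w = e + t *\<^sub>R d"
  proof -
    have "(s / (s + t)) *\<^sub>R w + (t / (s + t)) *\<^sub>R w = w"
      using st by (simp flip: scaleR_left_distrib add_divide_distrib)
    then show ?thesis
      unfolding e_def d_def by (simp add: algebra_simps divide_inverse)
  qed
  have xd: "x - y = s *\<^sub>R d - e"
    using xw yd by (simp add: algebra_simps)
  \<comment> \<open>In the coordinates \<open>d\<close> and \<open>e\<close> the mixed terms are
    \<open>- 2 * s * (d \<bullet> e)\<close> and \<open>2 * t * (d \<bullet> e)\<close>; after
    division by \<open>4 * s\<close> and \<open>4 * t\<close> they cancel.\<close>
  have quad: "(norm (x - y))\<^sup>2 / (4 * s) + (norm (y - w))\<^sup>2 / (4 * t)
      = (norm (x - w))\<^sup>2 / (4 * (s + t)) + (norm e)\<^sup>2 / (4 * (s * t / (s + t)))"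
  proof -
    have "(norm (x - y))\<^sup>2 = s\<^sup>2 * (d \<bullet> d) - 2 * s * (d \<bullet> e) + e \<bullet> e"
      and "(norm (y - w))\<^sup>2 = e \<bullet> e + 2 * t * (d \<bullet> e) + t\<^sup>2 * (d \<bullet> d)"
      and "(norm (x - w))\<^sup>2 = (s + t)\<^sup>2 * (d \<bullet> d)"
      unfolding xd yd xw power2_norm_eq_inner
      by (simp_all add: inner_diff_left inner_diff_right inner_add_left
          inner_add_right inner_commute[of e d] algebra_simps power2_eq_square)
    then show ?thesis
      unfolding power2_norm_eq_inner[of e] using assms st
      by (simp add: divide_simps) (simp add: algebra_simps power2_eq_square)
  qed
  have "(4 * pi * s) powr a * (4 * pi * t) powr a
      = (4 * pi * (s + t)) powr a * (4 * pi * (s * t / (s + t))) powr a" for a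
  proof -
    have "(4 * pi * s) * (4 * pi * t) = (4 * pi * (s + t)) * (4 * pi * (s * t / (s + t)))"
      using st by simp
    then show ?thesis by (simp only: powr_mult[symmetric])
  qed
  then show ?thesis
    unfolding heat_kernel_def e_def[symmetric]
    using quad by (simp add: mult_ac flip: exp_add)
qed

lemma heat_kernel_semigroup:
  fixes x w :: "'a::euclidean_space"
  assumes "s > 0" "t > 0"
  shows "(\<integral>\<^sup>+y. ennreal (heat_kernel s (x - y)) * ennreal (heat_kernel t (y - w)) \<partial>lborel)
    = ennreal (heat_kernel (s + t) (x - w))"
proof -
  have "(\<integral>\<^sup>+y. ennreal (heat_kernel s (x - y)) * ennreal (heat_kernel t (y - w)) \<partial>lborel)
      = (\<integral>\<^sup>+y. ennreal (heat_kernel (s + t) (x - w)) *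
           ennreal (heat_kernel (s * t / (s + t)) (y - (t *\<^sub>R x + s *\<^sub>R w) /\<^sub>R (s + t))) \<partial>lborel)"
    by (intro nn_integral_cong) (simp add: heat_kernel_mult[OF assms] flip: ennreal_mult)
  also have "\<dots> = ennreal (heat_kernel (s + t) (x - w))"
    using assms by (subst nn_integral_cmult) (auto simp: nn_integral_heat_kernel)
  finally show ?thesis .
qed

section \<open>The heat extension\<close>

text \<open>The counterpart of \<open>heat_semigroup\<close> over \<open>lborel\<close>, where
  Fubini and product measurability are available for Borel functions;
  \<open>heat_semigroup_eq_heat\<close> connects the two.\<close>

definition heat :: "('a::euclidean_space \<Rightarrow> 'b::euclidean_space) \<Rightarrow> real \<Rightarrow> 'a \<Rightarrow> 'b" where
  "heat f t x = (\<integral>y. heat_kernel t (x - y) *\<^sub>R f y \<partial>lborel)"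

definition heat_deriv :: "('a::euclidean_space \<Rightarrow> 'b::euclidean_space) \<Rightarrow> real \<Rightarrow> 'a \<Rightarrow> 'b" where
  "heat_deriv f t x = (\<integral>y. heat_kernel_deriv t (x - y) *\<^sub>R f y \<partial>lborel)"

text \<open>The class on which \<open>heat\<close> and \<open>heat_deriv\<close> converge absolutely
  at all positive times and differentiation under the integral is dominated. It contains the
  constants and the BMO functions.\<close>

definition tempered :: "('a::euclidean_space \<Rightarrow> 'b::euclidean_space) \<Rightarrow> bool" where
  "tempered f \<longleftrightarrow> f \<in> borel_measurable borel \<and>
     (\<forall>r>0. \<forall>x. integrable lborel (\<lambda>y. decay r (x - y) *\<^sub>R f y))"

lemma tempered_measurable [measurable_dest]: "tempered f \<Longrightarrow> f \<in> borel_measurable borel"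
  by (simp add: tempered_def)

lemma tempered_integrable: "tempered f \<Longrightarrow> r > 0 \<Longrightarrow> integrable lborel (\<lambda>y. decay r (x - y) *\<^sub>R f y)"
  by (simp add: tempered_def)

lemma nn_integral_decay_le:
  "\<exists>C>0. \<forall>r>0. \<forall>z::'a::euclidean_space. (\<integral>\<^sup>+y. ennreal (decay r (z - y)) \<partial>lborel) \<le> ennreal C"
proof -
  obtain C where C: "C > 0" and bd: "\<forall>r>0. \<forall>z::'a. \<forall>K\<ge>0. \<forall>F\<in>borel_measurable borel.
     (\<forall>j. (\<integral>\<^sup>+y\<in>ball z (2 ^ j * r). F y \<partial>lborel) \<le> ennreal (K * 4 ^ j * (2 ^ j * r) ^ DIM('a))) \<longrightarrow>
     (\<integral>\<^sup>+y. ennreal (decay r (z - y)) * F y \<partial>lborel) \<le> ennreal (C * K)"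
    using decay_nn_integral_le[where 'a = 'a] by blast
  define K where "K = unit_ball_vol (real DIM('a))"
  have K: "K > 0" by (simp add: K_def)
  have "(\<integral>\<^sup>+y. ennreal (decay r (z - y)) * 1 \<partial>lborel) \<le> ennreal (C * K)" if r: "r > 0" for r and z :: 'a
  proof (rule bd[rule_format, OF r])
    fix j :: nat
    have "K * (2 ^ j * r) ^ DIM('a) * 1 \<le> K * (2 ^ j * r) ^ DIM('a) * 4 ^ j"
      using K r by (intro mult_left_mono one_le_power) auto
    then have "ennreal (K * (2 ^ j * r) ^ DIM('a)) \<le> ennreal (K * 4 ^ j * (2 ^ j * r) ^ DIM('a))"
      by (intro ennreal_leI) (simp add: mult_ac)
    then show "(\<integral>\<^sup>+y\<in>ball z (2 ^ j * r). 1 \<partial>lborel) \<le> ennreal (K * 4 ^ j * (2 ^ j * r) ^ DIM('a))"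
      using r by (simp add: emeasure_ball K_def)
  qed (use K in auto)
  with C K show ?thesis by (intro exI[of _ "C * K"]) auto
qed

lemma tempered_const: "tempered (\<lambda>_::'a::euclidean_space. c)"
proof -
  obtain C where "C > 0" and C: "\<And>r z. r > 0 \<Longrightarrow> (\<integral>\<^sup>+y. ennreal (decay r (z - (y::'a))) \<partial>lborel) \<le> ennreal C"
    using nn_integral_decay_le by metis
  have "integrable lborel (\<lambda>y. decay r (x - y))" if "r > 0" for r and x :: 'a
    using that le_less_trans[OF C[OF that, of x]] by (intro integrableI_nonneg) auto
  then show ?thesis by (auto simp: tempered_def)
qed

lemma tempered_diff: "tempered f \<Longrightarrow> tempered g \<Longrightarrow> tempered (\<lambda>x. f x - g x)"
  by (auto simp: tempered_def scaleR_diff_right)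

lemma temperedI:
  fixes f :: "'a::euclidean_space \<Rightarrow> 'b::euclidean_space"
  assumes [measurable]: "f \<in> borel_measurable borel"
    and "\<And>r x. r > 0 \<Longrightarrow> (\<integral>\<^sup>+y. ennreal (decay r (x - y)) * ennreal (norm (f y)) \<partial>lborel) < \<infinity>"
  shows "tempered f"
  using assms by (auto simp: tempered_def integrable_iff_bounded ennreal_mult)

lemma tempered_nn_integral_finite:
  assumes "tempered f" "r > 0"
  shows "(\<integral>\<^sup>+y. ennreal (decay r (x - y)) * ennreal (norm (f y)) \<partial>lborel) < \<infinity>"
  using tempered_integrable[OF assms, of x] assms(2) by (simp add: integrable_iff_bounded ennreal_mult)

lemma integrable_of_decay:
  fixes f :: "'a::euclidean_space \<Rightarrow> 'b::euclidean_space"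
  assumes f: "tempered f" and "r > 0" and k[measurable]: "k \<in> borel_measurable borel"
    and le: "\<And>y. \<bar>k y\<bar> \<le> c * decay r (x - y)"
  shows "integrable lborel (\<lambda>y. k y *\<^sub>R f y)"
proof (rule Bochner_Integration.integrable_bound)
  show "integrable lborel (\<lambda>y. c *\<^sub>R (decay r (x - y) *\<^sub>R f y))"
    using tempered_integrable[OF f \<open>r > 0\<close>] by (intro integrable_scaleR_right)
  show "AE y in lborel. norm (k y *\<^sub>R f y) \<le> norm (c *\<^sub>R (decay r (x - y) *\<^sub>R f y))"
  proof (intro AE_I2)
    fix y
    have "\<bar>k y\<bar> * norm (f y) \<le> \<bar>c * decay r (x - y)\<bar> * norm (f y)"
      using le[of y] by (intro mult_right_mono) auto
    then show "norm (k y *\<^sub>R f y) \<le> norm (c *\<^sub>R (decay r (x - y) *\<^sub>R f y))"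
      by (simp add: abs_mult mult.assoc)
  qed
qed (use f in measurable)

lemma heat_kernel_le_decay_sqrt:
  "\<exists>C>0. \<forall>t>0. \<forall>w::'a::euclidean_space. heat_kernel t w \<le> C * decay (sqrt t) w"
proof -
  obtain C where C: "C > 0" "\<And>r w. r > 0 \<Longrightarrow> heat_kernel (r\<^sup>2) (w::'a) * (1 + norm w / r) ^ 4 \<le> C * decay r w"
    using heat_kernel_le_decay by metis
  have "heat_kernel t w \<le> C * decay (sqrt t) w" if t: "t > 0" for t and w :: 'a
  proof -
    have "heat_kernel t w * 1 \<le> heat_kernel t w * (1 + norm w / sqrt t) ^ 4"
      using t by (intro mult_left_mono one_le_power) auto
    then show ?thesis using C(2)[of "sqrt t" w] t by simp
  qed
  with C(1) show ?thesis by blast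
qed

lemma heat_integrable:
  assumes "tempered f" "t > 0"
  shows "integrable lborel (\<lambda>y. heat_kernel t (x - y) *\<^sub>R f y)"
  using heat_kernel_le_decay_sqrt[where 'a = 'a] assms
  by (elim exE conjE) (rule integrable_of_decay[OF assms(1), of "sqrt t"], auto)

text \<open>The bound is uniform for \<open>s\<close> in a neighbourhood of \<open>t\<close>, which dominates the difference quotients.\<close>

lemma heat_kernel_deriv_le_decay_near:
  "\<exists>C>0. \<forall>t>0. \<forall>s. t / 4 \<le> s \<longrightarrow> s \<le> 4 * t \<longrightarrow>
     (\<forall>w::'a::euclidean_space. t * \<bar>heat_kernel_deriv s w\<bar> \<le> C * decay (sqrt t) w)"
proof -
  obtain C where C: "C > 0" "\<And>r w. r > 0 \<Longrightarrow> r\<^sup>2 * \<bar>heat_kernel_deriv (r\<^sup>2) (w::'a)\<bar> \<le> C * decay r w"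
    using heat_kernel_deriv_le_decay by metis
  let ?D = "2 ^ (2 * DIM('a) + 3) :: real"
  have "t * \<bar>heat_kernel_deriv s w\<bar> \<le> 4 * C * ?D * decay (sqrt t) w"
    if t: "t > 0" "t / 4 \<le> s" "s \<le> 4 * t" for t s and w :: 'a
  proof -
    have s: "s > 0" using t by simp
    \<comment> \<open>A factor 4 in time is a factor 2 in scale, exactly the range of
      \<open>decay_comparable\<close>.\<close>
    have "sqrt (t / 4) \<le> sqrt s" "sqrt s \<le> sqrt (4 * t)"
      using t by (intro real_sqrt_le_mono; simp)+
    then have "decay (sqrt s) w \<le> ?D * decay (sqrt t) w"
      using t by (intro decay_comparable) (auto simp: real_sqrt_divide real_sqrt_mult)
    have "t * \<bar>heat_kernel_deriv s w\<bar> \<le> 4 * (s * \<bar>heat_kernel_deriv s w\<bar>)"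
      using t mult_right_mono[of t "4 * s" "\<bar>heat_kernel_deriv s w\<bar>"] by simp
    also have "\<dots> \<le> 4 * (C * decay (sqrt s) w)"
      using C(2)[of "sqrt s" w] s by simp
    also have "\<dots> \<le> 4 * (C * (?D * decay (sqrt t) w))"
      using C(1) \<open>decay (sqrt s) w \<le> _\<close> by simp
    finally show ?thesis by (simp add: mult_ac)
  qed
  with C(1) show ?thesis by (intro exI[of _ "4 * C * ?D"]) auto
qed

lemma heat_deriv_integrable:
  fixes f :: "'a::euclidean_space \<Rightarrow> 'b::euclidean_space"
  assumes "tempered f" "t > 0"
  shows "integrable lborel (\<lambda>y. heat_kernel_deriv t (x - y) *\<^sub>R f y)"
proof -
  obtain C where C: "C > 0" "\<And>t s w. t > 0 \<Longrightarrow> t / 4 \<le> s \<Longrightarrow> s \<le> 4 * t \<Longrightarrow>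
     t * \<bar>heat_kernel_deriv s (w::'a)\<bar> \<le> C * decay (sqrt t) w"
    using heat_kernel_deriv_le_decay_near by metis
  show ?thesis
    by (rule integrable_of_decay[OF assms(1), of "sqrt t" _ "C / t"])
       (use C(2)[of t t] assms(2) in \<open>auto simp: field_simps\<close>)
qed

lemma heat_kernel_has_derivative:
  assumes "t > 0"
  shows "((\<lambda>t. heat_kernel t w) has_real_derivative heat_kernel_deriv t w) (at t)"
proof -
  have "((\<lambda>t. (4 * pi * t) powr a) has_real_derivative a / t * (4 * pi * t) powr a) (at t)" for a
    using assms by (auto intro!: derivative_eq_intros simp: powr_diff field_simps)
  moreover have "((\<lambda>t. exp (- (norm w)\<^sup>2 / (4 * t))) has_real_derivative
      (norm w)\<^sup>2 / (4 * t\<^sup>2) * exp (- (norm w)\<^sup>2 / (4 * t))) (at t)"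
    using assms by (auto intro!: derivative_eq_intros simp: field_simps power2_eq_square)
  ultimately have "((\<lambda>t. heat_kernel t w) has_real_derivative
      (- (real DIM('a) / 2) / t * (4 * pi * t) powr (- (real DIM('a) / 2))) * exp (- (norm w)\<^sup>2 / (4 * t))
      + ((norm w)\<^sup>2 / (4 * t\<^sup>2) * exp (- (norm w)\<^sup>2 / (4 * t))) * (4 * pi * t) powr (- (real DIM('a) / 2))) (at t)"
    unfolding heat_kernel_def by (rule DERIV_mult)
  then show ?thesis
    by (rule DERIV_cong) (simp add: heat_kernel_deriv_def heat_kernel_def algebra_simps)
qed

lemma heat_has_vector_derivative:
  fixes f :: "'a::euclidean_space \<Rightarrow> 'b::euclidean_space"
  assumes f: "tempered f" and t: "t > 0"
  shows "((\<lambda>s. heat f s x) has_vector_derivative heat_deriv f t x) (at t)"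
proof -
  note [measurable] = tempered_measurable[OF f]
  obtain C where C: "C > 0" "\<And>t s w. t > 0 \<Longrightarrow> t / 4 \<le> s \<Longrightarrow> s \<le> 4 * t \<Longrightarrow>
     t * \<bar>heat_kernel_deriv s (w::'a)\<bar> \<le> C * decay (sqrt t) w"
    using heat_kernel_deriv_le_decay_near by metis
  let ?S = "{t / 4<..<4 * t}"
  \<comment> \<open>The mean value theorem in time identifies the difference quotient with
    \<open>heat_kernel_deriv\<close> at a time inside \<open>?S\<close>, where the bound is
    uniform.\<close>
  have quot: "\<bar>(heat_kernel s w - heat_kernel t w) / (s - t)\<bar> \<le> C / t * decay (sqrt t) w"
    if s: "s \<in> ?S - {t}" for s and w :: 'a
  proof -
    have "\<exists>\<xi>\<in>?S. (heat_kernel s w - heat_kernel t w) / (s - t) = heat_kernel_deriv \<xi> w"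
    proof (cases "s < t")
      case True
      have "\<exists>\<xi>. s < \<xi> \<and> \<xi> < t \<and> heat_kernel t w - heat_kernel s w = (t - s) * heat_kernel_deriv \<xi> w"
        using True s t by (intro MVT2 heat_kernel_has_derivative) auto
      then obtain \<xi> where "s < \<xi>" "\<xi> < t" "heat_kernel t w - heat_kernel s w = (t - s) * heat_kernel_deriv \<xi> w"
        by blast
      then show ?thesis using s t True by (intro bexI[of _ \<xi>]) (auto simp: field_simps)
    next
      case False
      have "\<exists>\<xi>. t < \<xi> \<and> \<xi> < s \<and> heat_kernel s w - heat_kernel t w = (s - t) * heat_kernel_deriv \<xi> w"
        using False s t by (intro MVT2 heat_kernel_has_derivative) auto
      then obtain \<xi> where "t < \<xi>" "\<xi> < s" "heat_kernel s w - heat_kernel t w = (s - t) * heat_kernel_deriv \<xi> w"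
        by blast
      then show ?thesis using s t False by (intro bexI[of _ \<xi>]) (auto simp: field_simps)
    qed
    then obtain \<xi> where "\<xi> \<in> ?S" and e: "(heat_kernel s w - heat_kernel t w) / (s - t) = heat_kernel_deriv \<xi> w" by blast
    then show ?thesis unfolding e using C(2)[OF t, of \<xi> w] t by (simp add: field_simps)
  qed
  \<comment> \<open>Dominated convergence is sequential, so the limit is tested along sequences in
    \<open>?S\<close>; as \<open>?S\<close> is an open neighbourhood of \<open>t\<close>, nothing is
    lost.\<close>
  have "((\<lambda>s. (heat f s x - heat f t x) /\<^sub>R (s - t)) \<longlongrightarrow> heat_deriv f t x) (at t within ?S)"
    unfolding tendsto_at_iff_sequentially
  proof (intro allI impI)
    fix X :: "nat \<Rightarrow> real"
    assume X: "\<forall>i. X i \<in> ?S - {t}" and lim: "X \<longlonglongrightarrow> t"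
    have X0: "X i > 0" for i using X t by (auto dest: spec[of _ i])
    define k where "k i y = (heat_kernel (X i) (x - y) - heat_kernel t (x - y)) / (X i - t)" for i y
    have "(\<lambda>i. \<integral>y. k i y *\<^sub>R f y \<partial>lborel) \<longlonglongrightarrow> (\<integral>y. heat_kernel_deriv t (x - y) *\<^sub>R f y \<partial>lborel)"
    proof (rule integral_dominated_convergence)
      show "integrable lborel (\<lambda>y. norm ((C / t) *\<^sub>R (decay (sqrt t) (x - y) *\<^sub>R f y)))"
        using tempered_integrable[OF f, of "sqrt t"] t by (intro integrable_norm integrable_scaleR_right) auto
      show "AE y in lborel. (\<lambda>i. k i y *\<^sub>R f y) \<longlonglongrightarrow> heat_kernel_deriv t (x - y) *\<^sub>R f y"
      proof (intro AE_I2 tendsto_scaleR tendsto_const)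
        fix y
        have "((\<lambda>s. (heat_kernel s (x - y) - heat_kernel t (x - y)) / (s - t)) \<longlongrightarrow> heat_kernel_deriv t (x - y)) (at t)"
          using heat_kernel_has_derivative[OF t, of "x - y"] by (simp add: has_field_derivative_iff)
        then show "(\<lambda>i. k i y) \<longlonglongrightarrow> heat_kernel_deriv t (x - y)"
          unfolding tendsto_at_iff_sequentially k_def using X lim by (auto simp: comp_def)
      qed
      show "AE y in lborel. norm (k i y *\<^sub>R f y) \<le> norm ((C / t) *\<^sub>R (decay (sqrt t) (x - y) *\<^sub>R f y))" for i
      proof (intro AE_I2)
        fix y
        have "\<bar>k i y\<bar> \<le> \<bar>C / t * decay (sqrt t) (x - y)\<bar>"
          unfolding k_def using X by (intro order_trans[OF quot abs_ge_self]) auto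
        then have "\<bar>k i y\<bar> * norm (f y) \<le> \<bar>C / t * decay (sqrt t) (x - y)\<bar> * norm (f y)"
          by (intro mult_right_mono) auto
        then show "norm (k i y *\<^sub>R f y) \<le> norm ((C / t) *\<^sub>R (decay (sqrt t) (x - y) *\<^sub>R f y))"
          by (simp add: abs_mult mult.assoc)
      qed
    qed (unfold k_def, measurable)
    moreover have "(\<integral>y. k i y *\<^sub>R f y \<partial>lborel) = (heat f (X i) x - heat f t x) /\<^sub>R (X i - t)" for i
    proof -
      have "(\<integral>y. k i y *\<^sub>R f y \<partial>lborel)
          = (\<integral>y. inverse (X i - t) *\<^sub>R (heat_kernel (X i) (x - y) *\<^sub>R f y - heat_kernel t (x - y) *\<^sub>R f y) \<partial>lborel)"
        by (intro Bochner_Integration.integral_cong refl)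
           (simp add: k_def divide_inverse algebra_simps)
      also have "\<dots> = inverse (X i - t) *\<^sub>R
          (\<integral>y. heat_kernel (X i) (x - y) *\<^sub>R f y - heat_kernel t (x - y) *\<^sub>R f y \<partial>lborel)"
        by simp
      also have "\<dots> = (heat f (X i) x - heat f t x) /\<^sub>R (X i - t)"
        unfolding heat_def
        by (subst Bochner_Integration.integral_diff) (auto intro!: heat_integrable f t X0)
      finally show ?thesis .
    qed
    ultimately show "((\<lambda>s. (heat f s x - heat f t x) /\<^sub>R (s - t)) \<circ> X) \<longlonglongrightarrow> heat_deriv f t x"
      by (simp add: comp_def heat_deriv_def)
  qed
  moreover have "at t within ?S = at t"
    using t by (intro at_within_open) auto
  ultimately have "((\<lambda>s. (heat f s x - heat f t x) /\<^sub>R (s - t)) \<longlongrightarrow> heat_deriv f t x) (at t)"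
    by simp
  then have "((\<lambda>s. norm ((heat f s x - heat f t x) /\<^sub>R (s - t) - heat_deriv f t x)) \<longlongrightarrow> 0) (at t)"
    by (intro tendsto_norm_zero LIM_zero)
  moreover have "norm ((heat f s x - heat f t x) /\<^sub>R (s - t) - heat_deriv f t x)
      = norm (heat f s x - heat f t x - (s - t) *\<^sub>R heat_deriv f t x) / norm (s - t)" if "s \<noteq> t" for s
  proof -
    have "(heat f s x - heat f t x) /\<^sub>R (s - t) - heat_deriv f t x
      = (heat f s x - heat f t x - (s - t) *\<^sub>R heat_deriv f t x) /\<^sub>R (s - t)"
      using that by (simp add: scaleR_diff_right)
    then show ?thesis by (simp add: divide_inverse)
  qed
  then have "\<forall>\<^sub>F s in at t. norm ((heat f s x - heat f t x) /\<^sub>R (s - t) - heat_deriv f t x)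
      = norm (heat f s x - heat f t x - (s - t) *\<^sub>R heat_deriv f t x) / norm (s - t)"
    by (simp add: eventually_at_filter)
  ultimately have "((\<lambda>s. norm (heat f s x - heat f t x - (s - t) *\<^sub>R heat_deriv f t x) / norm (s - t)) \<longlongrightarrow> 0) (at t)"
    by (rule Lim_transform_eventually)
  then show ?thesis
    by (simp add: has_vector_derivative_def has_derivative_iff_norm bounded_linear_scaleR_left)
qed

lemma heat_const: "t > 0 \<Longrightarrow> heat (\<lambda>_. c) t x = c"
proof -
  assume t: "t > 0"
  have "(\<integral>y. heat_kernel t (x - y) \<partial>lborel) = 1"
    using nn_integral_heat_kernel(1)[OF t, of x] by (intro integral_eq_nn_integral[THEN trans]) auto
  then show ?thesis
    using heat_integrable[OF tempered_const[of "1::real"] t, of x] by (simp add: heat_def)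
qed

lemma heat_diff:
  assumes "tempered f" "tempered g" "t > 0"
  shows "heat (\<lambda>y. f y - g y) t x = heat f t x - heat g t x"
  unfolding heat_def scaleR_diff_right
  by (intro Bochner_Integration.integral_diff heat_integrable assms)

lemma heat_diff_const:
  assumes "tempered f" "t > 0"
  shows "heat (\<lambda>y. f y - c) t x = heat f t x - c"
  using heat_diff[OF assms(1) tempered_const assms(2), of c x] heat_const[OF assms(2)] by simp

text \<open>This is the mean-zero property of \<open>heat_kernel_deriv\<close>. It comes from
  differentiating \<open>heat_diff_const\<close> and uniqueness of derivatives, without computing an
  integral.\<close>

lemma heat_deriv_diff_const:
  fixes f :: "'a::euclidean_space \<Rightarrow> 'b::euclidean_space"
  assumes f: "tempered f" and t: "t > 0"
  shows "heat_deriv (\<lambda>y. f y - c) t x = heat_deriv f t x"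
proof -
  have "((\<lambda>s. heat (\<lambda>y. f y - c) s x) has_vector_derivative heat_deriv (\<lambda>y. f y - c) t x) (at t)"
    by (intro heat_has_vector_derivative tempered_diff f tempered_const t)
  moreover have "((\<lambda>s. heat f s x - c) has_vector_derivative heat_deriv f t x) (at t)"
    using heat_has_vector_derivative[OF f t] by (auto intro!: derivative_eq_intros)
  then have "((\<lambda>s. heat (\<lambda>y. f y - c) s x) has_vector_derivative heat_deriv f t x) (at t)"
    by (rule has_vector_derivative_transform_within_open[of _ _ _ "{0<..}"])
       (use t in \<open>auto simp: heat_diff_const[OF f]\<close>)
  ultimately show ?thesis by (rule vector_derivative_unique_at)
qed

lemma heat_measurable [measurable]:
  assumes [measurable]: "f \<in> borel_measurable borel"
  shows "(\<lambda>(t, x). heat f t x) \<in> borel_measurable (borel \<Otimes>\<^sub>M borel)"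
  unfolding heat_def by measurable

lemma heat_deriv_measurable [measurable]:
  assumes [measurable]: "f \<in> borel_measurable borel"
  shows "(\<lambda>(t, x). heat_deriv f t x) \<in> borel_measurable (borel \<Otimes>\<^sub>M borel)"
  unfolding heat_deriv_def by measurable

text \<open>For nonnegative functions Tonelli needs no integrability. This form serves the squares
  in the Carleson estimate and supplies the absolute integrability behind Fubini in
  \<open>heat_heat\<close>.\<close>

lemma heat_semigroup_nn:
  fixes \<phi> :: "'a::euclidean_space \<Rightarrow> ennreal"
  assumes [measurable]: "\<phi> \<in> borel_measurable borel" and "s > 0" "t > 0"
  shows "(\<integral>\<^sup>+y. ennreal (heat_kernel s (x - y)) * (\<integral>\<^sup>+w. ennreal (heat_kernel t (y - w)) * \<phi> w \<partial>lborel) \<partial>lborel)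
    = (\<integral>\<^sup>+w. ennreal (heat_kernel (s + t) (x - w)) * \<phi> w \<partial>lborel)"
proof -
  have "(\<integral>\<^sup>+y. ennreal (heat_kernel s (x - y)) * (\<integral>\<^sup>+w. ennreal (heat_kernel t (y - w)) * \<phi> w \<partial>lborel) \<partial>lborel)
      = (\<integral>\<^sup>+y. (\<integral>\<^sup>+w. ennreal (heat_kernel s (x - y)) * (ennreal (heat_kernel t (y - w)) * \<phi> w) \<partial>lborel) \<partial>lborel)"
    by (intro nn_integral_cong) (simp add: nn_integral_cmult)
  also have "\<dots> = (\<integral>\<^sup>+w. (\<integral>\<^sup>+y. ennreal (heat_kernel s (x - y)) * (ennreal (heat_kernel t (y - w)) * \<phi> w) \<partial>lborel) \<partial>lborel)"
    by (intro lborel_pair.Fubini') measurable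
  also have "\<dots> = (\<integral>\<^sup>+w. (\<integral>\<^sup>+y. (ennreal (heat_kernel s (x - y)) * ennreal (heat_kernel t (y - w))) * \<phi> w \<partial>lborel) \<partial>lborel)"
    by (simp add: mult.assoc)
  also have "\<dots> = (\<integral>\<^sup>+w. ennreal (heat_kernel (s + t) (x - w)) * \<phi> w \<partial>lborel)"
    using assms by (intro nn_integral_cong) (simp add: nn_integral_multc heat_kernel_semigroup)
  finally show ?thesis .
qed

lemma heat_heat:
  fixes f :: "'a::euclidean_space \<Rightarrow> 'b::euclidean_space"
  assumes f: "tempered f" and s: "s > 0" and t: "t > 0"
  shows "heat (heat f t) s x = heat f (s + t) x"
proof -
  note [measurable] = tempered_measurable[OF f]
  let ?g = "\<lambda>(y, w). heat_kernel s (x - y) *\<^sub>R heat_kernel t (y - w) *\<^sub>R f w"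
  have int: "integrable (lborel \<Otimes>\<^sub>M lborel) ?g"
  proof (rule integrableI_bounded)
    show "?g \<in> borel_measurable (lborel \<Otimes>\<^sub>M lborel)" by measurable
    have "(\<integral>\<^sup>+p. ennreal (norm (?g p)) \<partial>(lborel \<Otimes>\<^sub>M lborel))
        = (\<integral>\<^sup>+y. (\<integral>\<^sup>+w. ennreal (norm (?g (y, w))) \<partial>lborel) \<partial>lborel)"
      by (intro lborel.nn_integral_fst[symmetric]) measurable
    also have "\<dots> = (\<integral>\<^sup>+y. ennreal (heat_kernel s (x - y)) *
        (\<integral>\<^sup>+w. ennreal (heat_kernel t (y - w)) * ennreal (norm (f w)) \<partial>lborel) \<partial>lborel)"
      by (intro nn_integral_cong) (simp add: nn_integral_cmult[symmetric] ennreal_mult mult.assoc)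
    also have "\<dots> = (\<integral>\<^sup>+w. ennreal (heat_kernel (s + t) (x - w)) * ennreal (norm (f w)) \<partial>lborel)"
      using s t by (intro heat_semigroup_nn) auto
    also have "\<dots> < \<infinity>"
      using heat_integrable[OF f, of "s + t" x] s t by (simp add: integrable_iff_bounded ennreal_mult)
    finally show "(\<integral>\<^sup>+p. ennreal (norm (?g p)) \<partial>(lborel \<Otimes>\<^sub>M lborel)) < \<infinity>" .
  qed
  have "heat (heat f t) s x = (\<integral>y. (\<integral>w. ?g (y, w) \<partial>lborel) \<partial>lborel)"
    by (simp add: heat_def del: scaleR_scaleR)
  also have "\<dots> = (\<integral>w. (\<integral>y. ?g (y, w) \<partial>lborel) \<partial>lborel)"
    using lborel_pair.Fubini_integral[OF int] by simp
  also have "\<dots> = (\<integral>w. heat_kernel (s + t) (x - w) *\<^sub>R f w \<partial>lborel)"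
  proof (intro Bochner_Integration.integral_cong refl)
    fix w
    have "has_bochner_integral lborel (\<lambda>y. heat_kernel s (x - y) * heat_kernel t (y - w)) (heat_kernel (s + t) (x - w))"
      using heat_kernel_semigroup[OF s t, of x w]
      by (intro has_bochner_integral_nn_integral) (auto simp: ennreal_mult)
    then have "has_bochner_integral lborel (\<lambda>y. (heat_kernel s (x - y) * heat_kernel t (y - w)) *\<^sub>R f w)
        (heat_kernel (s + t) (x - w) *\<^sub>R f w)"
      by (rule has_bochner_integral_scaleR_left)
    then show "(\<integral>y. ?g (y, w) \<partial>lborel) = heat_kernel (s + t) (x - w) *\<^sub>R f w"
      by (simp add: has_bochner_integral_iff)
  qed
  finally show ?thesis by (simp add: heat_def)
qed

text \<open>The kernel centred at \<open>x\<close> is a probability density under which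
  \<open>f\<close> has mean \<open>heat f t x\<close>; this is the decomposition of a second moment
  about \<open>c\<close> into variance and squared bias. It is additive because subtraction in
  \<open>ennreal\<close> truncates.\<close>

lemma heat_variance:
  fixes f :: "'a::euclidean_space \<Rightarrow> 'b::euclidean_space"
  assumes f: "tempered f" and t: "t > 0"
    and fin: "(\<integral>\<^sup>+y. ennreal (heat_kernel t (x - y)) * ennreal ((norm (f y - c))\<^sup>2) \<partial>lborel) < \<infinity>"
  shows "(\<integral>\<^sup>+y. ennreal (heat_kernel t (x - y)) * ennreal ((norm (f y - heat f t x))\<^sup>2) \<partial>lborel)
      + ennreal ((norm (heat f t x - c))\<^sup>2)
    = (\<integral>\<^sup>+y. ennreal (heat_kernel t (x - y)) * ennreal ((norm (f y - c))\<^sup>2) \<partial>lborel)"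
proof -
  note [measurable] = tempered_measurable[OF f]
  define d where "d = heat f t x"
  let ?k = "\<lambda>y. heat_kernel t (x - y)"
  have i1: "integrable lborel ?k" "(\<integral>y. ?k y \<partial>lborel) = 1"
    using heat_integrable[OF tempered_const[of "1::real"] t, of x] heat_const[OF t, of "1::real" x]
    by (simp_all add: heat_def)
  have fc: "tempered (\<lambda>y. f y - c)" by (intro tempered_diff f tempered_const)
  have i2: "integrable lborel (\<lambda>y. ?k y *\<^sub>R (f y - c))" "(\<integral>y. ?k y *\<^sub>R (f y - c) \<partial>lborel) = d - c"
    using heat_integrable[OF fc t, of x] heat_diff_const[OF f t, of c x] by (simp_all add: heat_def d_def)
  have i3: "integrable lborel (\<lambda>y. ?k y * (norm (f y - c))\<^sup>2)"
    using fin by (intro integrableI_nonneg) (auto simp: ennreal_mult)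
  have eq: "?k y * (norm (f y - d))\<^sup>2
      = ?k y * (norm (f y - c))\<^sup>2 - 2 * (?k y * ((f y - c) \<bullet> (d - c))) + ?k y * (norm (d - c))\<^sup>2" for y
  proof -
    have "(norm (f y - d))\<^sup>2 = (norm ((f y - c) - (d - c)))\<^sup>2" by simp
    also have "\<dots> = (norm (f y - c))\<^sup>2 - 2 * ((f y - c) \<bullet> (d - c)) + (norm (d - c))\<^sup>2"
      unfolding power2_norm_eq_inner by (simp add: inner_diff_left inner_diff_right inner_commute)
    finally show ?thesis
      by (simp only: distrib_left right_diff_distrib mult.left_commute)
  qed
  have i5: "integrable lborel (\<lambda>y. ?k y * ((f y - c) \<bullet> (d - c)))"
      "(\<integral>y. ?k y * ((f y - c) \<bullet> (d - c)) \<partial>lborel) = (d - c) \<bullet> (d - c)"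
    using integrable_inner_left[OF i2(1), of "d - c"] integral_inner_left[OF i2(1), of "d - c"] i2(2) by simp_all
  have i4: "integrable lborel (\<lambda>y. ?k y * (norm (f y - d))\<^sup>2)"
    unfolding eq using i1 i5 i3 by auto
  have "(\<integral>y. ?k y * (norm (f y - d))\<^sup>2 \<partial>lborel)
      = (\<integral>y. ?k y * (norm (f y - c))\<^sup>2 \<partial>lborel) - 2 * ((d - c) \<bullet> (d - c)) + (norm (d - c))\<^sup>2"
    unfolding eq using i1 i5 i3 by simp
  then have e: "(\<integral>y. ?k y * (norm (f y - d))\<^sup>2 \<partial>lborel) + (norm (d - c))\<^sup>2
      = (\<integral>y. ?k y * (norm (f y - c))\<^sup>2 \<partial>lborel)"
    by (simp add: power2_norm_eq_inner)
  have "(\<integral>\<^sup>+y. ennreal (?k y) * ennreal ((norm (f y - e))\<^sup>2) \<partial>lborel) = ennreal (\<integral>y. ?k y * (norm (f y - e))\<^sup>2 \<partial>lborel)"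
    if "integrable lborel (\<lambda>y. ?k y * (norm (f y - e))\<^sup>2)" for e
    using nn_integral_eq_integral[OF that] by (simp add: ennreal_mult)
  from this[OF i3] this[OF i4] show ?thesis
    unfolding d_def[symmetric] by (simp add: e[symmetric] ennreal_plus[symmetric] del: ennreal_plus)
qed

text \<open>Since \<open>heat_kernel_deriv\<close> has mean zero, the Cauchy-Schwarz inequality bounds
  \<open>t \<partial>\<^sub>t W\<^sub>t f\<close> by the variance of \<open>f\<close> under the heat kernel.\<close>

lemma heat_deriv_le_variance:
  "\<exists>C>0. \<forall>f::'a::euclidean_space \<Rightarrow> 'b::euclidean_space. \<forall>t>0. \<forall>x c. tempered f \<longrightarrow>
     ennreal ((norm (t *\<^sub>R heat_deriv f t x))\<^sup>2) + ennreal C * ennreal ((norm (heat f t x - c))\<^sup>2)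
     \<le> ennreal C * (\<integral>\<^sup>+y. ennreal (heat_kernel t (x - y)) * ennreal ((norm (f y - c))\<^sup>2) \<partial>lborel)"
proof -
  define n where "n = real DIM('a)"
  obtain C where C: "C > 0" "\<And>r w. r > 0 \<Longrightarrow> heat_kernel (r\<^sup>2) (w::'a) * (1 + norm w / r) ^ 4 \<le> C * decay r w"
    using heat_kernel_le_decay[where 'a = 'a] by blast
  obtain D where D: "D > 0" "\<And>r z. r > 0 \<Longrightarrow> (\<integral>\<^sup>+y. ennreal (decay r (z - (y::'a))) \<partial>lborel) \<le> ennreal D"
    using nn_integral_decay_le[where 'a = 'a] by blast
  define E where "E = (n + 1)\<^sup>2 * C * D"
  have n0: "n \<ge> 0" by (simp add: n_def)
  have E: "E > 0" using C D n0 by (simp add: E_def add_nonneg_pos)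
  have main: "ennreal ((norm (t *\<^sub>R heat_deriv f t x))\<^sup>2) + ennreal E * ennreal ((norm (heat f t x - c))\<^sup>2)
     \<le> ennreal E * (\<integral>\<^sup>+y. ennreal (heat_kernel t (x - y)) * ennreal ((norm (f y - c))\<^sup>2) \<partial>lborel)"
    if f: "tempered f" and t: "t > 0" for f :: "'a \<Rightarrow> 'b" and t x c
  proof (cases "(\<integral>\<^sup>+y. ennreal (heat_kernel t (x - y)) * ennreal ((norm (f y - c))\<^sup>2) \<partial>lborel) < \<infinity>")
    case False
    then have "(\<integral>\<^sup>+y. ennreal (heat_kernel t (x - y)) * ennreal ((norm (f y - c))\<^sup>2) \<partial>lborel) = \<infinity>"
      by (simp add: less_top[symmetric])
    then show ?thesis using E by (simp add: ennreal_mult_eq_top_iff ennreal_top_mult ennreal_mult_top)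
  next
    case True
    note [measurable] = tempered_measurable[OF f]
    define d where "d = heat f t x"
    define \<kappa> where "\<kappa> y = (norm (x - y))\<^sup>2 / (4 * t) - n / 2" for y
    have \<kappa>[measurable]: "\<kappa> \<in> borel_measurable borel" unfolding \<kappa>_def by measurable
    have fd: "tempered (\<lambda>y. f y - d)" by (intro tempered_diff f tempered_const)
    have tk: "t * heat_kernel_deriv t (x - y) = heat_kernel t (x - y) * \<kappa> y" for y
      using t by (simp add: heat_kernel_deriv_def \<kappa>_def n_def field_simps power2_eq_square)
    have "t *\<^sub>R heat_deriv f t x = (\<integral>y. (heat_kernel t (x - y) * \<kappa> y) *\<^sub>R (f y - d) \<partial>lborel)"
      by (subst heat_deriv_diff_const[OF f t, of d x, symmetric])
        (simp add: heat_deriv_def tk[symmetric] flip: scaleR_scaleR)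
    moreover have "integrable lborel (\<lambda>y. (heat_kernel t (x - y) * \<kappa> y) *\<^sub>R (f y - d))"
      unfolding tk[symmetric] scaleR_scaleR[symmetric]
      by (intro integrable_scaleR_right heat_deriv_integrable fd t)
    ultimately have "ennreal (norm (t *\<^sub>R heat_deriv f t x))
        \<le> (\<integral>\<^sup>+y. ennreal (norm ((heat_kernel t (x - y) * \<kappa> y) *\<^sub>R (f y - d))) \<partial>lborel)"
      by (simp only: integral_norm_bound_ennreal)
    \<comment> \<open>The kernel is shared as two square roots, so that Cauchy-Schwarz yields the
      second moment of \<open>\<kappa>\<close> and the variance of \<open>f\<close> under the same
      density.\<close>
    also have "\<dots> = (\<integral>\<^sup>+y. ennreal (sqrt (heat_kernel t (x - y)) * \<bar>\<kappa> y\<bar>) * ennreal (sqrt (heat_kernel t (x - y)) * norm (f y - d)) \<partial>lborel)"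
    proof (intro nn_integral_cong)
      fix y
      have "norm ((heat_kernel t (x - y) * \<kappa> y) *\<^sub>R (f y - d))
          = (sqrt (heat_kernel t (x - y)) * sqrt (heat_kernel t (x - y))) * \<bar>\<kappa> y\<bar> * norm (f y - d)"
        by (simp add: abs_mult)
      also have "\<dots> = (sqrt (heat_kernel t (x - y)) * \<bar>\<kappa> y\<bar>) * (sqrt (heat_kernel t (x - y)) * norm (f y - d))"
        by (simp only: mult_ac)
      finally show "ennreal (norm ((heat_kernel t (x - y) * \<kappa> y) *\<^sub>R (f y - d)))
          = ennreal (sqrt (heat_kernel t (x - y)) * \<bar>\<kappa> y\<bar>) * ennreal (sqrt (heat_kernel t (x - y)) * norm (f y - d))"
        by (subst ennreal_mult'[symmetric]) (auto simp del: norm_scaleR)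
    qed
    finally have "(ennreal (norm (t *\<^sub>R heat_deriv f t x)))\<^sup>2
        \<le> (\<integral>\<^sup>+y. ennreal (sqrt (heat_kernel t (x - y)) * \<bar>\<kappa> y\<bar>) * ennreal (sqrt (heat_kernel t (x - y)) * norm (f y - d)) \<partial>lborel)\<^sup>2"
      by (intro power_mono) auto
    also have "\<dots> \<le> (\<integral>\<^sup>+y. (ennreal (sqrt (heat_kernel t (x - y)) * \<bar>\<kappa> y\<bar>))\<^sup>2 \<partial>lborel) *
        (\<integral>\<^sup>+y. (ennreal (sqrt (heat_kernel t (x - y)) * norm (f y - d)))\<^sup>2 \<partial>lborel)"
      by (intro Cauchy_Schwarz_nn_integral) measurable
    also have "(\<integral>\<^sup>+y. (ennreal (sqrt (heat_kernel t (x - y)) * norm (f y - d)))\<^sup>2 \<partial>lborel)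
        = (\<integral>\<^sup>+y. ennreal (heat_kernel t (x - y)) * ennreal ((norm (f y - d))\<^sup>2) \<partial>lborel)" (is "_ = ?V")
      by (intro nn_integral_cong) (simp add: ennreal_power power_mult_distrib flip: ennreal_mult)
    \<comment> \<open>\<open>\<kappa>\<close> depends only on \<open>norm (x - y) / sqrt t\<close>,
      so its second moment is bounded independently of \<open>t\<close>; the spare fourth power of
      \<open>heat_kernel_le_decay\<close> absorbs \<open>\<kappa>\<^sup>2\<close>.\<close>
    also have "(\<integral>\<^sup>+y. (ennreal (sqrt (heat_kernel t (x - y)) * \<bar>\<kappa> y\<bar>))\<^sup>2 \<partial>lborel) \<le> ennreal E"
    proof -
      have "(\<integral>\<^sup>+y. (ennreal (sqrt (heat_kernel t (x - y)) * \<bar>\<kappa> y\<bar>))\<^sup>2 \<partial>lborel)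
          \<le> (\<integral>\<^sup>+y. ennreal ((n + 1)\<^sup>2 * C) * ennreal (decay (sqrt t) (x - y)) \<partial>lborel)"
      proof (intro nn_integral_mono)
        fix y
        define q where "q = norm (x - y) / sqrt t"
        have q: "q \<ge> 0" using t by (simp add: q_def)
        have \<kappa>q: "\<kappa> y = q\<^sup>2 / 4 + - (n / 2)"
          using t by (simp add: \<kappa>_def q_def power_divide)
        have "\<bar>\<kappa> y\<bar> \<le> (n + 1) * (1 + q)\<^sup>2"
          unfolding \<kappa>q using q n0 by (intro quadratic_abs_le power_mono one_le_power) auto
        then have "\<bar>\<kappa> y\<bar>\<^sup>2 \<le> ((n + 1) * (1 + q)\<^sup>2)\<^sup>2" by (intro power_mono) auto
        also have "\<dots> = (n + 1)\<^sup>2 * (1 + q) ^ 4" by (simp add: power_mult_distrib)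
        finally have "heat_kernel t (x - y) * \<bar>\<kappa> y\<bar>\<^sup>2 \<le> heat_kernel t (x - y) * ((n + 1)\<^sup>2 * (1 + q) ^ 4)"
          by (intro mult_left_mono) auto
        also have "\<dots> \<le> (n + 1)\<^sup>2 * (C * decay (sqrt t) (x - y))"
          using mult_left_mono[OF C(2)[of "sqrt t" "x - y"], of "(n + 1)\<^sup>2"] t by (simp add: q_def mult_ac)
        finally show "(ennreal (sqrt (heat_kernel t (x - y)) * \<bar>\<kappa> y\<bar>))\<^sup>2
            \<le> ennreal ((n + 1)\<^sup>2 * C) * ennreal (decay (sqrt t) (x - y))"
          using t C n0 by (simp add: ennreal_power power_mult_distrib mult.assoc flip: ennreal_mult)
      qed
      also have "\<dots> \<le> ennreal ((n + 1)\<^sup>2 * C) * ennreal D"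
        using D(2)[of "sqrt t" x] t by (simp add: nn_integral_cmult mult_left_mono)
      finally show ?thesis using C D n0 unfolding E_def by (simp flip: ennreal_mult)
    qed
    finally have 1: "ennreal ((norm (t *\<^sub>R heat_deriv f t x))\<^sup>2) \<le> ennreal E * ?V"
      by (simp add: ennreal_power mult_right_mono)
    have "ennreal E * ?V + ennreal E * ennreal ((norm (heat f t x - c))\<^sup>2)
       = ennreal E * (\<integral>\<^sup>+y. ennreal (heat_kernel t (x - y)) * ennreal ((norm (f y - c))\<^sup>2) \<partial>lborel)"
      unfolding heat_variance[OF f t True, symmetric] d_def by (simp add: distrib_left)
    then show ?thesis
      using add_right_mono[OF 1, of "ennreal E * ennreal ((norm (heat f t x - c))\<^sup>2)"] by (simp only:)
  qed
  show ?thesis using E main by blast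
qed

section \<open>The John-Nirenberg inequality for dyadic means\<close>

text \<open>A martingale on a uniformly branching tree, without a probability space:
  \<open>s\<close> is a node and \<open>ch e s\<close>, for \<open>e \<in> E\<close>, are its
  equally likely children. It will be used for cubes and their halves.\<close>

locale tree_martingale =
  fixes E :: "'e set" and ch :: "'e \<Rightarrow> 's \<Rightarrow> 's" and m :: "'s \<Rightarrow> 'b::euclidean_space"
  assumes E: "finite E" "E \<noteq> {}"
    and mean: "m s = (\<Sum>e\<in>E. m (ch e s)) /\<^sub>R card E"
begin

text \<open>The expectation of \<open>\<phi>\<close> after \<open>k\<close> uniformly random steps
  from \<open>s\<close>.\<close>

primrec lev :: "nat \<Rightarrow> ('s \<Rightarrow> real) \<Rightarrow> 's \<Rightarrow> real" where
  "lev 0 \<phi> s = \<phi> s"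
| "lev (Suc k) \<phi> s = (\<Sum>e\<in>E. lev k \<phi> (ch e s)) / card E"

lemma card_pos: "0 < card E"
  using E by (simp add: card_gt_0_iff)

lemma lev_const [simp]: "lev k (\<lambda>_. c) s = c"
  using card_pos by (induction k arbitrary: s) auto

lemma lev_add: "lev k (\<lambda>s. \<phi> s + \<psi> s) s = lev k \<phi> s + lev k \<psi> s"
  by (induction k arbitrary: s) (auto simp: sum.distrib add_divide_distrib)

lemma lev_cmult: "lev k (\<lambda>s. c * \<phi> s) s = c * lev k \<phi> s"
  by (induction k arbitrary: s) (auto simp flip: sum_distrib_left)

lemma lev_nonneg: "(\<And>s. 0 \<le> \<phi> s) \<Longrightarrow> 0 \<le> lev k \<phi> s"
proof (induction k arbitrary: s)
  case (Suc k)
  then have "0 \<le> lev k \<phi> s" for s by blast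
  then show ?case by (simp add: sum_nonneg)
qed simp

text \<open>The martingale property over \<open>k\<close> steps, tested against a vector because
  \<open>lev\<close> averages real functions only.\<close>

lemma lev_inner: "lev k (\<lambda>s. m s \<bullet> v) s = m s \<bullet> v"
proof (induction k arbitrary: s)
  case (Suc k)
  show ?case
    by (subst mean[of s]) (simp add: Suc inner_sum_left divide_inverse mult.commute)
qed simp

text \<open>Jensen's inequality for the norm. It turns an exit from a ball into a lower bound for
  the expected distance.\<close>

lemma lev_norm_ge: "norm (m s - c) \<le> lev k (\<lambda>s. norm (m s - c)) s"
proof (induction k arbitrary: s)
  case (Suc k)
  have "m s - c = (\<Sum>e\<in>E. m (ch e s) - c) /\<^sub>R card E"
    using card_pos by (subst mean[of s]) (simp add: sum_subtractf scaleR_diff_right sum_constant_scaleR)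
  then have "norm (m s - c) \<le> (\<Sum>e\<in>E. norm (m (ch e s) - c)) / card E"
    using norm_sum[of "\<lambda>e. m (ch e s) - c" E] by (simp add: divide_inverse mult.commute mult_left_mono)
  also have "\<dots> \<le> lev (Suc k) (\<lambda>s. norm (m s - c)) s"
    using Suc by (simp add: divide_right_mono sum_mono)
  finally show ?case .
qed simp

text \<open>Orthogonality of martingale increments: the cross term has expectation zero by
  \<open>lev_inner\<close>.\<close>

lemma lev_norm_square:
  "lev k (\<lambda>s'. (norm (m s' - c))\<^sup>2) s = lev k (\<lambda>s'. (norm (m s' - m s))\<^sup>2) s + (norm (m s - c))\<^sup>2"
proof -
  have eq: "(norm (m s' - c))\<^sup>2
      = (norm (m s' - m s))\<^sup>2 + (2 * (m s' \<bullet> (m s - c)) + ((norm (m s - c))\<^sup>2 - 2 * (m s \<bullet> (m s - c))))" for s'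
    unfolding power2_norm_eq_inner by (simp add: inner_diff_left inner_diff_right inner_commute)
  have "lev k (\<lambda>s'. (norm (m s' - c))\<^sup>2) s = lev k (\<lambda>s'. (norm (m s' - m s))\<^sup>2
      + (2 * (m s' \<bullet> (m s - c)) + ((norm (m s - c))\<^sup>2 - 2 * (m s \<bullet> (m s - c))))) s"
    by (intro arg_cong[where f = "\<lambda>\<phi>. lev k \<phi> s"] ext) (rule eq)
  then show ?thesis
    by (simp add: lev_add lev_cmult lev_inner)
qed

text \<open>Follow the martingale from \<open>s\<^sub>0\<close> until it leaves the ball of radius \<open>2 a\<close> about \<open>m s\<^sub>0\<close>. By the
  \<open>L\<^sup>1\<close> bound this happens with probability at most \<open>1/2\<close>, and from the exit point on the bound for
  shorter times applies. Instead of a stopping time, the induction over \<open>k\<close> carries the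
  \<open>L\<^sup>1\<close> distance, which dominates the exit probability.\<close>

theorem john_nirenberg_square:
  assumes a: "a > 0" and jump: "\<And>e s. e \<in> E \<Longrightarrow> norm (m (ch e s) - m s) \<le> a"
    and L1: "\<And>k s. lev k (\<lambda>s'. norm (m s' - m s)) s \<le> a"
  shows "lev N (\<lambda>s'. (norm (m s' - m s))\<^sup>2) s \<le> 17 * a\<^sup>2"
proof (induction N arbitrary: s rule: less_induct)
  case (less N)
  define c where "c = m s"
  \<comment> \<open>The expected square from an exit node on: the exit distance is at most
    \<open>2 * a\<close> plus one jump, and the induction hypothesis bounds the later variance. With
    exit probability at most 1/2 the constant must satisfy \<open>X = 4 + (9 + X) / 2\<close>, so
    \<open>X = 17\<close>.\<close>
  let ?B = "(2 * a + a)\<^sup>2 + 17 * a\<^sup>2"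
  have key: "lev k (\<lambda>s'. (norm (m s' - c))\<^sup>2) s'
      \<le> (2 * a)\<^sup>2 + ?B * (lev k (\<lambda>s'. norm (m s' - c)) s' / (2 * a))"
    if "k \<le> N" "norm (m s' - c) \<le> 2 * a" for k s'
    using that
  proof (induction k arbitrary: s')
    case 0
    then have "(norm (m s' - c))\<^sup>2 \<le> (2 * a)\<^sup>2" by (intro power_mono) auto
    moreover have "0 \<le> ?B * (norm (m s' - c) / (2 * a))" using a by simp
    ultimately show ?case unfolding lev.simps by linarith
  next
    case (Suc k)
    have "lev k (\<lambda>s'. (norm (m s' - c))\<^sup>2) (ch e s')
      \<le> (2 * a)\<^sup>2 + ?B * (lev k (\<lambda>s'. norm (m s' - c)) (ch e s') / (2 * a))" if e: "e \<in> E" for e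
    proof (cases "norm (m (ch e s') - c) \<le> 2 * a")
      case True
      then show ?thesis using Suc by simp
    next
      case False
      have "norm (m (ch e s') - c) \<le> 2 * a + a"
        using norm_triangle_le[of "m (ch e s') - m s'" "m s' - c" "2 * a + a"] jump[OF e, of s'] Suc.prems(2)
        by simp
      then have "(norm (m (ch e s') - c))\<^sup>2 \<le> (2 * a + a)\<^sup>2" by (intro power_mono) auto
      then have "lev k (\<lambda>s'. (norm (m s' - c))\<^sup>2) (ch e s') \<le> ?B * 1"
        using less[of k "ch e s'"] Suc.prems(1) unfolding lev_norm_square[of k c] by simp
      \<comment> \<open>Outside the ball the expected distance exceeds \<open>2 * a\<close> by
        \<open>lev_norm_ge\<close>, so the inserted quotient is at least 1.\<close>
      also have "\<dots> \<le> ?B * (lev k (\<lambda>s'. norm (m s' - c)) (ch e s') / (2 * a))"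
        using lev_norm_ge[of "ch e s'" c k] False a by (intro mult_left_mono) (auto simp: field_simps)
      also have "\<dots> \<le> (2 * a)\<^sup>2 + \<dots>" by simp
      finally show ?thesis .
    qed
    then have "(\<Sum>e\<in>E. lev k (\<lambda>s'. (norm (m s' - c))\<^sup>2) (ch e s'))
        \<le> (\<Sum>e\<in>E. (2 * a)\<^sup>2 + ?B * (lev k (\<lambda>s'. norm (m s' - c)) (ch e s') / (2 * a)))"
      by (intro sum_mono)
    also have "\<dots> = card E * ((2 * a)\<^sup>2 + ?B * (lev (Suc k) (\<lambda>s'. norm (m s' - c)) s' / (2 * a)))"
      using card_pos a
      by (simp add: sum.distrib distrib_left sum_distrib_left[symmetric] sum_divide_distrib[symmetric])
    finally show ?case
      using card_pos by (simp add: divide_le_eq mult.commute)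
  qed
  have "lev N (\<lambda>s'. (norm (m s' - c))\<^sup>2) s \<le> (2 * a)\<^sup>2 + ?B * (lev N (\<lambda>s'. norm (m s' - c)) s / (2 * a))"
    using a by (intro key) (auto simp: c_def)
  also have "\<dots> \<le> (2 * a)\<^sup>2 + ?B * (a / (2 * a))"
    using L1[of N s] a unfolding c_def by (intro add_left_mono mult_left_mono divide_right_mono) auto
  also have "\<dots> = 17 * a\<^sup>2"
    using a by (simp add: power2_eq_square algebra_simps)
  finally show ?case unfolding c_def .
qed

end

section \<open>Cubes and their dyadic halves\<close>

text \<open>Half-open, so that the \<open>2 ^ n\<close> half-size cubes partition the cube exactly
  and no null sets have to be discarded.\<close>

definition cube :: "'a::euclidean_space \<Rightarrow> real \<Rightarrow> 'a set" where
  "cube x l = {y. \<forall>b\<in>Basis. x \<bullet> b \<le> y \<bullet> b \<and> y \<bullet> b < x \<bullet> b + l}"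

text \<open>Nodes are pairs of lower corner and side; \<open>S\<close> lists the coordinates in
  which the upper half is taken, and the sum over \<open>S\<close> is the resulting shift.\<close>

definition subcube :: "'a::euclidean_space set \<Rightarrow> 'a \<times> real \<Rightarrow> 'a \<times> real" where
  "subcube S = (\<lambda>(x, l). (x + (l / 2) *\<^sub>R \<Sum>S, l / 2))"

lemma cube_sets [measurable]: "cube x l \<in> sets borel"
  unfolding cube_def by measurable

lemma inner_sum_Basis_subset:
  assumes "S \<subseteq> Basis" "b \<in> Basis"
  shows "\<Sum>S \<bullet> b = (if b \<in> S then 1 else 0)"
proof -
  have "\<Sum>S \<bullet> b = (\<Sum>b'\<in>S. if b' = b then 1 else 0)"
    unfolding inner_sum_left using assms by (intro sum.cong) (auto simp: inner_Basis)
  then show ?thesis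
    using finite_subset[OF assms(1) finite_Basis] by (simp add: sum.delta)
qed

text \<open>A point determines \<open>S\<close> as its set of upper-half coordinates, so covering
  and disjointness of the halves reduce to those of the fibres of a function.\<close>

lemma cube_subcube:
  assumes "S \<subseteq> Basis" "l > 0"
  shows "cube (fst (subcube S (x, l))) (l / 2) = {y\<in>cube x l. {b\<in>Basis. y \<bullet> b \<ge> x \<bullet> b + l / 2} = S}"
    (is "?L = ?R")
proof (intro set_eqI iffI)
  fix y assume y: "y \<in> ?L"
  have *: "x \<bullet> b + (if b \<in> S then l / 2 else 0) \<le> y \<bullet> b \<and> y \<bullet> b < x \<bullet> b + (if b \<in> S then l else l / 2)"
    if "b \<in> Basis" for b
    using y that assms by (auto simp: cube_def subcube_def inner_add_left inner_sum_Basis_subset split: if_splits)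
  have "y \<in> cube x l"
    unfolding cube_def using * assms(2) by (fastforce split: if_splits)
  moreover have "b \<in> S \<longleftrightarrow> y \<bullet> b \<ge> x \<bullet> b + l / 2" if "b \<in> Basis" for b
    using *[OF that] by (auto split: if_splits)
  ultimately show "y \<in> ?R" using assms(1) by auto
next
  fix y assume "y \<in> ?R"
  then show "y \<in> ?L"
    using assms by (auto simp: cube_def subcube_def inner_add_left inner_sum_Basis_subset)
qed

lemma cube_eq_UN_subcubes:
  fixes x :: "'a::euclidean_space"
  assumes "l > 0"
  shows "cube x l = (\<Union>S\<in>Pow Basis. cube (fst (subcube S (x, l))) (l / 2))"
proof -
  let ?f = "\<lambda>y. {b\<in>Basis. y \<bullet> b \<ge> x \<bullet> b + l / 2}"
  have partition: "A = (\<Union>S\<in>Pow B. {y\<in>A. f y = S})" if "\<And>y. f y \<in> Pow B"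
    for A :: "'a set" and B :: "'a set" and f
    using that by auto
  have "(\<Union>S\<in>Pow Basis. cube (fst (subcube S (x, l))) (l / 2)) = (\<Union>S\<in>Pow Basis. {y\<in>cube x l. ?f y = S})"
  proof (rule SUP_cong[OF refl])
    fix S :: "'a set" assume "S \<in> Pow Basis"
    then have "S \<subseteq> Basis" by simp
    then show "cube (fst (subcube S (x, l))) (l / 2) = {y\<in>cube x l. ?f y = S}"
      by (rule cube_subcube[OF _ assms])
  qed
  also have "\<dots> = cube x l"
    by (rule partition[symmetric]) simp
  finally show ?thesis ..
qed

lemma disjoint_subcubes:
  fixes x :: "'a::euclidean_space"
  assumes "l > 0"
  shows "disjoint_family_on (\<lambda>S. cube (fst (subcube S (x, l))) (l / 2)) (Pow Basis)"
  unfolding disjoint_family_on_def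
proof (intro ballI impI)
  fix S T :: "'a set" assume "S \<in> Pow Basis" "T \<in> Pow Basis" "S \<noteq> T"
  then show "cube (fst (subcube S (x, l))) (l / 2) \<inter> cube (fst (subcube T (x, l))) (l / 2) = {}"
    using cube_subcube[of S l x] cube_subcube[of T l x] assms by auto
qed

lemma emeasure_cube:
  fixes x :: "'a::euclidean_space"
  assumes "l \<ge> 0"
  shows "emeasure lborel (cube x l) = ennreal (l ^ DIM('a))"
proof -
  have sub: "box x (x + l *\<^sub>R One) \<subseteq> cube x l" "cube x l \<subseteq> cbox x (x + l *\<^sub>R One)"
    by (auto simp: cube_def mem_box inner_add_left less_imp_le)
  have "emeasure lborel (box x (x + l *\<^sub>R One)) = ennreal (l ^ DIM('a))"
    "emeasure lborel (cbox x (x + l *\<^sub>R One)) = ennreal (l ^ DIM('a))"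
    using assms by (simp_all add: emeasure_lborel_box emeasure_lborel_cbox inner_add_left)
  then show ?thesis
    using emeasure_mono[OF sub(1), of lborel] emeasure_mono[OF sub(2), of lborel] by (intro antisym) auto
qed

lemma measure_cube:
  fixes x :: "'a::euclidean_space"
  assumes "l \<ge> 0"
  shows "measure lborel (cube x l) = l ^ DIM('a)"
  using assms by (simp add: measure_def emeasure_cube)

text \<open>The radius comes from the sum norm, which gives at most \<open>n * l\<close>; the extra
  \<open>l\<close> makes the inequality strict for an open ball.\<close>

lemma cube_subset_ball:
  fixes x y :: "'a::euclidean_space"
  assumes "y \<in> cube x l" "l > 0"
  shows "cube x l \<subseteq> ball y (real (DIM('a) + 1) * l)"
proof
  fix w assume w: "w \<in> cube x l"
  have "norm (y - w) \<le> (\<Sum>b\<in>Basis. \<bar>(y - w) \<bullet> b\<bar>)" by (rule norm_le_l1)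
  also have "\<dots> \<le> (\<Sum>b\<in>(Basis::'a set). l)"
    using assms w by (intro sum_mono) (fastforce simp: cube_def inner_diff_left abs_le_iff)
  also have "\<dots> < real (DIM('a) + 1) * l" using assms by (simp add: algebra_simps)
  finally show "w \<in> ball y (real (DIM('a) + 1) * l)" by (simp add: dist_norm)
qed

lemma corner_in_cube: "l > 0 \<Longrightarrow> x \<in> cube x l"
  by (simp add: cube_def)

lemma ball_subset_cube:
  fixes z :: "'a::euclidean_space"
  assumes "2 * \<rho> \<le> l"
  shows "ball z \<rho> \<subseteq> cube (z - (l / 2) *\<^sub>R One) l"
proof
  fix w assume "w \<in> ball z \<rho>"
  then have "\<bar>(w - z) \<bullet> b\<bar> < \<rho>" if "b \<in> Basis" for b
    using Basis_le_norm[OF that, of "w - z"] by (simp add: dist_norm norm_minus_commute)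
  then show "w \<in> cube (z - (l / 2) *\<^sub>R One) l"
    using assms by (fastforce simp: cube_def inner_diff_left abs_less_iff)
qed

section \<open>Functions of bounded mean oscillation\<close>

definition mean_on :: "'a::euclidean_space set \<Rightarrow> ('a \<Rightarrow> 'b::euclidean_space) \<Rightarrow> 'b" where
  "mean_on S f = (LINT y:S|lborel. f y) /\<^sub>R measure lborel S"

text \<open>Left unnormalised to be monotone in \<open>S\<close> and additive over subcubes.\<close>

definition deviation :: "'a::euclidean_space set \<Rightarrow> ('a \<Rightarrow> 'b::euclidean_space) \<Rightarrow> 'b \<Rightarrow> real" where
  "deviation S f c = (LINT y:S|lborel. norm (f y - c))"

lemma set_integrable_deviation:
  fixes f :: "'a::euclidean_space \<Rightarrow> 'b::euclidean_space"
  assumes "set_integrable lborel S f" "S \<in> sets borel" "emeasure lborel S < \<infinity>"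
  shows "set_integrable lborel S (\<lambda>y. f y - c)" "set_integrable lborel S (\<lambda>y. norm (f y - c))"
proof -
  have "set_integrable lborel S (\<lambda>y. c)"
    using assms by (simp add: set_integrable_def)
  then show "set_integrable lborel S (\<lambda>y. f y - c)"
    by (intro set_integral_diff assms)
  then show "set_integrable lborel S (\<lambda>y. norm (f y - c))"
    unfolding set_integrable_def by (drule_tac integrable_norm) simp
qed

lemma nn_integral_eq_deviation:
  fixes f :: "'a::euclidean_space \<Rightarrow> 'b::euclidean_space"
  assumes "set_integrable lborel S f" "S \<in> sets borel" "emeasure lborel S < \<infinity>"
  shows "(\<integral>\<^sup>+y\<in>S. ennreal (norm (f y - c)) \<partial>lborel) = ennreal (deviation S f c)"
proof -
  have "(\<integral>\<^sup>+y\<in>S. ennreal (norm (f y - c)) \<partial>lborel)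
      = (\<integral>\<^sup>+y. ennreal (indicator S y *\<^sub>R norm (f y - c)) \<partial>lborel)"
    by (intro nn_integral_cong) (auto simp: indicator_def)
  also have "\<dots> = ennreal (deviation S f c)"
    using set_integrable_deviation(2)[OF assms, of c]
    unfolding deviation_def set_lebesgue_integral_def set_integrable_def
    by (intro nn_integral_eq_integral) auto
  finally show ?thesis .
qed

lemma norm_mean_on_diff_le:
  fixes f :: "'a::euclidean_space \<Rightarrow> 'b::euclidean_space"
  assumes "set_integrable lborel S f" "S \<in> sets borel" "emeasure lborel S < \<infinity>" "0 < measure lborel S"
  shows "norm (mean_on S f - c) \<le> deviation S f c / measure lborel S"
proof -
  have "(LINT y:S|lborel. f y - c) = (LINT y:S|lborel. f y) - measure lborel S *\<^sub>R c"
    using assms by (subst set_integral_diff(2))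
      (auto simp: set_integral_const set_integrable_def set_lebesgue_integral_def)
  then have "mean_on S f - c = (LINT y:S|lborel. f y - c) /\<^sub>R measure lborel S"
    using assms(4) by (simp add: mean_on_def scaleR_diff_right)
  also have "norm \<dots> = norm (LINT y:S|lborel. f y - c) / measure lborel S"
    using assms(4) by (simp add: divide_inverse mult.commute)
  also have "\<dots> \<le> deviation S f c / measure lborel S"
    unfolding deviation_def
    using set_integral_norm_bound[OF set_integrable_deviation(1)[OF assms(1-3), of c]]
    by (intro divide_right_mono) auto
  finally show ?thesis .
qed

lemma deviation_nonneg [simp]: "0 \<le> deviation S f c"
  unfolding deviation_def set_lebesgue_integral_def by (intro integral_nonneg_AE) auto

lemma deviation_mono:
  fixes f :: "'a::euclidean_space \<Rightarrow> 'b::euclidean_space"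
  assumes "set_integrable lborel T f" "T \<in> sets borel" "emeasure lborel T < \<infinity>"
    and "S \<in> sets borel" "S \<subseteq> T"
  shows "deviation S f c \<le> deviation T f c"
proof -
  note T = set_integrable_deviation(2)[OF assms(1-3), of c]
  have "set_integrable lborel S (\<lambda>y. norm (f y - c))"
    using set_integrable_subset[OF T] assms by auto
  with T show ?thesis
    unfolding deviation_def set_lebesgue_integral_def set_integrable_def
    using assms(5) by (intro integral_mono) (auto simp: indicator_def)
qed

lemma deviation_triangle:
  fixes f :: "'a::euclidean_space \<Rightarrow> 'b::euclidean_space"
  assumes "set_integrable lborel S f" "S \<in> sets borel" "emeasure lborel S < \<infinity>"
  shows "deviation S f c \<le> deviation S f d + norm (d - c) * measure lborel S"
proof -
  have const: "integrable lborel (\<lambda>y. indicator S y *\<^sub>R norm (d - c))"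
    using assms by simp
  note int = set_integrable_deviation(2)[OF assms, unfolded set_integrable_def]
  have "deviation S f c \<le> (\<integral>y. indicator S y *\<^sub>R norm (f y - d) + indicator S y *\<^sub>R norm (d - c) \<partial>lborel)"
    unfolding deviation_def set_lebesgue_integral_def
  proof (intro integral_mono Bochner_Integration.integrable_add int const)
    fix y
    show "indicat_real S y *\<^sub>R norm (f y - c) \<le> indicat_real S y *\<^sub>R norm (f y - d) + indicat_real S y *\<^sub>R norm (d - c)"
      using norm_triangle_ineq[of "f y - d" "d - c"] by (auto simp: indicator_def)
  qed
  also have "\<dots> = deviation S f d + norm (d - c) * measure lborel S"
    unfolding deviation_def set_lebesgue_integral_def
    using int const assms by (subst Bochner_Integration.integral_add) (auto simp: mult.commute)
  finally show ?thesis .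
qed

definition bmo_bounded :: "('a::euclidean_space \<Rightarrow> 'b::euclidean_space) \<Rightarrow> real \<Rightarrow> bool" where
  "bmo_bounded f a \<longleftrightarrow> f \<in> borel_measurable borel \<and> a > 0 \<and>
     (\<forall>z r. set_integrable lborel (ball z r) f) \<and>
     (\<forall>z. \<forall>r>0. deviation (ball z r) f (mean_on (ball z r) f) \<le> a * measure lborel (ball z r))"

abbreviation unit_vol :: "'a::euclidean_space itself \<Rightarrow> real" where
  "unit_vol _ \<equiv> unit_ball_vol (real DIM('a))"

lemma measure_ball: "r \<ge> 0 \<Longrightarrow> measure lborel (ball (z::'a::euclidean_space) r) = unit_vol TYPE('a) * r ^ DIM('a)"
  using content_ball[of r z] by simp

context
  fixes f :: "'a::euclidean_space \<Rightarrow> 'b::euclidean_space" and a :: real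
  assumes bmo: "bmo_bounded f a"
begin

lemma bmo_measurable: "f \<in> borel_measurable borel"
  using bmo by (simp add: bmo_bounded_def)

lemma bmo_pos: "a > 0"
  using bmo by (simp add: bmo_bounded_def)

lemma bmo_set_integrable_ball: "set_integrable lborel (ball z r) f"
  using bmo by (simp add: bmo_bounded_def)

lemma bmo_set_integrable: "S \<in> sets borel \<Longrightarrow> S \<subseteq> ball z r \<Longrightarrow> set_integrable lborel S f"
  by (rule set_integrable_subset[OF bmo_set_integrable_ball[of z r]]) auto

lemma bmo_set_integrable_cube:
  assumes "l > 0"
  shows "set_integrable lborel (cube x l) f"
  using bmo_set_integrable[OF _ cube_subset_ball[OF corner_in_cube[OF assms] assms]] by simp

lemma emeasure_ball_finite: "emeasure lborel (ball (z::'a) r) < \<infinity>"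
  using emeasure_lborel_ball_finite[of z r] by simp

lemma bmo_deviation_ball:
  "r > 0 \<Longrightarrow> deviation (ball z r) f (mean_on (ball z r) f) \<le> a * measure lborel (ball z r)"
  using bmo by (simp add: bmo_bounded_def)

text \<open>Passing to a subset costs only the ratio of the measures; all later comparisons of means
  over balls and cubes are instances.\<close>

lemma bmo_norm_mean_diff:
  assumes "S \<in> sets borel" "S \<subseteq> ball z r" "r > 0" "0 < measure lborel S"
    and K: "measure lborel (ball z r) \<le> K * measure lborel S"
  shows "norm (mean_on S f - mean_on (ball z r) f) \<le> K * a"
proof -
  have fin: "emeasure lborel S < \<infinity>"
    using emeasure_mono[OF assms(2), of lborel] emeasure_ball_finite[of z r] by simp
  have "norm (mean_on S f - mean_on (ball z r) f) \<le> deviation S f (mean_on (ball z r) f) / measure lborel S"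
    using assms fin by (intro norm_mean_on_diff_le bmo_set_integrable) auto
  also have "\<dots> \<le> deviation (ball z r) f (mean_on (ball z r) f) / measure lborel S"
    using assms by (intro divide_right_mono deviation_mono bmo_set_integrable_ball emeasure_ball_finite) auto
  also have "\<dots> \<le> (a * (K * measure lborel S)) / measure lborel S"
    using bmo_deviation_ball[OF assms(3), of z] mult_left_mono[OF K less_imp_le[OF bmo_pos]] assms(4)
    by (intro divide_right_mono) auto
  also have "\<dots> = K * a" using assms(4) by simp
  finally show ?thesis .
qed

lemma bmo_norm_mean_ball_diff:
  assumes "0 < r" "r \<le> s" "s \<le> k * r"
  shows "norm (mean_on (ball z r) f - mean_on (ball z s) f) \<le> k ^ DIM('a) * a"
proof (rule bmo_norm_mean_diff)
  have "s ^ DIM('a) \<le> (k * r) ^ DIM('a)" using assms by (intro power_mono) auto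
  then have "unit_vol TYPE('a) * s ^ DIM('a) \<le> unit_vol TYPE('a) * (k ^ DIM('a) * r ^ DIM('a))"
    by (intro mult_left_mono) (auto simp: power_mult_distrib)
  then show "measure lborel (ball z s) \<le> k ^ DIM('a) * measure lborel (ball z r)"
    using assms by (simp only: measure_ball less_imp_le mult.left_commute)
qed (use assms in \<open>auto simp: measure_ball\<close>)

text \<open>Telescoping over \<open>j\<close> doublings: means of BMO functions grow logarithmically
  in the radius.\<close>

lemma bmo_norm_mean_dyadic:
  assumes "r > 0"
  shows "norm (mean_on (ball z (2 ^ j * r)) f - mean_on (ball z r) f) \<le> real j * 2 ^ DIM('a) * a"
proof (induction j)
  case (Suc j)
  have "norm (mean_on (ball z (2 ^ j * r)) f - mean_on (ball z (2 ^ Suc j * r)) f) \<le> 2 ^ DIM('a) * a"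
    using assms by (intro bmo_norm_mean_ball_diff) auto
  with Suc norm_triangle_ineq[of "mean_on (ball z (2 ^ Suc j * r)) f - mean_on (ball z (2 ^ j * r)) f"
      "mean_on (ball z (2 ^ j * r)) f - mean_on (ball z r) f"]
  show ?case by (simp add: algebra_simps norm_minus_commute)
qed simp

lemma bmo_deviation_dyadic:
  assumes r: "r > 0"
  shows "deviation (ball z (2 ^ j * r)) f (mean_on (ball z r) f)
    \<le> 2 ^ DIM('a) * unit_vol TYPE('a) * a * 2 ^ j * (2 ^ j * r) ^ DIM('a)"
proof -
  let ?B = "ball z (2 ^ j * r)" and ?c = "mean_on (ball z r) f" and ?n = "DIM('a)"
  have "deviation ?B f ?c \<le> deviation ?B f (mean_on ?B f) + norm (mean_on ?B f - ?c) * measure lborel ?B"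
    by (intro deviation_triangle bmo_set_integrable_ball emeasure_ball_finite) auto
  also have "\<dots> \<le> a * measure lborel ?B + real j * 2 ^ ?n * a * measure lborel ?B"
    using r by (intro add_mono bmo_deviation_ball mult_right_mono bmo_norm_mean_dyadic) auto
  also have "\<dots> = (1 + real j * 2 ^ ?n) * (a * measure lborel ?B)"
    by (simp add: algebra_simps)
  \<comment> \<open>The linear growth in \<open>j\<close> is given away as \<open>2 ^ j\<close>,
    well within the \<open>4 ^ j\<close> that \<open>decay_nn_integral_le\<close> tolerates.\<close>
  also have "\<dots> \<le> (2 ^ ?n * 2 ^ j) * (a * measure lborel ?B)"
  proof (intro mult_right_mono)
    have "1 + real j \<le> 2 ^ j"
      using Bernoulli_inequality[of 1 j] by simp
    then have "(1 + real j) * 2 ^ ?n \<le> 2 ^ j * 2 ^ ?n" by (intro mult_right_mono) auto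
    moreover have "1 \<le> (2::real) ^ ?n" by simp
    ultimately show "1 + real j * 2 ^ ?n \<le> 2 ^ ?n * 2 ^ j"
      unfolding distrib_right mult.commute[of "2 ^ ?n"] by linarith
  qed (use bmo_pos in auto)
  also have "\<dots> = 2 ^ ?n * unit_vol TYPE('a) * a * 2 ^ j * (2 ^ j * r) ^ ?n"
    using r by (simp add: measure_ball mult_ac)
  finally show ?thesis .
qed

end

text \<open>The classical weighted integrability of BMO functions at infinity. The mean is taken at
  the centre and scale of the weight, which makes the constant independent of both.\<close>

lemma bmo_nn_integral_decay:
  "\<exists>C>0. \<forall>f::'a::euclidean_space \<Rightarrow> 'b::euclidean_space. \<forall>a. bmo_bounded f a \<longrightarrow> (\<forall>r>0. \<forall>z.
     (\<integral>\<^sup>+y. ennreal (decay r (z - y)) * ennreal (norm (f y - mean_on (ball z r) f)) \<partial>lborel) \<le> ennreal (C * a))"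
proof -
  obtain C where C: "C > 0" and bd: "\<forall>r>0. \<forall>z::'a. \<forall>K\<ge>0. \<forall>F\<in>borel_measurable borel.
     (\<forall>j. (\<integral>\<^sup>+y\<in>ball z (2 ^ j * r). F y \<partial>lborel) \<le> ennreal (K * 4 ^ j * (2 ^ j * r) ^ DIM('a))) \<longrightarrow>
     (\<integral>\<^sup>+y. ennreal (decay r (z - y)) * F y \<partial>lborel) \<le> ennreal (C * K)"
    using decay_nn_integral_le[where 'a = 'a] by blast
  let ?k = "2 ^ DIM('a) * unit_vol TYPE('a)"
  have k: "?k > 0" by simp
  have "(\<integral>\<^sup>+y. ennreal (decay r (z - y)) * ennreal (norm (f y - mean_on (ball z r) f)) \<partial>lborel) \<le> ennreal (C * (?k * a))"
    if bmo: "bmo_bounded f a" and r: "r > 0" for f :: "'a \<Rightarrow> 'b" and a r z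
  proof (rule bd[rule_format, OF r])
    note [measurable] = bmo_measurable[OF bmo]
    show "0 \<le> ?k * a" using bmo_pos[OF bmo] k by simp
    show "(\<lambda>y. ennreal (norm (f y - mean_on (ball z r) f))) \<in> borel_measurable borel" by measurable
    fix j :: nat
    have "?k * a * 2 ^ j * (2 ^ j * r) ^ DIM('a) \<le> ?k * a * 4 ^ j * (2 ^ j * r) ^ DIM('a)"
      using bmo_pos[OF bmo] k r by (intro mult_right_mono mult_left_mono power_mono) auto
    with bmo_deviation_dyadic[OF bmo r, of z j]
    have "deviation (ball z (2 ^ j * r)) f (mean_on (ball z r) f) \<le> ?k * a * 4 ^ j * (2 ^ j * r) ^ DIM('a)"
      by linarith
    then show "(\<integral>\<^sup>+y\<in>ball z (2 ^ j * r). ennreal (norm (f y - mean_on (ball z r) f)) \<partial>lborel)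
        \<le> ennreal (?k * a * 4 ^ j * (2 ^ j * r) ^ DIM('a))"
      using nn_integral_eq_deviation[OF bmo_set_integrable_ball[OF bmo] _ emeasure_ball_finite[OF bmo]]
      by (simp add: ennreal_leI)
  qed
  then show ?thesis
    using C k by (intro exI[of _ "C * ?k"]) (simp add: mult.assoc)
qed

text \<open>Unlike in \<open>decay_comparable\<close> the scales are arbitrary and the constant
  depends on their ratio, which is enough for qualitative integrability.\<close>

lemma decay_le_decay:
  fixes w :: "'a::euclidean_space"
  assumes "r > 0" "s > 0"
  shows "decay r w \<le> (s / r) ^ DIM('a) * (max 1 (r / s)) ^ (DIM('a) + 3) * decay s w"
proof -
  let ?m = "max 1 (r / s)" and ?n = "DIM('a)"
  have "norm w / s = r / s * (norm w / r)" using assms by simp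
  also have "\<dots> \<le> ?m * (norm w / r)" using assms by (intro mult_right_mono) auto
  finally have "1 + norm w / s \<le> ?m * (1 + norm w / r)" by (simp add: distrib_left add_mono)
  then have X: "(1 + norm w / s) ^ (?n + 3) \<le> ?m ^ (?n + 3) * (1 + norm w / r) ^ (?n + 3)"
    using assms unfolding power_mult_distrib[symmetric] by (intro power_mono) auto
  have "inverse ((1 + norm w / r) ^ (?n + 3)) \<le> ?m ^ (?n + 3) * inverse ((1 + norm w / s) ^ (?n + 3))"
  proof (rule inverse_le_inverse_mult)
    show "0 < (1 + norm w / r) ^ (?n + 3)" "0 < (1 + norm w / s) ^ (?n + 3)"
      by (intro zero_less_power add_pos_nonneg divide_nonneg_pos norm_ge_zero zero_less_one assms)+
  qed (fact X)
  then have "decay r w \<le> inverse (r ^ ?n) * (?m ^ (?n + 3) * inverse ((1 + norm w / s) ^ (?n + 3)))"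
    unfolding decay_def using assms by (intro mult_left_mono) auto
  also have "\<dots> = (s / r) ^ ?n * ?m ^ (?n + 3) * decay s w"
    unfolding decay_def power_divide using assms by (simp add: divide_inverse)
  finally show ?thesis .
qed

lemma temperedI_at_one_scale:
  fixes f :: "'a::euclidean_space \<Rightarrow> 'b::euclidean_space"
  assumes [measurable]: "f \<in> borel_measurable borel"
    and fin: "\<And>x. \<exists>r>0. \<exists>c. (\<integral>\<^sup>+y. ennreal (decay r (x - y)) * ennreal (norm (f y - c)) \<partial>lborel) < \<infinity>"
  shows "tempered f"
proof (rule temperedI)
  fix r :: real and x assume r: "r > 0"
  obtain s c where s: "s > 0" "(\<integral>\<^sup>+y. ennreal (decay s (x - y)) * ennreal (norm (f y - c)) \<partial>lborel) < \<infinity>"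
    using fin by blast
  define k where "k = (s / r) ^ DIM('a) * (max 1 (r / s)) ^ (DIM('a) + 3)"
  have k: "k \<ge> 0" using r s by (simp add: k_def)
  have "ennreal (decay r (x - y)) * ennreal (norm (f y))
      \<le> ennreal k * (ennreal (decay s (x - y)) * ennreal (norm (f y - c)))
        + ennreal (decay r (x - y)) * ennreal (norm c)" for y
  proof -
    have "decay r (x - y) * norm (f y) \<le> decay r (x - y) * (norm (f y - c) + norm c)"
      using norm_triangle_ineq[of "f y - c" c] r by (intro mult_left_mono) auto
    also have "\<dots> \<le> k * decay s (x - y) * norm (f y - c) + decay r (x - y) * norm c"
      unfolding distrib_left
      using decay_le_decay[OF r s(1), of "x - y"] by (intro add_right_mono mult_right_mono) (auto simp: k_def)
    finally show ?thesis
      using r s k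
      by (simp add: ennreal_mult'[symmetric] ennreal_plus[symmetric] mult.assoc ennreal_leI del: ennreal_plus)
  qed
  then have "(\<integral>\<^sup>+y. ennreal (decay r (x - y)) * ennreal (norm (f y)) \<partial>lborel)
      \<le> (\<integral>\<^sup>+y. ennreal k * (ennreal (decay s (x - y)) * ennreal (norm (f y - c)))
        + ennreal (decay r (x - y)) * ennreal (norm c) \<partial>lborel)"
    by (intro nn_integral_mono)
  also have "\<dots> = ennreal k * (\<integral>\<^sup>+y. ennreal (decay s (x - y)) * ennreal (norm (f y - c)) \<partial>lborel)
        + (\<integral>\<^sup>+y. ennreal (decay r (x - y)) * ennreal (norm c) \<partial>lborel)"
    by (subst nn_integral_add) (auto simp: nn_integral_cmult)
  also have "\<dots> < \<infinity>"
    using s tempered_nn_integral_finite[OF tempered_const r, of x c] by (simp add: ennreal_mult_less_top)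
  finally show "(\<integral>\<^sup>+y. ennreal (decay r (x - y)) * ennreal (norm (f y)) \<partial>lborel) < \<infinity>" .
qed measurable

lemma bmo_tempered:
  fixes f :: "'a::euclidean_space \<Rightarrow> 'b::euclidean_space"
  assumes "bmo_bounded f a"
  shows "tempered f"
proof (rule temperedI_at_one_scale)
  obtain C where C: "\<forall>f::'a \<Rightarrow> 'b. \<forall>a. bmo_bounded f a \<longrightarrow> (\<forall>r>0. \<forall>z.
     (\<integral>\<^sup>+y. ennreal (decay r (z - y)) * ennreal (norm (f y - mean_on (ball z r) f)) \<partial>lborel) \<le> ennreal (C * a))"
    using bmo_nn_integral_decay[where 'a = 'a and 'b = 'b] by blast
  show "\<exists>r>0. \<exists>c. (\<integral>\<^sup>+y. ennreal (decay r (x - y)) * ennreal (norm (f y - c)) \<partial>lborel) < \<infinity>" for x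
    using C[rule_format, OF assms zero_less_one, of x]
    by (intro exI[of _ 1] conjI exI[of _ "mean_on (ball x 1) f"]) (auto intro: le_less_trans)
qed (rule bmo_measurable[OF assms])

text \<open>The value \<open>0\<close> on cubes of side \<open>l \<le> 0\<close> keeps the martingale property for every pair \<open>(x, l)\<close>.\<close>

definition cube_mean :: "('a::euclidean_space \<Rightarrow> 'b::euclidean_space) \<Rightarrow> 'a \<times> real \<Rightarrow> 'b" where
  "cube_mean f s = (if snd s > 0 then mean_on (cube (fst s) (snd s)) f else 0)"

lemma sum_over_subcubes:
  fixes g :: "'a::euclidean_space \<Rightarrow> 'b::euclidean_space"
  assumes "l > 0" "set_integrable lborel (cube x l) g"
  shows "(\<Sum>S\<in>Pow Basis. LINT y:cube (fst (subcube S (x, l))) (l / 2)|lborel. g y)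
    = (LINT y:cube x l|lborel. g y)"
proof -
  have "set_integrable lborel (cube (fst (subcube S (x, l))) (l / 2)) g" if "S \<in> Pow Basis" for S
    using that by (intro set_integrable_subset[OF assms(2)])
      (auto simp: cube_eq_UN_subcubes[OF assms(1), of x])
  then show ?thesis
    by (subst cube_eq_UN_subcubes[OF assms(1)], subst set_integral_finite_Union)
      (auto intro: disjoint_subcubes[OF assms(1)])
qed

lemma card_Pow_Basis: "card (Pow (Basis :: 'a::euclidean_space set)) = 2 ^ DIM('a)"
  by (simp add: card_Pow)

lemma snd_subcube [simp]: "snd (subcube S s) = snd s / 2"
  by (simp add: subcube_def split_beta)

lemma fst_subcube_eq: "subcube S (x, l) = (fst (subcube S (x, l)), l / 2)"
  by (simp add: subcube_def)

lemma tree_martingale_cube_mean: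
  fixes f :: "'a::euclidean_space \<Rightarrow> 'b::euclidean_space"
  assumes bmo: "bmo_bounded f a"
  shows "tree_martingale (Pow Basis) subcube (cube_mean f)"
proof
  fix s :: "'a \<times> real"
  obtain x l where s: "s = (x, l)" by fastforce
  show "cube_mean f s = (\<Sum>S\<in>Pow Basis. cube_mean f (subcube S s)) /\<^sub>R real (card (Pow (Basis::'a set)))"
  proof (cases "l > 0")
    case True
    then have "(\<Sum>S\<in>Pow Basis. cube_mean f (subcube S s))
        = (\<Sum>S\<in>Pow Basis. LINT y:cube (fst (subcube S (x, l))) (l / 2)|lborel. f y) /\<^sub>R (l / 2) ^ DIM('a)"
      by (simp add: s cube_mean_def mean_on_def measure_cube scaleR_sum_right)
    also have "\<dots> = (LINT y:cube x l|lborel. f y) /\<^sub>R (l / 2) ^ DIM('a)"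
      by (subst sum_over_subcubes) (use True bmo_set_integrable_cube[OF bmo] in auto)
    finally show ?thesis
      using True by (simp add: s cube_mean_def mean_on_def measure_cube card_Pow_Basis power_divide inverse_eq_divide)
  qed (simp add: cube_mean_def s)
qed auto

text \<open>The constant compares a cube of side \<open>l\<close> with the balls of radius \<open>(n + 1) l\<close> about its points.\<close>

definition cube_ball_ratio :: "'a::euclidean_space itself \<Rightarrow> real" where
  "cube_ball_ratio _ = unit_vol TYPE('a) * real (DIM('a) + 1) ^ DIM('a)"

lemma cube_ball_ratio_pos: "cube_ball_ratio TYPE('a::euclidean_space) > 0"
  by (simp add: cube_ball_ratio_def)

lemma measure_ball_cube:
  fixes x z :: "'a::euclidean_space"
  assumes "l > 0"
  shows "measure lborel (ball z (real (DIM('a) + 1) * l)) = cube_ball_ratio TYPE('a) * measure lborel (cube x l)"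
  using assms by (subst measure_ball) (auto simp: measure_cube cube_ball_ratio_def power_mult_distrib mult_ac)

lemma bmo_cube_mean_diff:
  fixes f :: "'a::euclidean_space \<Rightarrow> 'b::euclidean_space"
  assumes bmo: "bmo_bounded f a" and l: "l > 0" and z: "z \<in> cube x l"
  shows "norm (mean_on (cube x l) f - mean_on (ball z (real (DIM('a) + 1) * l)) f) \<le> cube_ball_ratio TYPE('a) * a"
proof (rule bmo_norm_mean_diff[OF bmo])
  show "measure lborel (ball z (real (DIM('a) + 1) * l)) \<le> cube_ball_ratio TYPE('a) * measure lborel (cube x l)"
    by (rule measure_ball_cube[OF l, THEN eq_refl])
qed (use l cube_subset_ball[OF z l] in \<open>auto simp: measure_cube\<close>)

lemma emeasure_cube_finite: "l > 0 \<Longrightarrow> emeasure lborel (cube x l) < \<infinity>"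
  by (simp add: emeasure_cube)

lemma bmo_deviation_cube:
  fixes f :: "'a::euclidean_space \<Rightarrow> 'b::euclidean_space"
  assumes bmo: "bmo_bounded f a" and l: "l > 0"
  shows "deviation (cube x l) f (mean_on (cube x l) f) \<le> 2 * cube_ball_ratio TYPE('a) * a * l ^ DIM('a)"
proof -
  let ?Q = "cube x l" and ?B = "ball x (real (DIM('a) + 1) * l)"
  \<comment> \<open>The ratio of ball to cube enters once through the deviation on \<open>?B\<close>
    and once through the change of mean, hence the factor 2.\<close>
  have "deviation ?Q f (mean_on ?Q f)
      \<le> deviation ?Q f (mean_on ?B f) + norm (mean_on ?B f - mean_on ?Q f) * measure lborel ?Q"
    by (intro deviation_triangle bmo_set_integrable_cube[OF bmo] emeasure_cube_finite l) auto
  also have "deviation ?Q f (mean_on ?B f) \<le> deviation ?B f (mean_on ?B f)"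
    by (intro deviation_mono bmo_set_integrable_ball[OF bmo] emeasure_ball_finite[OF bmo]
        cube_subset_ball corner_in_cube l) auto
  also have "\<dots> \<le> a * (cube_ball_ratio TYPE('a) * measure lborel ?Q)"
    unfolding measure_ball_cube[OF l, of x x, symmetric] using l by (intro bmo_deviation_ball[OF bmo]) simp
  also have "norm (mean_on ?B f - mean_on ?Q f) * measure lborel ?Q
      \<le> cube_ball_ratio TYPE('a) * a * measure lborel ?Q"
    using bmo_cube_mean_diff[OF bmo l corner_in_cube[OF l], of x] l
    by (intro mult_right_mono) (auto simp: norm_minus_commute)
  finally show ?thesis
    using l by (simp add: measure_cube algebra_simps)
qed

text \<open>On each final cube the distance of its mean from \<open>c\<close> is at most the mean
  distance of \<open>f\<close> from \<open>c\<close>, and deviations add up over the partition; the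
  bound therefore does not depend on \<open>k\<close>.\<close>

lemma lev_cube_mean_le_deviation:
  fixes f :: "'a::euclidean_space \<Rightarrow> 'b::euclidean_space"
  assumes bmo: "bmo_bounded f a" and l: "l > 0"
  shows "tree_martingale.lev (Pow Basis) subcube k (\<lambda>s. norm (cube_mean f s - c)) (x, l)
    \<le> deviation (cube x l) f c / l ^ DIM('a)"
  using l
proof (induction k arbitrary: x l)
  interpret tree_martingale "Pow Basis" subcube "cube_mean f"
    by (rule tree_martingale_cube_mean[OF bmo])
  case 0
  then show ?case
    using norm_mean_on_diff_le[OF bmo_set_integrable_cube[OF bmo 0] _ emeasure_cube_finite[OF 0], of x c]
    by (simp add: cube_mean_def measure_cube)
next
  interpret tree_martingale "Pow Basis" subcube "cube_mean f"
    by (rule tree_martingale_cube_mean[OF bmo])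
  case (Suc k)
  have "(\<Sum>S\<in>Pow Basis. lev k (\<lambda>s. norm (cube_mean f s - c)) (subcube S (x, l)))
      \<le> (\<Sum>S\<in>Pow Basis. deviation (cube (fst (subcube S (x, l))) (l / 2)) f c / (l / 2) ^ DIM('a))"
    by (intro sum_mono, subst fst_subcube_eq, intro Suc.IH) (use Suc.prems in auto)
  also have "\<dots> = deviation (cube x l) f c / (l / 2) ^ DIM('a)"
    unfolding deviation_def sum_divide_distrib[symmetric]
    by (subst sum_over_subcubes)
      (use Suc.prems in \<open>auto intro!: set_integrable_deviation bmo_set_integrable_cube[OF bmo] simp: emeasure_cube\<close>)
  finally show ?case
    using Suc.prems by (simp add: card_Pow_Basis power_divide field_simps)
qed

text \<open>The mean square bound is uniform in the number \<open>N\<close> of bisections. The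
  factor \<open>2 ^ n\<close> is the measure ratio of a cube to its half, which governs a single
  jump.\<close>

theorem bmo_lev_cube_square:
  fixes f :: "'a::euclidean_space \<Rightarrow> 'b::euclidean_space"
  assumes bmo: "bmo_bounded f a"
  shows "tree_martingale.lev (Pow Basis) subcube N (\<lambda>s. (norm (cube_mean f s - cube_mean f (x, l)))\<^sup>2) (x, l)
    \<le> 17 * (2 ^ DIM('a) * (2 * cube_ball_ratio TYPE('a) * a))\<^sup>2"
proof -
  let ?\<kappa> = "2 * cube_ball_ratio TYPE('a) * a"
  interpret tree_martingale "Pow Basis" subcube "cube_mean f"
    by (rule tree_martingale_cube_mean[OF bmo])
  have \<kappa>: "0 < ?\<kappa>" using cube_ball_ratio_pos[where 'a = 'a] bmo_pos[OF bmo] by simp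
  have pow: "1 \<le> (2::real) ^ DIM('a)" by simp
  have dev: "deviation (cube x l) f (cube_mean f (x, l)) \<le> ?\<kappa> * l ^ DIM('a)" if "l > 0" for x l
    using bmo_deviation_cube[OF bmo that, of x] that by (simp add: cube_mean_def)
  show ?thesis
  proof (rule john_nirenberg_square)
    show "0 < 2 ^ DIM('a) * ?\<kappa>" using \<kappa> by simp
  next
    fix S and s :: "'a \<times> real" assume S: "S \<in> Pow (Basis :: 'a set)"
    obtain x l where s: "s = (x, l)" by fastforce
    show "norm (cube_mean f (subcube S s) - cube_mean f s) \<le> 2 ^ DIM('a) * ?\<kappa>"
    proof (cases "l > 0")
      case True
      let ?Q = "cube (fst (subcube S (x, l))) (l / 2)"
      have "norm (mean_on ?Q f - cube_mean f s) \<le> deviation ?Q f (cube_mean f s) / measure lborel ?Q"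
        using True by (intro norm_mean_on_diff_le bmo_set_integrable_cube[OF bmo] emeasure_cube_finite)
          (auto simp: measure_cube)
      also have "\<dots> \<le> deviation (cube x l) f (cube_mean f s) / measure lborel ?Q"
      proof -
        have "?Q \<subseteq> cube x l" using S True cube_subcube[of S l x] by auto
        then show ?thesis
          using True by (intro divide_right_mono deviation_mono bmo_set_integrable_cube[OF bmo] emeasure_cube_finite) auto
      qed
      also have "\<dots> \<le> (?\<kappa> * l ^ DIM('a)) / measure lborel ?Q"
        using dev[OF True, of x] unfolding s by (intro divide_right_mono) auto
      also have "\<dots> = 2 ^ DIM('a) * ?\<kappa>"
        using True by (simp add: measure_cube power_divide)
      finally show ?thesis using True by (simp add: s cube_mean_def)
    qed (use \<kappa> in \<open>auto simp: s cube_mean_def\<close>)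
  next
    fix k and s :: "'a \<times> real"
    obtain x l where s: "s = (x, l)" by fastforce
    show "lev k (\<lambda>s'. norm (cube_mean f s' - cube_mean f s)) s \<le> 2 ^ DIM('a) * ?\<kappa>"
    proof (cases "l > 0")
      case True
      have "lev k (\<lambda>s'. norm (cube_mean f s' - cube_mean f s)) s
          \<le> deviation (cube x l) f (cube_mean f s) / l ^ DIM('a)"
        unfolding s by (rule lev_cube_mean_le_deviation[OF bmo True])
      also have "\<dots> \<le> ?\<kappa>"
        using dev[OF True, of x] True by (simp add: s divide_le_eq)
      also have "\<dots> \<le> 2 ^ DIM('a) * ?\<kappa>"
        using mult_right_mono[OF pow less_imp_le[OF \<kappa>]] by simp
      finally show ?thesis .
    next
      case False
      \<comment> \<open>The hypotheses of \<open>john_nirenberg_square\<close> range over all pairs,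
        including sides \<open>l \<le> 0\<close>; on such nodes and all their descendants
        \<open>cube_mean\<close> is 0.\<close>
      then have "lev k (\<lambda>s'. norm (cube_mean f s' - cube_mean f (x, l))) (x, l) = 0" for x
      proof (induction k arbitrary: x l)
        case (Suc k)
        have "lev k (\<lambda>s'. norm (cube_mean f s' - cube_mean f (x, l))) (subcube S (x, l)) = 0" for S
          using Suc.IH[of "l / 2" "fst (subcube S (x, l))"] Suc.prems
          by (subst fst_subcube_eq) (simp add: cube_mean_def)
        then show ?case by simp
      qed simp
      then show ?thesis using \<kappa> by (simp add: s)
    qed
  qed
qed

section \<open>Mean squares of the heat extension\<close>

lemma norm_diff_square_le:
  fixes u m c :: "'b::real_normed_vector"
  shows "(norm (u - c))\<^sup>2 \<le> 2 * (norm (u - m))\<^sup>2 + 2 * (norm (m - c))\<^sup>2"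
proof -
  have "(norm (u - c))\<^sup>2 \<le> (norm (u - m) + norm (m - c))\<^sup>2"
    using norm_triangle_ineq[of "u - m" "m - c"] by (intro power_mono) auto
  also have "\<dots> \<le> 2 * (norm (u - m))\<^sup>2 + 2 * (norm (m - c))\<^sup>2"
    using zero_le_power2[of "norm (u - m) - norm (m - c)"] by (simp add: power2_eq_square algebra_simps)
  finally show ?thesis .
qed

lemma norm_integral_le_decay:
  fixes f :: "'a::euclidean_space \<Rightarrow> 'b::euclidean_space"
  assumes [measurable]: "f \<in> borel_measurable borel" "k \<in> borel_measurable borel"
    and "r > 0" "B \<ge> 0" and k: "\<And>y. \<bar>k y\<bar> \<le> A * decay r (x - y)" "A \<ge> 0"
    and int: "integrable lborel (\<lambda>y. k y *\<^sub>R f y)"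
    and bd: "(\<integral>\<^sup>+y. ennreal (decay r (x - y)) * ennreal (norm (f y)) \<partial>lborel) \<le> ennreal B"
  shows "norm (\<integral>y. k y *\<^sub>R f y \<partial>lborel) \<le> A * B"
proof -
  have "ennreal (norm (\<integral>y. k y *\<^sub>R f y \<partial>lborel)) \<le> (\<integral>\<^sup>+y. ennreal (norm (k y *\<^sub>R f y)) \<partial>lborel)"
    by (rule integral_norm_bound_ennreal[OF int])
  also have "\<dots> \<le> (\<integral>\<^sup>+y. ennreal A * (ennreal (decay r (x - y)) * ennreal (norm (f y))) \<partial>lborel)"
    using k \<open>r > 0\<close>
    by (intro nn_integral_mono)
      (auto simp: ennreal_mult'[symmetric] mult.assoc[symmetric] intro!: ennreal_leI mult_right_mono)
  also have "\<dots> \<le> ennreal A * ennreal B"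
    using bd by (simp add: nn_integral_cmult mult_left_mono)
  finally show ?thesis
    using k(2) \<open>B \<ge> 0\<close> by (simp add: ennreal_mult'[symmetric])
qed

text \<open>Constants are fixed by the heat extension, so only \<open>f\<close> minus its mean is
  averaged, against a kernel dominated by \<open>decay r\<close>.\<close>

lemma bmo_heat_near_mean:
  "\<exists>C>0. \<forall>f::'a::euclidean_space \<Rightarrow> 'b::euclidean_space. \<forall>a. bmo_bounded f a \<longrightarrow> (\<forall>r>0. \<forall>y.
     norm (heat f (r\<^sup>2) y - mean_on (ball y r) f) \<le> C * a)"
proof -
  obtain A where A: "A > 0" "\<forall>t>0. \<forall>w::'a. heat_kernel t w \<le> A * decay (sqrt t) w"
    using heat_kernel_le_decay_sqrt[where 'a = 'a] by blast
  obtain B where B: "B > 0" "\<forall>f::'a \<Rightarrow> 'b. \<forall>a. bmo_bounded f a \<longrightarrow> (\<forall>r>0. \<forall>z.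
     (\<integral>\<^sup>+y. ennreal (decay r (z - y)) * ennreal (norm (f y - mean_on (ball z r) f)) \<partial>lborel) \<le> ennreal (B * a))"
    using bmo_nn_integral_decay[where 'a = 'a and 'b = 'b] by blast
  have "norm (heat f (r\<^sup>2) y - mean_on (ball y r) f) \<le> A * (B * a)"
    if bmo: "bmo_bounded f a" and r: "r > 0" for f :: "'a \<Rightarrow> 'b" and a r y
  proof -
    note [measurable] = bmo_measurable[OF bmo]
    define c where "c = mean_on (ball y r) f"
    have r2: "r\<^sup>2 > 0" using r by simp
    have "norm (\<integral>w. heat_kernel (r\<^sup>2) (y - w) *\<^sub>R (f w - c) \<partial>lborel) \<le> A * (B * a)"
    proof (rule norm_integral_le_decay[OF _ _ r])
      show "integrable lborel (\<lambda>w. heat_kernel (r\<^sup>2) (y - w) *\<^sub>R (f w - c))"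
        by (intro heat_integrable tempered_diff tempered_const bmo_tempered[OF bmo] r2)
      show "(\<integral>\<^sup>+w. ennreal (decay r (y - w)) * ennreal (norm (f w - c)) \<partial>lborel) \<le> ennreal (B * a)"
        using B(2)[rule_format, OF bmo r] by (simp add: c_def)
      show "\<bar>heat_kernel (r\<^sup>2) (y - w)\<bar> \<le> A * decay r (y - w)" for w
        using A(2)[rule_format, OF r2, of "y - w"] r by simp
    qed (use A B bmo_pos[OF bmo] in auto)
    then show ?thesis
      using heat_diff_const[OF bmo_tempered[OF bmo] r2, of c y] by (simp add: heat_def c_def)
  qed
  then show ?thesis
    using A B by (intro exI[of _ "A * B"]) (auto simp: mult.assoc)
qed

lemma bmo_heat_near_cube_mean:
  "\<exists>C>0. \<forall>f::'a::euclidean_space \<Rightarrow> 'b::euclidean_space. \<forall>a. bmo_bounded f a \<longrightarrow> (\<forall>l>0. \<forall>x. \<forall>y\<in>cube x l.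
     norm (heat f (l\<^sup>2) y - cube_mean f (x, l)) \<le> C * a)"
proof -
  obtain C where C: "C > 0" "\<forall>f::'a \<Rightarrow> 'b. \<forall>a. bmo_bounded f a \<longrightarrow> (\<forall>r>0. \<forall>y.
     norm (heat f (r\<^sup>2) y - mean_on (ball y r) f) \<le> C * a)"
    using bmo_heat_near_mean[where 'a = 'a and 'b = 'b] by blast
  let ?N = "real (DIM('a) + 1)" and ?\<kappa> = "cube_ball_ratio TYPE('a)"
  have "norm (heat f (l\<^sup>2) y - cube_mean f (x, l)) \<le> (C + ?N ^ DIM('a) + ?\<kappa>) * a"
    if bmo: "bmo_bounded f a" and l: "l > 0" and y: "y \<in> cube x l" for f :: "'a \<Rightarrow> 'b" and a l x y
  proof -
    have 1: "norm (heat f (l\<^sup>2) y - mean_on (ball y l) f) \<le> C * a"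
      using C(2) bmo l by blast
    have 2: "norm (mean_on (ball y l) f - mean_on (ball y (?N * l)) f) \<le> ?N ^ DIM('a) * a"
      using l by (intro bmo_norm_mean_ball_diff[OF bmo]) auto
    have 3: "norm (mean_on (cube x l) f - mean_on (ball y (?N * l)) f) \<le> ?\<kappa> * a"
      by (rule bmo_cube_mean_diff[OF bmo l y])
    have "norm (heat f (l\<^sup>2) y - mean_on (cube x l) f)
       \<le> norm (heat f (l\<^sup>2) y - mean_on (ball y l) f) + norm (mean_on (ball y l) f - mean_on (ball y (?N * l)) f)
         + norm (mean_on (cube x l) f - mean_on (ball y (?N * l)) f)"
      by norm
    with 1 2 3 show ?thesis using l unfolding cube_mean_def by (simp add: distrib_right)
  qed
  then show ?thesis
    using C cube_ball_ratio_pos[where 'a = 'a]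
    by (intro exI[of _ "C + ?N ^ DIM('a) + ?\<kappa>"]) (auto intro!: add_pos_pos)
qed

lemma nn_integral_cube_eq_sum:
  fixes F :: "'a::euclidean_space \<Rightarrow> ennreal"
  assumes [measurable]: "F \<in> borel_measurable borel" and l: "l > 0"
  shows "(\<integral>\<^sup>+y\<in>cube x l. F y \<partial>lborel)
    = (\<Sum>S\<in>Pow Basis. \<integral>\<^sup>+y\<in>cube (fst (subcube S (x, l))) (l / 2). F y \<partial>lborel)"
proof -
  have "F y * indicator (cube x l) y = (\<Sum>S\<in>Pow Basis. F y * indicator (cube (fst (subcube S (x, l))) (l / 2)) y)" for y
    unfolding sum_distrib_left[symmetric]
    by (subst cube_eq_UN_subcubes[OF l], subst indicator_UN_disjoint[OF _ disjoint_subcubes[OF l]]) auto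
  then show ?thesis
    by (simp only:) (rule nn_integral_sum, measurable)
qed

lemma heat_measurable_snd [measurable (raw)]:
  assumes [measurable]: "f \<in> borel_measurable borel"
  shows "heat f t \<in> borel_measurable borel"
  using measurable_compose[OF measurable_Pair1' heat_measurable[OF assms], of t] by simp

text \<open>After \<open>N\<close> bisections the cubes have side \<open>\<surd>t\<close> for \<open>t = (l / 2 ^ N)\<^sup>2\<close>, and on each of them
  \<open>W\<^sub>t f\<close> differs from the mean of \<open>f\<close> by at most \<open>D\<close>. Working with \<open>W\<^sub>t f\<close> rather than \<open>f\<close> avoids
  Lebesgue differentiation.\<close>

lemma bmo_cube_square:
  fixes f :: "'a::euclidean_space \<Rightarrow> 'b::euclidean_space"
  assumes bmo: "bmo_bounded f a" and D: "D \<ge> 0"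
    and near: "\<And>l x y. l > 0 \<Longrightarrow> y \<in> cube x l \<Longrightarrow> norm (heat f (l\<^sup>2) y - cube_mean f (x, l)) \<le> D"
    and l: "l > 0"
  shows "(\<integral>\<^sup>+y\<in>cube x l. ennreal ((norm (heat f ((l / 2 ^ N)\<^sup>2) y - c))\<^sup>2) \<partial>lborel)
    \<le> ennreal (l ^ DIM('a) * (2 * tree_martingale.lev (Pow Basis) subcube N (\<lambda>s. (norm (cube_mean f s - c))\<^sup>2) (x, l)
         + 2 * D\<^sup>2))"
  using l
proof (induction N arbitrary: x l)
  interpret tree_martingale "Pow Basis" subcube "cube_mean f"
    by (rule tree_martingale_cube_mean[OF bmo])
  case 0
  have "(\<integral>\<^sup>+y\<in>cube x l. ennreal ((norm (heat f ((l / 2 ^ 0)\<^sup>2) y - c))\<^sup>2) \<partial>lborel)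
      \<le> (\<integral>\<^sup>+y\<in>cube x l. ennreal (2 * (norm (cube_mean f (x, l) - c))\<^sup>2 + 2 * D\<^sup>2) \<partial>lborel)"
  proof (intro nn_integral_mono)
    fix y
    show "ennreal ((norm (heat f ((l / 2 ^ 0)\<^sup>2) y - c))\<^sup>2) * indicator (cube x l) y
        \<le> ennreal (2 * (norm (cube_mean f (x, l) - c))\<^sup>2 + 2 * D\<^sup>2) * indicator (cube x l) y"
    proof (cases "y \<in> cube x l")
      case True
      have "(norm (heat f (l\<^sup>2) y - cube_mean f (x, l)))\<^sup>2 \<le> D\<^sup>2"
        using near[OF 0 True] by (intro power_mono) auto
      then show ?thesis
        using True norm_diff_square_le[of "heat f (l\<^sup>2) y" c "cube_mean f (x, l)"]
        by (simp del: ennreal_plus)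
    qed simp
  qed
  also have "\<dots> = ennreal (l ^ DIM('a) * (2 * (norm (cube_mean f (x, l) - c))\<^sup>2 + 2 * D\<^sup>2))"
    using 0 by (subst nn_integral_cmult_indicator)
      (auto simp: emeasure_cube ennreal_mult'[symmetric] mult.commute simp del: ennreal_plus)
  finally show ?case by simp
next
  interpret tree_martingale "Pow Basis" subcube "cube_mean f"
    by (rule tree_martingale_cube_mean[OF bmo])
  note [measurable] = bmo_measurable[OF bmo]
  case (Suc N)
  let ?g = "\<lambda>S. 2 * lev N (\<lambda>s. (norm (cube_mean f s - c))\<^sup>2) (subcube S (x, l)) + 2 * D\<^sup>2"
  \<comment> \<open>The induction peels off the first bisection, so the final side, and with it the
    time, is the same for the cube and its halves.\<close>
  have tN: "l / 2 ^ Suc N = (l / 2) / 2 ^ N" by simp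
  have "(\<integral>\<^sup>+y\<in>cube x l. ennreal ((norm (heat f ((l / 2 ^ Suc N)\<^sup>2) y - c))\<^sup>2) \<partial>lborel)
     = (\<Sum>S\<in>Pow Basis. \<integral>\<^sup>+y\<in>cube (fst (subcube S (x, l))) (l / 2).
          ennreal ((norm (heat f ((l / 2 / 2 ^ N)\<^sup>2) y - c))\<^sup>2) \<partial>lborel)"
    unfolding tN using Suc.prems by (intro nn_integral_cube_eq_sum) measurable
  also have "\<dots> \<le> (\<Sum>S\<in>Pow Basis. ennreal ((l / 2) ^ DIM('a) * ?g S))"
  proof (intro sum_mono)
    fix S :: "'a set" assume "S \<in> Pow Basis"
    show "(\<integral>\<^sup>+y\<in>cube (fst (subcube S (x, l))) (l / 2). ennreal ((norm (heat f ((l / 2 / 2 ^ N)\<^sup>2) y - c))\<^sup>2) \<partial>lborel)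
        \<le> ennreal ((l / 2) ^ DIM('a) * ?g S)"
      using Suc.IH[of "l / 2" "fst (subcube S (x, l))"] Suc.prems
      by (simp only: fst_subcube_eq[of S x l, symmetric] half_gt_zero)
  qed
  also have "\<dots> = ennreal (\<Sum>S\<in>Pow Basis. (l / 2) ^ DIM('a) * ?g S)"
    using Suc.prems by (intro sum_ennreal) (auto intro!: mult_nonneg_nonneg add_nonneg_nonneg lev_nonneg)
  also have "(\<Sum>S\<in>Pow Basis. (l / 2) ^ DIM('a) * ?g S)
      = l ^ DIM('a) * (2 * lev (Suc N) (\<lambda>s. (norm (cube_mean f s - c))\<^sup>2) (x, l) + 2 * D\<^sup>2)"
    unfolding sum_distrib_left[symmetric] sum.distrib
    by (simp add: card_Pow_Basis power_divide sum_distrib_left[symmetric] field_simps)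
  finally show ?case .
qed

text \<open>The time fixes the final side \<open>\<tau>\<close>, so the starting cube has to be a
  dyadic multiple of it; this finds one of size comparable to the given ball.\<close>

lemma exists_dyadic_multiple:
  fixes \<tau> R :: real
  assumes "0 < \<tau>" "\<tau> \<le> R"
  shows "\<exists>N. R \<le> 2 ^ N * \<tau> \<and> 2 ^ N * \<tau> \<le> 2 * R"
proof -
  define P where "P N \<longleftrightarrow> R \<le> 2 ^ N * \<tau>" for N :: nat
  obtain i :: nat where "R / \<tau> < 2 ^ i" using real_arch_pow[of 2] by auto
  then have "P i" using assms by (simp add: P_def field_simps)
  define N where "N = (LEAST N. P N)"
  have N: "P N" unfolding N_def by (rule LeastI[of P, OF \<open>P i\<close>])
  have "2 ^ N * \<tau> \<le> 2 * R"
  proof (cases N)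
    case (Suc k)
    then have "\<not> P k" unfolding N_def using not_less_Least[of k P] by simp
    then show ?thesis by (simp add: Suc P_def)
  qed (use assms in simp)
  with N show ?thesis by (auto simp: P_def)
qed

text \<open>The constant does not depend on \<open>\<tau>\<close>, although the centre is a mean at
  the possibly much larger scale \<open>r\<close>. This is the uniform bound on which the
  telescoping rests.\<close>

theorem bmo_heat_square_decay:
  "\<exists>C>0. \<forall>f::'a::euclidean_space \<Rightarrow> 'b::euclidean_space. \<forall>a. bmo_bounded f a \<longrightarrow> (\<forall>r>0. \<forall>\<tau>>0. \<tau> \<le> r \<longrightarrow> (\<forall>z.
     (\<integral>\<^sup>+y. ennreal (decay r (z - y)) * ennreal ((norm (heat f (\<tau>\<^sup>2) y - mean_on (ball z r) f))\<^sup>2) \<partial>lborel)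
       \<le> ennreal (C * a\<^sup>2)))"
proof -
  obtain A where A: "A > 0" and bd: "\<forall>r>0. \<forall>z::'a. \<forall>K\<ge>0. \<forall>F\<in>borel_measurable borel.
     (\<forall>j. (\<integral>\<^sup>+y\<in>ball z (2 ^ j * r). F y \<partial>lborel) \<le> ennreal (K * 4 ^ j * (2 ^ j * r) ^ DIM('a))) \<longrightarrow>
     (\<integral>\<^sup>+y. ennreal (decay r (z - y)) * F y \<partial>lborel) \<le> ennreal (A * K)"
    using decay_nn_integral_le[where 'a = 'a] by blast
  obtain D where D: "D > 0" "\<forall>f::'a \<Rightarrow> 'b. \<forall>a. bmo_bounded f a \<longrightarrow> (\<forall>l>0. \<forall>x. \<forall>y\<in>cube x l.
     norm (heat f (l\<^sup>2) y - cube_mean f (x, l)) \<le> D * a)"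
    using bmo_heat_near_cube_mean[where 'a = 'a and 'b = 'b] by blast
  let ?n = "DIM('a)"
  let ?N = "real (?n + 1)" and ?\<kappa> = "cube_ball_ratio TYPE('a)"
  define K where "K = 2 ^ ?n * (2 * ?\<kappa>)"
  \<comment> \<open>The three terms of \<open>M\<close> bound the steps from the cube to the ball of
    radius \<open>(n + 1) * L\<close>, from there to the ball of radius \<open>2 ^ j * r\<close>,
    and down the dyadic chain to radius \<open>r\<close>. The \<open>4 ^ n\<close> in
    \<open>E\<close> is the volume cost of a side \<open>L\<close> of at most
    \<open>4 * (2 ^ j * r)\<close>.\<close>
  define M where "M = ?\<kappa> + (4 * ?N) ^ ?n + 2 ^ ?n"
  define E where "E = 4 ^ ?n * (2 * (17 * K\<^sup>2 + M\<^sup>2) + 2 * D\<^sup>2)"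
  have \<kappa>: "?\<kappa> > 0" by (rule cube_ball_ratio_pos)
  have E0: "E > 0" using D by (simp add: E_def add_nonneg_pos)
  have "(\<integral>\<^sup>+y. ennreal (decay r (z - y)) * ennreal ((norm (heat f (\<tau>\<^sup>2) y - mean_on (ball z r) f))\<^sup>2) \<partial>lborel)
       \<le> ennreal (A * (E * a\<^sup>2))"
    if bmo: "bmo_bounded f a" and r: "r > 0" and \<tau>: "\<tau> > 0" "\<tau> \<le> r" for f :: "'a \<Rightarrow> 'b" and a r \<tau> z
  proof (rule bd[rule_format, OF r])
    note [measurable] = bmo_measurable[OF bmo]
    interpret tree_martingale "Pow Basis" subcube "cube_mean f"
      by (rule tree_martingale_cube_mean[OF bmo])
    have a: "a > 0" by (rule bmo_pos[OF bmo])
    define c where "c = mean_on (ball z r) f"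
    show "0 \<le> E * a\<^sup>2" using E0 by simp
    show "(\<lambda>y. ennreal ((norm (heat f (\<tau>\<^sup>2) y - mean_on (ball z r) f))\<^sup>2)) \<in> borel_measurable borel"
      by measurable
    fix j :: nat
    have one: "1 \<le> (2::real) ^ j" by simp
    have "\<tau> \<le> 2 * (2 ^ j * r)"
      using \<tau> r mult_right_mono[OF one less_imp_le[OF r]] by linarith
    \<comment> \<open>The side must be at least the diameter \<open>2 * (2 ^ j * r)\<close> for the
      cube centred at \<open>z\<close> to contain the ball.\<close>
    with exists_dyadic_multiple[OF \<tau>(1)] obtain N
      where N: "2 * (2 ^ j * r) \<le> 2 ^ N * \<tau>" "2 ^ N * \<tau> \<le> 2 * (2 * (2 ^ j * r))" by blast
    define L where "L = 2 ^ N * \<tau>"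
    have L: "L > 0" using \<tau> by (simp add: L_def)
    have \<tau>L: "\<tau> = L / 2 ^ N" by (simp add: L_def)
    have Lj: "2 * (2 ^ j * r) \<le> L" "L \<le> 4 * (2 ^ j * r)" using N by (auto simp: L_def)
    have rj: "2 ^ j * r > 0" using r by simp
    define x where "x = z - (L / 2) *\<^sub>R One"
    have sub: "ball z (2 ^ j * r) \<subseteq> cube x L"
      unfolding x_def using Lj by (intro ball_subset_cube)
    then have z: "z \<in> cube x L" using rj by (auto dest: subsetD[of _ _ z])
    define m where "m = cube_mean f (x, L)"
    have m: "m = mean_on (cube x L) f" using L by (simp add: m_def cube_mean_def)
    have mc: "norm (m - c) \<le> M * a * 2 ^ j"
    proof -
      have 1: "norm (m - mean_on (ball z (?N * L)) f) \<le> ?\<kappa> * a"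
        unfolding m by (rule bmo_cube_mean_diff[OF bmo L z])
      have 2: "norm (mean_on (ball z (2 ^ j * r)) f - mean_on (ball z (?N * L)) f) \<le> (4 * ?N) ^ ?n * a"
      proof (rule bmo_norm_mean_ball_diff[OF bmo rj])
        have "1 * L \<le> ?N * L" using L by (intro mult_right_mono) auto
        then show "2 ^ j * r \<le> ?N * L" using Lj rj by linarith
        show "?N * L \<le> 4 * ?N * (2 ^ j * r)"
          using mult_left_mono[OF Lj(2) of_nat_0_le_iff, of "DIM('a) + 1"] by (simp only: mult_ac)
      qed
      have 3: "norm (mean_on (ball z (2 ^ j * r)) f - c) \<le> real j * 2 ^ ?n * a"
        unfolding c_def by (rule bmo_norm_mean_dyadic[OF bmo r])
      have "norm (m - c) \<le> norm (m - mean_on (ball z (?N * L)) f)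
          + norm (mean_on (ball z (2 ^ j * r)) f - mean_on (ball z (?N * L)) f)
          + norm (mean_on (ball z (2 ^ j * r)) f - c)"
        by norm
      also have "\<dots> \<le> (?\<kappa> + (4 * ?N) ^ ?n) * a * 1 + 2 ^ ?n * a * real j"
        using 1 2 3 by (simp add: algebra_simps)
      also have "\<dots> \<le> (?\<kappa> + (4 * ?N) ^ ?n) * a * 2 ^ j + 2 ^ ?n * a * 2 ^ j"
        using \<kappa> a less_imp_le[OF of_nat_less_two_power[of j, where 'a = real]]
        by (intro add_mono mult_left_mono one mult_nonneg_nonneg add_nonneg_nonneg) auto
      also have "\<dots> = M * a * 2 ^ j" by (simp add: M_def algebra_simps)
      finally show ?thesis .
    qed
    have four: "(2 ^ j)\<^sup>2 = (4::real) ^ j"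
      by (simp add: power_mult[symmetric] mult.commute[of j] power_mult)
    \<comment> \<open>Orthogonality separates the variance inside the cube, bounded uniformly, from
      the squared drift of the mean; only the drift grows with \<open>j\<close>.\<close>
    have levN: "lev N (\<lambda>s. (norm (cube_mean f s - c))\<^sup>2) (x, L) \<le> (17 * K\<^sup>2 + M\<^sup>2) * a\<^sup>2 * 4 ^ j"
    proof -
      have "lev N (\<lambda>s. (norm (cube_mean f s - c))\<^sup>2) (x, L) \<le> 17 * (K * a)\<^sup>2 + (norm (m - c))\<^sup>2"
        using bmo_lev_cube_square[OF bmo, of N x L] unfolding lev_norm_square[of N c]
        by (simp add: m_def K_def mult_ac)
      also have "(norm (m - c))\<^sup>2 \<le> (M * a * 2 ^ j)\<^sup>2"
        using mc by (intro power_mono) auto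
      also have "\<dots> = M\<^sup>2 * a\<^sup>2 * 4 ^ j" by (simp add: power_mult_distrib four)
      also have "17 * (K * a)\<^sup>2 \<le> 17 * (K * a)\<^sup>2 * 4 ^ j"
        using mult_left_mono[of 1 "4 ^ j" "17 * (K * a)\<^sup>2"] by simp
      finally show ?thesis by (simp add: power_mult_distrib algebra_simps)
    qed
    have "(\<integral>\<^sup>+y\<in>ball z (2 ^ j * r). ennreal ((norm (heat f (\<tau>\<^sup>2) y - c))\<^sup>2) \<partial>lborel)
        \<le> (\<integral>\<^sup>+y\<in>cube x L. ennreal ((norm (heat f (\<tau>\<^sup>2) y - c))\<^sup>2) \<partial>lborel)"
      using sub by (intro nn_integral_mono mult_left_mono) (auto simp: indicator_def)
    also have "\<dots> \<le> ennreal (L ^ ?n * (2 * lev N (\<lambda>s. (norm (cube_mean f s - c))\<^sup>2) (x, L) + 2 * (D * a)\<^sup>2))"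
      unfolding \<tau>L using D bmo a by (intro bmo_cube_square[OF bmo _ _ L]) auto
    also have "\<dots> \<le> ennreal ((4 * (2 ^ j * r)) ^ ?n * (2 * ((17 * K\<^sup>2 + M\<^sup>2) * a\<^sup>2 * 4 ^ j) + 2 * D\<^sup>2 * a\<^sup>2 * 4 ^ j))"
    proof (intro ennreal_leI mult_mono)
      show "L ^ ?n \<le> (4 * (2 ^ j * r)) ^ ?n" using Lj L by (intro power_mono) auto
      have "2 * (D * a)\<^sup>2 \<le> 2 * D\<^sup>2 * a\<^sup>2 * 4 ^ j"
        using mult_left_mono[of 1 "4 ^ j" "2 * D\<^sup>2 * a\<^sup>2"] by (simp add: power_mult_distrib)
      with levN show "2 * lev N (\<lambda>s. (norm (cube_mean f s - c))\<^sup>2) (x, L) + 2 * (D * a)\<^sup>2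
          \<le> 2 * ((17 * K\<^sup>2 + M\<^sup>2) * a\<^sup>2 * 4 ^ j) + 2 * D\<^sup>2 * a\<^sup>2 * 4 ^ j"
        by linarith
      show "0 \<le> 2 * lev N (\<lambda>s. (norm (cube_mean f s - c))\<^sup>2) (x, L) + 2 * (D * a)\<^sup>2"
        by (intro mult_nonneg_nonneg add_nonneg_nonneg lev_nonneg) auto
    qed (use r in auto)
    also have "(4 * (2 ^ j * r)) ^ ?n * (2 * ((17 * K\<^sup>2 + M\<^sup>2) * a\<^sup>2 * 4 ^ j) + 2 * D\<^sup>2 * a\<^sup>2 * 4 ^ j)
        = E * a\<^sup>2 * 4 ^ j * (2 ^ j * r) ^ ?n"
      unfolding E_def power_mult_distrib by (simp add: algebra_simps)
    finally show "(\<integral>\<^sup>+y\<in>ball z (2 ^ j * r). ennreal ((norm (heat f (\<tau>\<^sup>2) y - mean_on (ball z r) f))\<^sup>2) \<partial>lborel)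
        \<le> ennreal (E * a\<^sup>2 * 4 ^ j * (2 ^ j * r) ^ ?n)"
      unfolding c_def .
  qed
  then show ?thesis
    using A E0 by (intro exI[of _ "A * E"]) (simp add: mult.assoc)
qed

section \<open>The Carleson estimate\<close>

text \<open>By \<open>s \<le> 1 + s\<^sup>2\<close> the mean square bound at the scale
  \<open>sqrt t\<close> yields integrability, which lets the variance inequality be applied to
  \<open>heat f t\<close> itself.\<close>

lemma heat_tempered:
  fixes f :: "'a::euclidean_space \<Rightarrow> 'b::euclidean_space"
  assumes bmo: "bmo_bounded f a" and t: "t > 0"
  shows "tempered (heat f t)"
proof (rule temperedI_at_one_scale)
  note [measurable] = bmo_measurable[OF bmo]
  show "heat f t \<in> borel_measurable borel" by measurable
  obtain C where C: "C > 0" "\<forall>f::'a \<Rightarrow> 'b. \<forall>a. bmo_bounded f a \<longrightarrow> (\<forall>r>0. \<forall>\<tau>>0. \<tau> \<le> r \<longrightarrow> (\<forall>z.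
     (\<integral>\<^sup>+y. ennreal (decay r (z - y)) * ennreal ((norm (heat f (\<tau>\<^sup>2) y - mean_on (ball z r) f))\<^sup>2) \<partial>lborel)
       \<le> ennreal (C * a\<^sup>2)))"
    using bmo_heat_square_decay[where 'a = 'a and 'b = 'b] by blast
  obtain D where D: "D > 0" "\<forall>r>0. \<forall>z::'a. (\<integral>\<^sup>+y. ennreal (decay r (z - y)) \<partial>lborel) \<le> ennreal D"
    using nn_integral_decay_le[where 'a = 'a] by blast
  fix x
  define r where "r = sqrt t"
  have r: "r > 0" "t = r\<^sup>2" using t by (auto simp: r_def)
  define c where "c = mean_on (ball x r) f"
  have "ennreal (decay r (x - y)) * ennreal (norm (heat f t y - c))
      \<le> ennreal (decay r (x - y)) + ennreal (decay r (x - y)) * ennreal ((norm (heat f t y - c))\<^sup>2)" for y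
  proof -
    have "s \<le> 1 + s\<^sup>2" if "s \<ge> 0" for s :: real
      using zero_le_power2[of "s - 1"] that by (simp add: power2_eq_square algebra_simps)
    then have "ennreal (norm (heat f t y - c)) \<le> 1 + ennreal ((norm (heat f t y - c))\<^sup>2)"
      by (simp add: ennreal_leI flip: ennreal_1 ennreal_plus)
    then have "ennreal (decay r (x - y)) * ennreal (norm (heat f t y - c))
        \<le> ennreal (decay r (x - y)) * (1 + ennreal ((norm (heat f t y - c))\<^sup>2))"
      by (intro mult_left_mono) auto
    then show ?thesis by (simp add: distrib_left)
  qed
  then have "(\<integral>\<^sup>+y. ennreal (decay r (x - y)) * ennreal (norm (heat f t y - c)) \<partial>lborel)
      \<le> (\<integral>\<^sup>+y. ennreal (decay r (x - y)) + ennreal (decay r (x - y)) * ennreal ((norm (heat f t y - c))\<^sup>2) \<partial>lborel)"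
    by (intro nn_integral_mono)
  also have "\<dots> = (\<integral>\<^sup>+y. ennreal (decay r (x - y)) \<partial>lborel)
      + (\<integral>\<^sup>+y. ennreal (decay r (x - y)) * ennreal ((norm (heat f t y - c))\<^sup>2) \<partial>lborel)"
    by (intro nn_integral_add) measurable
  also have "\<dots> \<le> ennreal D + ennreal (C * a\<^sup>2)"
    unfolding c_def r(2) using C D bmo r by (intro add_mono) auto
  also have "\<dots> < \<infinity>" by simp
  finally show "\<exists>r>0. \<exists>c. (\<integral>\<^sup>+y. ennreal (decay r (x - y)) * ennreal (norm (heat f t y - c)) \<partial>lborel) < \<infinity>"
    using r by blast
qed

text \<open>Differentiating the semigroup law in \<open>s\<close>, with uniqueness of the
  derivative.\<close>

lemma heat_deriv_heat:
  fixes f :: "'a::euclidean_space \<Rightarrow> 'b::euclidean_space"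
  assumes f: "tempered f" and ht: "tempered (heat f t)" and s: "s > 0" and t: "t > 0"
  shows "heat_deriv (heat f t) s x = heat_deriv f (s + t) x"
proof (rule vector_derivative_unique_at)
  show "((\<lambda>s. heat (heat f t) s x) has_vector_derivative heat_deriv (heat f t) s x) (at s)"
    by (rule heat_has_vector_derivative[OF ht s])
  have "((\<lambda>s. heat f s x) has_vector_derivative heat_deriv f (s + t) x) (at (s + t))"
    using s t by (intro heat_has_vector_derivative f) auto
  moreover have "((\<lambda>s. s + t) has_vector_derivative 1) (at s)"
    by (auto intro!: derivative_eq_intros)
  ultimately have "((\<lambda>s. heat f (s + t) x) has_vector_derivative heat_deriv f (s + t) x) (at s)"
    using vector_diff_chain_at[of "\<lambda>s. s + t" 1 s "\<lambda>s. heat f s x" "heat_deriv f (s + t) x"]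
    by (simp add: comp_def)
  then show "((\<lambda>s. heat (heat f t) s x) has_vector_derivative heat_deriv f (s + t) x) (at s)"
    by (rule has_vector_derivative_transform_within_open[of _ _ _ "{0<..}"])
       (use s t in \<open>auto simp: heat_heat[OF f]\<close>)
qed

text \<open>The substitution \<open>t \<mapsto> t / 2\<close> preserves \<open>dt / t\<close>, so the integrals of \<open>h\<close> telescope.\<close>

lemma nn_integral_halving_telescope:
  fixes w h :: "real \<Rightarrow> ennreal"
  assumes [measurable]: "w \<in> borel_measurable borel" "h \<in> borel_measurable borel"
    and R: "R > 0" and K: "K \<ge> 0"
    and step: "\<And>t. 0 < t \<Longrightarrow> t \<le> R \<Longrightarrow> w t + h t \<le> h (t / 2)"
    and bd: "\<And>t. 0 < t \<Longrightarrow> t \<le> R \<Longrightarrow> h t \<le> ennreal K"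
  shows "(\<integral>\<^sup>+t\<in>{0<..R}. w t * ennreal (1 / t) \<partial>lborel) \<le> ennreal K"
proof -
  \<comment> \<open>The times near 0 are cut off first: the integral of \<open>h\<close> against
    \<open>dt / t\<close> may diverge there, and an infinite term cannot be cancelled.\<close>
  have main: "(\<integral>\<^sup>+t\<in>{\<epsilon><..R}. w t * ennreal (1 / t) \<partial>lborel) \<le> ennreal K" if \<epsilon>: "0 < \<epsilon>" "\<epsilon> \<le> R" for \<epsilon>
  proof -
    define I where "I S = (\<integral>\<^sup>+t\<in>S. h t * ennreal (1 / t) \<partial>lborel)" for S
    let ?A = "\<integral>\<^sup>+t\<in>{\<epsilon><..R}. w t * ennreal (1 / t) \<partial>lborel"
    have I_le: "I {u<..v} \<le> ennreal (K / u * (v - u))" if "0 < u" "u \<le> v" "v \<le> R" for u v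
    proof -
      have "I {u<..v} \<le> (\<integral>\<^sup>+t\<in>{u<..v}. ennreal (K / u) \<partial>lborel)"
        unfolding I_def
      proof (rule nn_integral_mono)
        fix t
        show "h t * ennreal (1 / t) * indicator {u<..v} t \<le> ennreal (K / u) * indicator {u<..v} t"
        proof (cases "t \<in> {u<..v}")
          case True
          have "h t * ennreal (1 / t) \<le> ennreal K * ennreal (1 / u)"
            using True that by (intro mult_mono bd ennreal_leI) (auto simp: field_simps)
          then show ?thesis using True K that by (simp add: ennreal_mult'[symmetric])
        qed simp
      qed
      also have "\<dots> = ennreal (K / u * (v - u))"
        using that K by (simp add: nn_integral_cmult_indicator ennreal_mult'[symmetric])
      finally show ?thesis .
    qed
    have "?A + I {\<epsilon><..R} = (\<integral>\<^sup>+t\<in>{\<epsilon><..R}. (w t + h t) * ennreal (1 / t) \<partial>lborel)"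
      unfolding I_def by (subst nn_integral_add[symmetric]) (auto simp: distrib_right)
    also have "\<dots> \<le> (\<integral>\<^sup>+t\<in>{\<epsilon><..R}. h (t / 2) * ennreal (1 / t) \<partial>lborel)"
      using step \<epsilon> by (intro nn_integral_mono) (auto simp: indicator_def intro!: mult_right_mono)
    also have "\<dots> = (\<integral>\<^sup>+t. ennreal 2 * (h ((0 + 2 * t) / 2) * ennreal (1 / (0 + 2 * t)) * indicator {\<epsilon><..R} (0 + 2 * t)) \<partial>lborel)"
      by (subst nn_integral_real_affine[where c = 2 and t = 0]) (auto simp: nn_integral_cmult)
    also have "\<dots> = I {\<epsilon> / 2<..R / 2}"
      unfolding I_def
    proof (intro nn_integral_cong)
      fix t :: real
      show "ennreal 2 * (h ((0 + 2 * t) / 2) * ennreal (1 / (0 + 2 * t)) * indicator {\<epsilon><..R} (0 + 2 * t))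
          = h t * ennreal (1 / t) * indicator {\<epsilon> / 2<..R / 2} t"
      proof (cases "t \<in> {\<epsilon> / 2<..R / 2}")
        case True
        then have t: "t > 0" using \<epsilon> by auto
        have "ennreal 2 * ennreal (1 / (2 * t)) = ennreal (1 / t)"
          using t by (simp add: ennreal_mult'[symmetric] del: ennreal_numeral)
        then have "ennreal 2 * (h t * ennreal (1 / (2 * t))) = h t * ennreal (1 / t)"
          by (simp add: mult.left_commute)
        then show ?thesis using True by (simp add: indicator_def field_simps)
      qed (auto simp: indicator_def)
    qed
    \<comment> \<open>The range is enlarged from \<open>R / 2\<close> to \<open>R\<close> so that
      the integral over \<open>{\<epsilon><..R}\<close> reappears and cancels.\<close>
    also have "\<dots> \<le> (\<integral>\<^sup>+t. h t * ennreal (1 / t) * indicator {\<epsilon> / 2<..\<epsilon>} t + h t * ennreal (1 / t) * indicator {\<epsilon><..R} t \<partial>lborel)"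
      unfolding I_def using R by (intro nn_integral_mono) (auto simp: indicator_def)
    also have "\<dots> = I {\<epsilon> / 2<..\<epsilon>} + I {\<epsilon><..R}"
      unfolding I_def by (intro nn_integral_add) auto
    finally have "?A + I {\<epsilon><..R} \<le> I {\<epsilon> / 2<..\<epsilon>} + I {\<epsilon><..R}" .
    moreover have "I {\<epsilon><..R} < \<infinity>"
      using I_le[of \<epsilon> R] \<epsilon> by (auto intro: le_less_trans)
    ultimately have "?A \<le> I {\<epsilon> / 2<..\<epsilon>}"
      by (auto simp: ennreal_add_left_cancel_le add.commute)
    \<comment> \<open>On the remaining interval \<open>1 / t\<close> is at most
      \<open>2 / \<epsilon>\<close> and the length is \<open>\<epsilon> / 2\<close>, so the bound is
      exactly \<open>K\<close>, independent of \<open>\<epsilon>\<close>.\<close>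
    also have "\<dots> \<le> ennreal K"
      using I_le[of "\<epsilon> / 2" \<epsilon>] \<epsilon> by simp
    finally show ?thesis .
  qed
  \<comment> \<open>Viewing the integral as a measure lets the cutoff be removed by continuity from
    below.\<close>
  define M where "M = density lborel (\<lambda>t. w t * ennreal (1 / t))"
  have em: "emeasure M S = (\<integral>\<^sup>+t\<in>S. w t * ennreal (1 / t) \<partial>lborel)" if "S \<in> sets borel" for S
    unfolding M_def using that by (subst emeasure_density) auto
  define \<epsilon> where "\<epsilon> i = R / (real i + 1)" for i :: nat
  have \<epsilon>: "0 < \<epsilon> i" "\<epsilon> i \<le> R" for i using R by (auto simp: \<epsilon>_def field_simps)
  have U: "{0<..R} = (\<Union>i. {\<epsilon> i<..R})"
  proof (intro set_eqI iffI)
    fix t assume t: "t \<in> {0<..R}"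
    obtain n :: nat where "R / t < n" using reals_Archimedean2 by blast
    then have "\<epsilon> n < t" using t by (simp add: \<epsilon>_def field_simps)
    with t show "t \<in> (\<Union>i. {\<epsilon> i<..R})" by auto
  next
    fix t assume "t \<in> (\<Union>i. {\<epsilon> i<..R})"
    then show "t \<in> {0<..R}" using \<epsilon>(1) by (auto intro: less_trans)
  qed
  have "incseq (\<lambda>i. {\<epsilon> i<..R})"
  proof (rule incseq_SucI)
    fix i
    have "\<epsilon> (Suc i) \<le> \<epsilon> i" using R by (simp add: \<epsilon>_def frac_le)
    then show "{\<epsilon> i<..R} \<subseteq> {\<epsilon> (Suc i)<..R}" by auto
  qed
  then have "(SUP i. emeasure M {\<epsilon> i<..R}) = emeasure M {0<..R}"
    unfolding U by (intro SUP_emeasure_incseq) (auto simp: M_def)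
  moreover have "(SUP i. emeasure M {\<epsilon> i<..R}) \<le> ennreal K"
    using main[OF \<epsilon>] by (intro SUP_least) (simp add: em)
  ultimately show ?thesis by (simp add: em)
qed

definition g_density :: "('a::euclidean_space \<Rightarrow> 'b::euclidean_space) \<Rightarrow> real \<Rightarrow> 'a \<Rightarrow> ennreal" where
  "g_density f t x = ennreal ((norm (t *\<^sub>R heat_deriv f t x))\<^sup>2 / t)"

lemma g_density_measurable [measurable (raw)]:
  assumes [measurable]: "f \<in> borel_measurable borel" "g \<in> borel_measurable M" "h \<in> borel_measurable M"
  shows "(\<lambda>p. g_density f (g p) (h p)) \<in> borel_measurable M"
  unfolding g_density_def by measurable

theorem bmo_carleson:
  "\<exists>C>0. \<forall>f::'a::euclidean_space \<Rightarrow> 'b::euclidean_space. \<forall>a. bmo_bounded f a \<longrightarrow> (\<forall>r>0. \<forall>z.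
     (\<integral>\<^sup>+x\<in>ball z r. (\<integral>\<^sup>+t\<in>{0<..r\<^sup>2}. g_density f t x \<partial>lborel) \<partial>lborel)
       \<le> ennreal (C * a\<^sup>2) * emeasure lborel (ball z r))"
proof -
  obtain P where P: "P > 0" "\<forall>t>0. \<forall>w::'a. heat_kernel t w \<le> P * decay (sqrt t) w"
    using heat_kernel_le_decay_sqrt[where 'a = 'a] by blast
  obtain S where S: "S > 0" "\<forall>f::'a \<Rightarrow> 'b. \<forall>a. bmo_bounded f a \<longrightarrow> (\<forall>r>0. \<forall>\<tau>>0. \<tau> \<le> r \<longrightarrow> (\<forall>z.
     (\<integral>\<^sup>+y. ennreal (decay r (z - y)) * ennreal ((norm (heat f (\<tau>\<^sup>2) y - mean_on (ball z r) f))\<^sup>2) \<partial>lborel)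
       \<le> ennreal (S * a\<^sup>2)))"
    using bmo_heat_square_decay[where 'a = 'a and 'b = 'b] by blast
  obtain V where V: "V > 0" "\<forall>f::'a \<Rightarrow> 'b. \<forall>t>0. \<forall>x c. tempered f \<longrightarrow>
     ennreal ((norm (t *\<^sub>R heat_deriv f t x))\<^sup>2) + ennreal V * ennreal ((norm (heat f t x - c))\<^sup>2)
     \<le> ennreal V * (\<integral>\<^sup>+y. ennreal (heat_kernel t (x - y)) * ennreal ((norm (f y - c))\<^sup>2) \<partial>lborel)"
    using heat_deriv_le_variance[where 'a = 'a and 'b = 'b] by blast
  obtain Q where Q: "Q > 0" "\<forall>r>0. \<forall>s. \<forall>w::'a. norm w \<le> r \<longrightarrow> r\<^sup>2 \<le> s \<longrightarrow> s \<le> 2 * r\<^sup>2 \<longrightarrow>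
     Q * inverse (r ^ DIM('a)) \<le> heat_kernel s w"
    using heat_kernel_lower_bound[where 'a = 'a] by blast
  let ?n = "DIM('a)"
  define D where "D = P * 2 ^ (2 * ?n + 3) * S"
  define \<omega> where "\<omega> = unit_vol TYPE('a)"
  have D: "D > 0" using P S by (simp add: D_def)
  have \<omega>: "\<omega> > 0" by (simp add: \<omega>_def)
  \<comment> \<open>\<open>4 * V * D\<close> bounds the telescoped integral, \<open>Q\<close> is the
    lower bound of the kernel on the ball, and \<open>\<omega>\<close> converts \<open>r ^ n\<close>
    into the measure of the ball.\<close>
  let ?C = "4 * V * D / (Q * \<omega>)"
  have main: "(\<integral>\<^sup>+x\<in>ball z r. (\<integral>\<^sup>+t\<in>{0<..r\<^sup>2}. g_density f t x \<partial>lborel) \<partial>lborel)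
       \<le> ennreal (?C * a\<^sup>2) * emeasure lborel (ball z r)"
    if bmo: "bmo_bounded f a" and r: "r > 0" for f :: "'a \<Rightarrow> 'b" and a r z
  proof -
    note [measurable] = bmo_measurable[OF bmo]
    have [measurable]: "ball z r \<in> sets borel" by simp
    note f = bmo_tempered[OF bmo]
    define c where "c = mean_on (ball z r) f"
    define T where "T = 2 * r\<^sup>2"
    define H where "H t = (\<integral>\<^sup>+y. ennreal (heat_kernel (T - t) (z - y)) * ennreal ((norm (heat f t y - c))\<^sup>2) \<partial>lborel)" for t
    define W where "W t = (\<integral>\<^sup>+x. ennreal (heat_kernel (T - t) (z - x)) * ennreal ((norm (t *\<^sub>R heat_deriv f t x))\<^sup>2) \<partial>lborel)" for t
    have r2: "r\<^sup>2 > 0" using r by simp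
    have H_le: "H t \<le> ennreal (D * a\<^sup>2)" if t: "0 < t" "t \<le> r\<^sup>2" for t
    proof -
      define \<tau> where "\<tau> = sqrt t"
      have \<tau>: "\<tau> > 0" "\<tau> \<le> r" "t = \<tau>\<^sup>2" using t r by (auto simp: \<tau>_def real_le_lsqrt)
      have Tt: "T - t > 0" "r\<^sup>2 \<le> T - t" "T - t \<le> 4 * r\<^sup>2" using t r2 by (auto simp: T_def)
      have le: "heat_kernel (T - t) w \<le> P * 2 ^ (2 * ?n + 3) * decay r w" for w :: 'a
      proof -
        have "r \<le> sqrt (T - t)" using Tt r by (simp add: real_le_rsqrt)
        moreover have "sqrt (T - t) \<le> 2 * r"
          using Tt r by (intro real_le_lsqrt) (auto simp: power_mult_distrib)
        ultimately have "decay (sqrt (T - t)) w \<le> 2 ^ (2 * ?n + 3) * decay r w"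
          using r by (intro decay_comparable) auto
        then have "P * decay (sqrt (T - t)) w \<le> P * (2 ^ (2 * ?n + 3) * decay r w)"
          using P by (intro mult_left_mono) auto
        with P(2)[rule_format, OF Tt(1), of w] show ?thesis by (simp only: mult.assoc)
      qed
      have "H t \<le> (\<integral>\<^sup>+y. ennreal (P * 2 ^ (2 * ?n + 3)) * (ennreal (decay r (z - y)) * ennreal ((norm (heat f t y - c))\<^sup>2)) \<partial>lborel)"
        unfolding H_def
      proof (intro nn_integral_mono)
        fix y
        have "ennreal (heat_kernel (T - t) (z - y)) \<le> ennreal (P * 2 ^ (2 * ?n + 3)) * ennreal (decay r (z - y))"
          using P le[of "z - y"] by (simp add: ennreal_mult'[symmetric] ennreal_leI)
        then show "ennreal (heat_kernel (T - t) (z - y)) * ennreal ((norm (heat f t y - c))\<^sup>2)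
            \<le> ennreal (P * 2 ^ (2 * ?n + 3)) * (ennreal (decay r (z - y)) * ennreal ((norm (heat f t y - c))\<^sup>2))"
          unfolding mult.assoc[symmetric] by (intro mult_right_mono) auto
      qed
      also have "\<dots> \<le> ennreal (P * 2 ^ (2 * ?n + 3)) * ennreal (S * a\<^sup>2)"
        using S(2)[rule_format, OF bmo r \<tau>(1,2), of z] unfolding \<tau>(3) c_def
        by (subst nn_integral_cmult) (auto intro!: mult_left_mono)
      finally show ?thesis using P S by (simp add: D_def ennreal_mult'[symmetric] mult.assoc)
    qed
    \<comment> \<open>The variance inequality is applied to \<open>heat f (t / 2)\<close> at time
      \<open>t / 2\<close>; since \<open>t\<^sup>2\<close> is four times
      \<open>(t / 2)\<^sup>2\<close>, its constant becomes \<open>4 * V\<close>. Averaging over time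
      \<open>T - t\<close> then adds up to \<open>T - t / 2\<close>, the kernel time in
      \<open>H (t / 2)\<close>.\<close>
    have step: "W t + ennreal (4 * V) * H t \<le> ennreal (4 * V) * H (t / 2)" if t: "0 < t" "t \<le> r\<^sup>2" for t
    proof -
      have t2: "t / 2 > 0" and Tt: "T - t > 0" using t r2 by (auto simp: T_def)
      have ht: "tempered (heat f (t / 2))" by (rule heat_tempered[OF bmo t2])
      have pw: "ennreal ((norm (t *\<^sub>R heat_deriv f t x))\<^sup>2) + ennreal (4 * V) * ennreal ((norm (heat f t x - c))\<^sup>2)
          \<le> ennreal (4 * V) * (\<integral>\<^sup>+y. ennreal (heat_kernel (t / 2) (x - y)) * ennreal ((norm (heat f (t / 2) y - c))\<^sup>2) \<partial>lborel)"
        (is "?L \<le> _ * ?I") for x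
      proof -
        have "(norm (t *\<^sub>R heat_deriv f t x))\<^sup>2 = 4 * (norm ((t / 2) *\<^sub>R heat_deriv f t x))\<^sup>2"
          by (simp add: power_mult_distrib power_divide)
        then have "?L = ennreal 4 * (ennreal ((norm ((t / 2) *\<^sub>R heat_deriv f t x))\<^sup>2) + ennreal V * ennreal ((norm (heat f t x - c))\<^sup>2))"
          using V(1) by (simp add: ennreal_mult distrib_left mult.assoc)
        also have "\<dots> \<le> ennreal 4 * (ennreal V * ?I)"
          using V(2)[rule_format, OF t2 ht, of x c] heat_deriv_heat[OF f ht t2 t2, of x] heat_heat[OF f t2 t2, of x]
          by (intro mult_left_mono) auto
        finally show ?thesis using V(1) by (simp add: ennreal_mult mult.assoc)
      qed
      have "W t + ennreal (4 * V) * H t = (\<integral>\<^sup>+x. ennreal (heat_kernel (T - t) (z - x)) *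
          (ennreal ((norm (t *\<^sub>R heat_deriv f t x))\<^sup>2) + ennreal (4 * V) * ennreal ((norm (heat f t x - c))\<^sup>2)) \<partial>lborel)"
        unfolding W_def H_def
        by (simp add: nn_integral_cmult[symmetric] nn_integral_add[symmetric] distrib_left mult.left_commute)
      also have "\<dots> \<le> (\<integral>\<^sup>+x. ennreal (heat_kernel (T - t) (z - x)) * (ennreal (4 * V) *
          (\<integral>\<^sup>+y. ennreal (heat_kernel (t / 2) (x - y)) * ennreal ((norm (heat f (t / 2) y - c))\<^sup>2) \<partial>lborel)) \<partial>lborel)"
        by (intro nn_integral_mono mult_left_mono pw) auto
      also have "\<dots> = ennreal (4 * V) * (\<integral>\<^sup>+x. ennreal (heat_kernel (T - t) (z - x)) *
          (\<integral>\<^sup>+y. ennreal (heat_kernel (t / 2) (x - y)) * ennreal ((norm (heat f (t / 2) y - c))\<^sup>2) \<partial>lborel) \<partial>lborel)"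
        by (simp add: nn_integral_cmult[symmetric] mult.left_commute)
      also have "\<dots> = ennreal (4 * V) * H (t / 2)"
        unfolding H_def by (subst heat_semigroup_nn) (use Tt t2 in auto)
      finally show ?thesis .
    qed
    have W_int: "(\<integral>\<^sup>+t\<in>{0<..r\<^sup>2}. W t * ennreal (1 / t) \<partial>lborel) \<le> ennreal (4 * V * (D * a\<^sup>2))"
    proof (rule nn_integral_halving_telescope[where h = "\<lambda>t. ennreal (4 * V) * H t"])
      show "W \<in> borel_measurable borel" unfolding W_def by measurable
      show "(\<lambda>t. ennreal (4 * V) * H t) \<in> borel_measurable borel" unfolding H_def by measurable
      show "ennreal (4 * V) * H t \<le> ennreal (4 * V * (D * a\<^sup>2))" if "0 < t" "t \<le> r\<^sup>2" for t
        using mult_left_mono[OF H_le[OF that], of "ennreal (4 * V)"] V D by (simp add: ennreal_mult)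
    qed (use step r2 V D in auto)
    have "ennreal (Q * inverse (r ^ ?n)) * (\<integral>\<^sup>+x\<in>ball z r. (\<integral>\<^sup>+t\<in>{0<..r\<^sup>2}. g_density f t x \<partial>lborel) \<partial>lborel)
        = (\<integral>\<^sup>+x. (\<integral>\<^sup>+t. ennreal (Q * inverse (r ^ ?n)) * indicator (ball z r) x * (g_density f t x * indicator {0<..r\<^sup>2} t) \<partial>lborel) \<partial>lborel)"
      by (subst nn_integral_cmult[symmetric], measurable)
        (intro nn_integral_cong, subst nn_integral_cmult, auto simp: mult_ac)
    also have "\<dots> = (\<integral>\<^sup>+t. (\<integral>\<^sup>+x. ennreal (Q * inverse (r ^ ?n)) * indicator (ball z r) x * (g_density f t x * indicator {0<..r\<^sup>2} t) \<partial>lborel) \<partial>lborel)"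
      by (intro lborel_pair.Fubini') measurable
    also have "\<dots> \<le> (\<integral>\<^sup>+t\<in>{0<..r\<^sup>2}. W t * ennreal (1 / t) \<partial>lborel)"
    proof (intro nn_integral_mono)
      fix t :: real
      show "(\<integral>\<^sup>+x. ennreal (Q * inverse (r ^ ?n)) * indicator (ball z r) x * (g_density f t x * indicator {0<..r\<^sup>2} t) \<partial>lborel)
          \<le> W t * ennreal (1 / t) * indicator {0<..r\<^sup>2} t"
      proof (cases "t \<in> {0<..r\<^sup>2}")
        case True
        then have t: "0 < t" "t \<le> r\<^sup>2" by auto
        have "(\<integral>\<^sup>+x. ennreal (Q * inverse (r ^ ?n)) * indicator (ball z r) x * g_density f t x \<partial>lborel)
            \<le> (\<integral>\<^sup>+x. ennreal (heat_kernel (T - t) (z - x)) * ennreal ((norm (t *\<^sub>R heat_deriv f t x))\<^sup>2) * ennreal (1 / t) \<partial>lborel)"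
        proof (intro nn_integral_mono)
          fix x
          have "ennreal (Q * inverse (r ^ ?n)) * indicator (ball z r) x \<le> ennreal (heat_kernel (T - t) (z - x))"
          proof (cases "x \<in> ball z r")
            case True
            then have "norm (z - x) \<le> r" by (simp add: dist_norm)
            then have "Q * inverse (r ^ ?n) \<le> heat_kernel (T - t) (z - x)"
              using Q(2)[rule_format, OF r, of "z - x" "T - t"] t by (simp add: T_def)
            with True show ?thesis by (simp add: ennreal_leI)
          qed simp
          moreover have "g_density f t x = ennreal ((norm (t *\<^sub>R heat_deriv f t x))\<^sup>2) * ennreal (1 / t)"
            using t unfolding g_density_def by (subst ennreal_mult'[symmetric]) auto
          ultimately show "ennreal (Q * inverse (r ^ ?n)) * indicator (ball z r) x * g_density f t x
              \<le> ennreal (heat_kernel (T - t) (z - x)) * ennreal ((norm (t *\<^sub>R heat_deriv f t x))\<^sup>2) * ennreal (1 / t)"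
            by (simp only: mult.assoc[symmetric]) (intro mult_right_mono, auto)
        qed
        also have "\<dots> = W t * ennreal (1 / t)"
          unfolding W_def by (rule nn_integral_multc) measurable
        finally show ?thesis using True by simp
      qed simp
    qed
    also note W_int
    finally have le: "ennreal (Q * inverse (r ^ ?n)) * (\<integral>\<^sup>+x\<in>ball z r. (\<integral>\<^sup>+t\<in>{0<..r\<^sup>2}. g_density f t x \<partial>lborel) \<partial>lborel)
        \<le> ennreal (4 * V * (D * a\<^sup>2))" (is "_ * ?X \<le> _") .
    have inv: "ennreal (r ^ ?n / Q) * ennreal (Q * inverse (r ^ ?n)) = 1"
      using Q r by (simp add: ennreal_mult'[symmetric])
    have "?X = (ennreal (r ^ ?n / Q) * ennreal (Q * inverse (r ^ ?n))) * ?X"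
      unfolding inv by simp
    also have "\<dots> \<le> ennreal (r ^ ?n / Q) * ennreal (4 * V * (D * a\<^sup>2))"
      unfolding mult.assoc[of "ennreal (r ^ ?n / Q)"] by (intro mult_left_mono le) auto
    also have "\<dots> = ennreal (?C * a\<^sup>2 * (\<omega> * r ^ ?n))"
      using Q r \<omega> by (simp add: ennreal_mult'[symmetric] field_simps)
    also have "\<dots> = ennreal (?C * a\<^sup>2) * emeasure lborel (ball z r)"
      using r V D Q \<omega> by (subst ennreal_mult) (auto simp: emeasure_ball \<omega>_def)
    finally show ?thesis .
  qed
  have "?C > 0" using V D Q \<omega> by simp
  with main show ?thesis by blast
qed

section \<open>Oscillation of the large times\<close>

text \<open>The mean-zero property allows a constant to be subtracted from \<open>f\<close>. In the
  difference the same constant, the mean about \<open>x\<close>, serves both points, since the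
  kernel difference is already controlled by decay centred at \<open>x\<close>.\<close>

lemma bmo_heat_deriv_bounds:
  "\<exists>C>0. \<forall>f::'a::euclidean_space \<Rightarrow> 'b::euclidean_space. \<forall>a. bmo_bounded f a \<longrightarrow> (\<forall>r>0. \<forall>x.
     norm (r\<^sup>2 *\<^sub>R heat_deriv f (r\<^sup>2) x) \<le> C * a \<and>
     (\<forall>y. norm (x - y) \<le> 2 * r \<longrightarrow>
       norm (r\<^sup>2 *\<^sub>R heat_deriv f (r\<^sup>2) x - r\<^sup>2 *\<^sub>R heat_deriv f (r\<^sup>2) y) \<le> C * (norm (x - y) / r) * a))"
proof -
  obtain P where P: "P > 0" "\<forall>r>0. \<forall>w::'a. r\<^sup>2 * \<bar>heat_kernel_deriv (r\<^sup>2) w\<bar> \<le> P * decay r w"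
    using heat_kernel_deriv_le_decay[where 'a = 'a] by blast
  obtain L where L: "L > 0" "\<forall>r>0. \<forall>x y::'a. norm (x - y) \<le> 2 * r \<longrightarrow>
     r\<^sup>2 * \<bar>heat_kernel_deriv (r\<^sup>2) x - heat_kernel_deriv (r\<^sup>2) y\<bar> \<le> L * (norm (x - y) / r) * decay r x"
    using heat_kernel_deriv_diff_le_decay[where 'a = 'a] by blast
  obtain B where B: "B > 0" "\<forall>f::'a \<Rightarrow> 'b. \<forall>a. bmo_bounded f a \<longrightarrow> (\<forall>r>0. \<forall>z.
     (\<integral>\<^sup>+y. ennreal (decay r (z - y)) * ennreal (norm (f y - mean_on (ball z r) f)) \<partial>lborel) \<le> ennreal (B * a))"
    using bmo_nn_integral_decay[where 'a = 'a and 'b = 'b] by blast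
  let ?C = "(P + L) * B"
  have main: "norm (r\<^sup>2 *\<^sub>R heat_deriv f (r\<^sup>2) x) \<le> ?C * a"
      "norm (x - y) \<le> 2 * r \<Longrightarrow>
       norm (r\<^sup>2 *\<^sub>R heat_deriv f (r\<^sup>2) x - r\<^sup>2 *\<^sub>R heat_deriv f (r\<^sup>2) y) \<le> ?C * (norm (x - y) / r) * a"
    if bmo: "bmo_bounded f a" and r: "r > 0" for f :: "'a \<Rightarrow> 'b" and a r x y
  proof -
    note [measurable] = bmo_measurable[OF bmo]
    note f = bmo_tempered[OF bmo]
    have a: "a > 0" by (rule bmo_pos[OF bmo])
    define c where "c = mean_on (ball x r) f"
    have fc: "tempered (\<lambda>y. f y - c)" by (intro tempered_diff f tempered_const)
    have r2: "r\<^sup>2 > 0" using r by simp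
    have v: "r\<^sup>2 *\<^sub>R heat_deriv f (r\<^sup>2) x = (\<integral>w. (r\<^sup>2 * heat_kernel_deriv (r\<^sup>2) (x - w)) *\<^sub>R (f w - c) \<partial>lborel)" for x
      unfolding scaleR_scaleR[symmetric]
      by (subst heat_deriv_diff_const[OF f r2, of c x, symmetric]) (simp add: heat_deriv_def del: scaleR_scaleR)
    have int: "integrable lborel (\<lambda>w. (r\<^sup>2 * heat_kernel_deriv (r\<^sup>2) (x - w)) *\<^sub>R (f w - c))" for x
      unfolding scaleR_scaleR[symmetric] by (intro integrable_scaleR_right heat_deriv_integrable fc r2)
    have bd: "(\<integral>\<^sup>+w. ennreal (decay r (x - w)) * ennreal (norm (f w - c)) \<partial>lborel) \<le> ennreal (B * a)"
      using B(2)[rule_format, OF bmo r] by (simp add: c_def)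
    have "norm (\<integral>w. (r\<^sup>2 * heat_kernel_deriv (r\<^sup>2) (x - w)) *\<^sub>R (f w - c) \<partial>lborel) \<le> P * (B * a)"
    proof (rule norm_integral_le_decay[OF _ _ r _ _ _ int bd])
      show "\<bar>r\<^sup>2 * heat_kernel_deriv (r\<^sup>2) (x - w)\<bar> \<le> P * decay r (x - w)" for w
        using P(2)[rule_format, OF r, of "x - w"] by (simp add: abs_mult)
    qed (use P B a in auto)
    also have "\<dots> \<le> ?C * a"
      using L B a by (simp add: algebra_simps)
    finally show "norm (r\<^sup>2 *\<^sub>R heat_deriv f (r\<^sup>2) x) \<le> ?C * a"
      unfolding v .
    assume xy: "norm (x - y) \<le> 2 * r"
    let ?\<delta> = "norm (x - y) / r"
    have \<delta>: "?\<delta> \<ge> 0" using r by simp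
    let ?k = "\<lambda>w. r\<^sup>2 * heat_kernel_deriv (r\<^sup>2) (x - w) - r\<^sup>2 * heat_kernel_deriv (r\<^sup>2) (y - w)"
    have diff: "r\<^sup>2 *\<^sub>R heat_deriv f (r\<^sup>2) x - r\<^sup>2 *\<^sub>R heat_deriv f (r\<^sup>2) y = (\<integral>w. ?k w *\<^sub>R (f w - c) \<partial>lborel)"
      unfolding v scaleR_diff_left by (intro Bochner_Integration.integral_diff[symmetric] int)
    have "norm (\<integral>w. ?k w *\<^sub>R (f w - c) \<partial>lborel) \<le> (L * ?\<delta>) * (B * a)"
    proof (rule norm_integral_le_decay[OF _ _ r _ _ _ _ bd])
      show "integrable lborel (\<lambda>w. ?k w *\<^sub>R (f w - c))"
        unfolding scaleR_diff_left by (intro Bochner_Integration.integrable_diff int)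
      show "\<bar>?k w\<bar> \<le> L * ?\<delta> * decay r (x - w)" for w
        using L(2)[rule_format, OF r, of "x - w" "y - w"] xy
        by (simp add: abs_mult flip: right_diff_distrib)
      show "0 \<le> L * ?\<delta>" using L \<delta> by (intro mult_nonneg_nonneg) auto
    qed (use B a in auto)
    also have "(L * ?\<delta>) * (B * a) \<le> ?C * ?\<delta> * a"
    proof -
      have "0 \<le> P * B * ?\<delta> * a" using P B a \<delta> by (intro mult_nonneg_nonneg) auto
      then show ?thesis by (simp add: algebra_simps)
    qed
    finally show "norm (r\<^sup>2 *\<^sub>R heat_deriv f (r\<^sup>2) x - r\<^sup>2 *\<^sub>R heat_deriv f (r\<^sup>2) y) \<le> ?C * ?\<delta> * a"
      unfolding diff .
  qed
  have "?C > 0" using P L B by simp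
  with main show ?thesis by blast
qed

text \<open>The weight is scale invariant, so the value does not depend on \<open>r\<close>; this
  makes the oscillation bound uniform over all balls.\<close>

lemma nn_integral_powr_tail:
  assumes r: "r > 0"
  shows "(\<integral>\<^sup>+t. ennreal (r * t powr (- 3 / 2)) * indicator {r\<^sup>2..} t \<partial>lborel) = 2"
proof -
  have r2: "r\<^sup>2 > 0" using r by simp
  have "(\<integral>\<^sup>+t. ennreal (r * t powr (- 3 / 2)) * indicator {r\<^sup>2..} t \<partial>lborel)
      = ennreal (0 - (- 2 * r * (r\<^sup>2) powr (- 1 / 2)))"
  proof (rule nn_integral_FTC_atLeast)
    fix t :: real assume "r\<^sup>2 \<le> t"
    then have t: "t > 0" using r2 by linarith
    show "((\<lambda>t. - 2 * r * t powr (- 1 / 2)) has_real_derivative r * t powr (- 3 / 2)) (at t)"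
      using t by (auto intro!: derivative_eq_intros simp: powr_diff[symmetric])
    show "0 \<le> r * t powr (- 3 / 2)" using r by simp
  next
    have "((\<lambda>t::real. t powr (- 1 / 2)) \<longlongrightarrow> 0) at_top"
      by (intro tendsto_neg_powr filterlim_ident) auto
    then show "((\<lambda>t. - 2 * r * t powr (- 1 / 2)) \<longlongrightarrow> 0) at_top"
      using tendsto_mult_right_zero by blast
  qed measurable
  also have "(r\<^sup>2) powr (- 1 / 2) = inverse r"
    using r by (simp add: powr_minus powr_half_sqrt)
  finally show ?thesis using r by (simp add: mult.assoc)
qed

text \<open>The Lipschitz bound gains a factor \<open>r / sqrt t\<close> over the size bound, which
  makes the difference of the squares integrable against \<open>dt / t\<close> for
  \<open>t > r\<^sup>2\<close>. The additive one-sided form remains meaningful when a tail is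
  infinite.\<close>

lemma bmo_tail_oscillation:
  "\<exists>C>0. \<forall>f::'a::euclidean_space \<Rightarrow> 'b::euclidean_space. \<forall>a. bmo_bounded f a \<longrightarrow> (\<forall>r>0. \<forall>x y.
     norm (x - y) \<le> 2 * r \<longrightarrow>
     (\<integral>\<^sup>+t\<in>{r\<^sup>2<..}. g_density f t x \<partial>lborel) \<le> (\<integral>\<^sup>+t\<in>{r\<^sup>2<..}. g_density f t y \<partial>lborel) + ennreal (C * a\<^sup>2))"
proof -
  obtain C where C: "C > 0" "\<forall>f::'a \<Rightarrow> 'b. \<forall>a. bmo_bounded f a \<longrightarrow> (\<forall>r>0. \<forall>x.
     norm (r\<^sup>2 *\<^sub>R heat_deriv f (r\<^sup>2) x) \<le> C * a \<and>
     (\<forall>y. norm (x - y) \<le> 2 * r \<longrightarrow>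
       norm (r\<^sup>2 *\<^sub>R heat_deriv f (r\<^sup>2) x - r\<^sup>2 *\<^sub>R heat_deriv f (r\<^sup>2) y) \<le> C * (norm (x - y) / r) * a))"
    using bmo_heat_deriv_bounds[where 'a = 'a and 'b = 'b] by blast
  have "(\<integral>\<^sup>+t\<in>{r\<^sup>2<..}. g_density f t x \<partial>lborel)
      \<le> (\<integral>\<^sup>+t\<in>{r\<^sup>2<..}. g_density f t y \<partial>lborel) + ennreal (8 * C\<^sup>2 * a\<^sup>2)"
    if bmo: "bmo_bounded f a" and r: "r > 0" and xy: "norm (x - y) \<le> 2 * r" for f :: "'a \<Rightarrow> 'b" and a r x y
  proof -
    note [measurable] = bmo_measurable[OF bmo]
    have a: "a > 0" by (rule bmo_pos[OF bmo])
    let ?K = "4 * C\<^sup>2 * a\<^sup>2"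
    have pw: "g_density f t x \<le> g_density f t y + ennreal ?K * ennreal (r * t powr (- 3 / 2))" if t: "r\<^sup>2 < t" for t
    proof -
      define \<tau> where "\<tau> = sqrt t"
      have t0: "t > 0" using t zero_le_power2[of r] by linarith
      have \<tau>: "\<tau> > 0" "t = \<tau>\<^sup>2" using t0 by (auto simp: \<tau>_def)
      have "r \<le> \<tau>" using t r by (simp add: \<tau>_def real_le_rsqrt)
      then have xy': "norm (x - y) \<le> 2 * \<tau>" using xy by linarith
      define v where "v z = t *\<^sub>R heat_deriv f t z" for z
      have v: "norm (v x) \<le> C * a" "norm (v y) \<le> C * a" "norm (v x - v y) \<le> C * (norm (x - y) / \<tau>) * a"
        using C(2)[rule_format, OF bmo \<tau>(1)] xy' unfolding v_def \<tau>(2) by blast+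
      have "norm (x - y) / \<tau> \<le> 2 * r / \<tau>"
        using xy \<tau> by (intro divide_right_mono) auto
      then have "C * (norm (x - y) / \<tau>) * a \<le> C * (2 * r / \<tau>) * a"
        using C a by (intro mult_right_mono mult_left_mono) auto
      with v(3) have v3: "norm (v x - v y) \<le> C * (2 * r / \<tau>) * a" by linarith
      have "norm (v x) - norm (v y) \<le> C * (2 * r / \<tau>) * a"
        using norm_triangle_ineq2[of "v x" "v y"] v3 by linarith
      moreover have "norm (v x) + norm (v y) \<le> 2 * (C * a)" using v by linarith
      moreover have "0 \<le> C * (2 * r / \<tau>) * a" using C r \<tau> a by simp
      \<comment> \<open>A difference of squares factors into the small difference and the merely
        bounded sum.\<close>
      ultimately have "(norm (v x) - norm (v y)) * (norm (v x) + norm (v y)) \<le> (C * (2 * r / \<tau>) * a) * (2 * (C * a))"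
        by (intro order_trans[OF mult_right_mono mult_left_mono]) auto
      then have "(norm (v x))\<^sup>2 \<le> (norm (v y))\<^sup>2 + ?K * (r / \<tau>)"
        by (simp add: power2_eq_square algebra_simps)
      then have "(norm (v x))\<^sup>2 / t \<le> ((norm (v y))\<^sup>2 + ?K * (r / \<tau>)) / t"
        using t0 by (intro divide_right_mono) auto
      also have "\<dots> = (norm (v y))\<^sup>2 / t + ?K * (r * t powr (- 3 / 2))"
      proof -
        have "t powr (- 3 / 2) = t powr (- 1 / 2 + - 1)" by simp
        also have "\<dots> = t powr (- 1 / 2) * t powr (- 1)" by (rule powr_add)
        also have "t powr (- 1 / 2) = inverse \<tau>" using t0 by (simp add: \<tau>_def powr_minus powr_half_sqrt)
        also have "t powr (- 1) = inverse t" using t0 by (simp add: powr_minus)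
        finally have "r * t powr (- 3 / 2) = r / \<tau> / t" by (simp only: divide_inverse mult.assoc)
        then show ?thesis by (simp only: add_divide_distrib times_divide_eq_right)
      qed
      finally show ?thesis
        using t0 r unfolding g_density_def v_def[symmetric]
        by (simp add: ennreal_leI ennreal_mult'[symmetric] ennreal_plus[symmetric] del: ennreal_plus)
    qed
    have "(\<integral>\<^sup>+t\<in>{r\<^sup>2<..}. g_density f t x \<partial>lborel)
        \<le> (\<integral>\<^sup>+t. g_density f t y * indicator {r\<^sup>2<..} t + ennreal ?K * (ennreal (r * t powr (- 3 / 2)) * indicator {r\<^sup>2..} t) \<partial>lborel)"
    proof (intro nn_integral_mono)
      fix t
      show "g_density f t x * indicator {r\<^sup>2<..} t
        \<le> g_density f t y * indicator {r\<^sup>2<..} t + ennreal ?K * (ennreal (r * t powr (- 3 / 2)) * indicator {r\<^sup>2..} t)"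
        using pw[of t] by (cases "r\<^sup>2 < t") auto
    qed
    also have "\<dots> = (\<integral>\<^sup>+t\<in>{r\<^sup>2<..}. g_density f t y \<partial>lborel)
        + ennreal ?K * (\<integral>\<^sup>+t. ennreal (r * t powr (- 3 / 2)) * indicator {r\<^sup>2..} t \<partial>lborel)"
      by (subst nn_integral_add) (auto simp: nn_integral_cmult)
    also have "\<dots> = (\<integral>\<^sup>+t\<in>{r\<^sup>2<..}. g_density f t y \<partial>lborel) + ennreal (8 * C\<^sup>2 * a\<^sup>2)"
      unfolding nn_integral_powr_tail[OF r]
      by (simp add: ennreal_mult'[symmetric] flip: ennreal_numeral)
    finally show ?thesis .
  qed
  then show ?thesis
    using C by (intro exI[of _ "8 * C\<^sup>2"]) (simp add: mult.assoc)
qed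

section \<open>The square function\<close>

definition g_square :: "('a::euclidean_space \<Rightarrow> 'b::euclidean_space) \<Rightarrow> 'a \<Rightarrow> ennreal" where
  "g_square f x = (\<integral>\<^sup>+t\<in>{0<..}. g_density f t x \<partial>lborel)"

text \<open>The tail at \<open>x\<close>, lowered by its oscillation, is a competitor for the
  essential infimum; what is left at \<open>x\<close> is the small-time part plus that oscillation,
  and the Carleson estimate bounds its mean.\<close>

theorem bmo_g_square_blo:
  "\<exists>C>0. \<forall>f::'a::euclidean_space \<Rightarrow> 'b::euclidean_space. \<forall>a. bmo_bounded f a \<longrightarrow>
     (AE x in lborel. g_square f x < \<infinity>) \<longrightarrow>
     locally_integrable (\<lambda>x. enn2real (g_square f x)) \<and> BLO_norm (\<lambda>x. enn2real (g_square f x)) \<le> ennreal (C * a\<^sup>2)"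
proof -
  obtain P where P: "P > 0" "\<forall>f::'a \<Rightarrow> 'b. \<forall>a. bmo_bounded f a \<longrightarrow> (\<forall>r>0. \<forall>z.
     (\<integral>\<^sup>+x\<in>ball z r. (\<integral>\<^sup>+t\<in>{0<..r\<^sup>2}. g_density f t x \<partial>lborel) \<partial>lborel)
       \<le> ennreal (P * a\<^sup>2) * emeasure lborel (ball z r))"
    using bmo_carleson[where 'a = 'a and 'b = 'b] by blast
  obtain Q where Q: "Q > 0" "\<forall>f::'a \<Rightarrow> 'b. \<forall>a. bmo_bounded f a \<longrightarrow> (\<forall>r>0. \<forall>x y.
     norm (x - y) \<le> 2 * r \<longrightarrow>
     (\<integral>\<^sup>+t\<in>{r\<^sup>2<..}. g_density f t x \<partial>lborel) \<le> (\<integral>\<^sup>+t\<in>{r\<^sup>2<..}. g_density f t y \<partial>lborel) + ennreal (Q * a\<^sup>2))"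
    using bmo_tail_oscillation[where 'a = 'a and 'b = 'b] by blast
  have main: "locally_integrable (\<lambda>x. enn2real (g_square f x))"
      "BLO_norm (\<lambda>x. enn2real (g_square f x)) \<le> ennreal ((P + Q) * a\<^sup>2)"
    if bmo: "bmo_bounded f a" and AE: "AE x in lborel. g_square f x < \<infinity>" for f :: "'a \<Rightarrow> 'b" and a
  proof -
    note [measurable] = bmo_measurable[OF bmo]
    have [measurable]: "ball z r \<in> sets borel" for z :: 'a and r by simp
    have g_meas [measurable]: "g_square f \<in> borel_measurable borel"
      unfolding g_square_def by measurable
    define L where "L r x = (\<integral>\<^sup>+t\<in>{0<..r\<^sup>2}. g_density f t x \<partial>lborel)" for r x
    define U where "U r x = (\<integral>\<^sup>+t\<in>{r\<^sup>2<..}. g_density f t x \<partial>lborel)" for r x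
    have [measurable]: "L r \<in> borel_measurable borel" for r unfolding L_def by measurable
    have split: "g_square f x = L r x + U r x" for r x
    proof -
      have "g_square f x = (\<integral>\<^sup>+t. g_density f t x * indicator {0<..r\<^sup>2} t + g_density f t x * indicator {r\<^sup>2<..} t \<partial>lborel)"
        unfolding g_square_def
      proof (intro nn_integral_cong)
        fix t :: real
        show "g_density f t x * indicator {0<..} t
            = g_density f t x * indicator {0<..r\<^sup>2} t + g_density f t x * indicator {r\<^sup>2<..} t"
          using order_le_less_trans[OF zero_le_power2[of r], of t] by (cases "t \<le> r\<^sup>2") (auto simp: indicator_def)
      qed
      then show ?thesis unfolding L_def U_def by (simp add: nn_integral_add)
    qed
    have L_int: "(\<integral>\<^sup>+x\<in>ball z r. L r x \<partial>lborel) \<le> ennreal (P * a\<^sup>2) * emeasure lborel (ball z r)" if "r > 0" for z r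
      unfolding L_def using P(2) bmo that by blast
    have U_osc: "U r x \<le> U r y + ennreal (Q * a\<^sup>2)" if "r > 0" "x \<in> ball z r" "y \<in> ball z r" for x y z r
    proof -
      have "dist x y \<le> dist x z + dist y z" by (rule dist_triangle2)
      then have "norm (x - y) \<le> 2 * r" using that by (simp add: dist_norm norm_minus_commute[of _ z])
      then show ?thesis unfolding U_def using Q(2) bmo that(1) by blast
    qed
    have pos: "emeasure lborel (ball z r) \<noteq> 0" "emeasure lborel (ball z r) < \<infinity>" if "r > 0" for z :: 'a and r
      using that less_imp_neq[OF unit_ball_vol_pos[of "real DIM('a)"]] by (auto simp: emeasure_ball)
    show "locally_integrable (\<lambda>x. enn2real (g_square f x))"
      unfolding locally_integrable_def
    proof (intro allI impI)
      fix K :: "'a set" assume K: "compact K"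
      obtain r where r: "r > 0" "K \<subseteq> ball 0 r"
        using bounded_subset_ballD[OF compact_imp_bounded[OF K], of 0] by auto
      \<comment> \<open>A single point with a finite value makes the tail finite there, and by the
        oscillation bound it is then bounded on the whole ball. Such a point exists because a ball
        is not a null set.\<close>
      have "\<exists>x0\<in>ball 0 r. g_square f x0 < \<infinity>"
      proof (rule ccontr)
        assume neg: "\<not> (\<exists>x0\<in>ball 0 r. g_square f x0 < \<infinity>)"
        have "AE x in lborel. x \<notin> ball (0::'a) r"
          using AE by eventually_elim (use neg in auto)
        then have "ball (0::'a) r \<in> null_sets lborel"
          by (subst AE_iff_null_sets) auto
        then have "emeasure lborel (ball (0::'a) r) = 0"
          by (rule null_setsD1)
        with pos(1)[OF r(1), of 0] show False by simp
      qed
      then obtain x0 where x0: "x0 \<in> ball 0 r" "g_square f x0 < \<infinity>" by blast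
      have U0: "U r x0 < \<infinity>" using x0(2) unfolding split[of x0 r] by simp
      have "(\<integral>\<^sup>+x\<in>ball 0 r. g_square f x \<partial>lborel)
          \<le> (\<integral>\<^sup>+x. L r x * indicator (ball 0 r) x + (U r x0 + ennreal (Q * a\<^sup>2)) * indicator (ball 0 r) x \<partial>lborel)"
        using U_osc[OF r(1) _ x0(1)] unfolding split[of _ r]
        by (intro nn_integral_mono) (auto simp: indicator_def intro!: add_left_mono)
      also have "\<dots> = (\<integral>\<^sup>+x\<in>ball 0 r. L r x \<partial>lborel) + (U r x0 + ennreal (Q * a\<^sup>2)) * emeasure lborel (ball (0::'a) r)"
        by (subst nn_integral_add) (auto simp: nn_integral_cmult_indicator)
      also have "\<dots> < \<infinity>"
        using le_less_trans[OF L_int[OF r(1), of 0]] pos(2)[OF r(1), of 0] U0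
        by (simp add: ennreal_mult_less_top)
      finally have fin: "(\<integral>\<^sup>+x\<in>ball 0 r. g_square f x \<partial>lborel) < \<infinity>" .
      have "integrable lborel (\<lambda>x. indicator (ball 0 r) x *\<^sub>R enn2real (g_square f x))"
      proof (rule integrableI_nonneg)
        have "(\<integral>\<^sup>+x. ennreal (indicator (ball 0 r) x *\<^sub>R enn2real (g_square f x)) \<partial>lborel)
            \<le> (\<integral>\<^sup>+x\<in>ball 0 r. g_square f x \<partial>lborel)"
          by (intro nn_integral_mono) (auto simp: indicator_def ennreal_enn2real_if)
        with fin show "(\<integral>\<^sup>+x. ennreal (indicator (ball 0 r) x *\<^sub>R enn2real (g_square f x)) \<partial>lborel) < \<infinity>"
          by (rule le_less_trans[rotated])
      qed auto
      then have "set_integrable lebesgue (ball 0 r) (\<lambda>x. enn2real (g_square f x))"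
        unfolding set_integrable_def by (subst integrable_completion) auto
      then show "set_integrable lebesgue K (\<lambda>x. enn2real (g_square f x))"
        using r(2) compact_imp_closed[OF K] by (rule_tac set_integrable_subset[where A = "ball 0 r"]) (auto intro: borel_closed)
    qed
    have ball_le: "(\<integral>\<^sup>+x\<in>ball z r. e2ennreal (ereal (enn2real (g_square f x)) - ess_inf (ball z r) (\<lambda>x. enn2real (g_square f x))) \<partial>lebesgue)
        / emeasure lebesgue (ball z r) \<le> ennreal ((P + Q) * a\<^sup>2)" if r: "r > 0" for z r
    proof -
      let ?e = "ess_inf (ball z r) (\<lambda>x. enn2real (g_square f x))"
      let ?M = "Q * a\<^sup>2"
      have M: "?M \<ge> 0" using Q by simp
      have pw: "e2ennreal (ereal (enn2real (g_square f x)) - ?e) \<le> L r x + ennreal ?M"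
        if x: "x \<in> ball z r" "g_square f x < \<infinity>" for x
      proof -
        obtain l where l: "l \<ge> 0" "L r x = ennreal l"
          using x(2) unfolding split[of x r] by (cases "L r x") auto
        obtain u where u: "u \<ge> 0" "U r x = ennreal u"
          using x(2) unfolding split[of x r] by (cases "U r x") auto
        have g: "enn2real (g_square f x) = l + u"
          using l u unfolding split[of x r] by (simp add: ennreal_plus[symmetric] del: ennreal_plus)
        \<comment> \<open>The number \<open>u\<close> is the tail at the fixed point
          \<open>x\<close>; at almost every \<open>y\<close> the whole square is at least its own
          tail, hence at least \<open>u - ?M\<close>, which may be negative.\<close>
        have "AE y in lborel. y \<in> ball z r \<longrightarrow> ereal (u - ?M) \<le> ereal (enn2real (g_square f y))"
          using AE
        proof eventually_elim
          fix y assume gy: "g_square f y < \<infinity>"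
          show "y \<in> ball z r \<longrightarrow> ereal (u - ?M) \<le> ereal (enn2real (g_square f y))"
          proof
            assume y: "y \<in> ball z r"
            have "ennreal u \<le> U r y + ennreal ?M"
              using U_osc[OF r x(1) y] u by simp
            also have "\<dots> \<le> g_square f y + ennreal ?M"
              unfolding split[of y r] by (intro add_right_mono) simp
            also have "\<dots> = ennreal (enn2real (g_square f y) + ?M)"
              using gy M by (simp add: ennreal_enn2real_if ennreal_plus)
            finally have "u \<le> enn2real (g_square f y) + ?M"
              using M by (subst (asm) ennreal_le_iff) auto
            then show "ereal (u - ?M) \<le> ereal (enn2real (g_square f y))" by simp
          qed
        qed
        then have "ereal (u - ?M) \<le> ?e"
          unfolding ess_inf_def by (intro Sup_upper) (auto intro: AE_completion)
        then have "ereal (enn2real (g_square f x)) - ?e \<le> ereal (l + u) - ereal (u - ?M)"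
          unfolding g by (intro ereal_minus_mono) auto
        also have "\<dots> = ereal (l + ?M)" by simp
        finally have "e2ennreal (ereal (enn2real (g_square f x)) - ?e) \<le> e2ennreal (ereal (l + ?M))"
          by (rule e2ennreal_mono)
        then show ?thesis using l M by simp
      qed
      have "(\<integral>\<^sup>+x\<in>ball z r. e2ennreal (ereal (enn2real (g_square f x)) - ?e) \<partial>lebesgue)
          = (\<integral>\<^sup>+x\<in>ball z r. e2ennreal (ereal (enn2real (g_square f x)) - ?e) \<partial>lborel)"
        by (rule nn_integral_completion)
      also have "\<dots> \<le> (\<integral>\<^sup>+x. L r x * indicator (ball z r) x + ennreal ?M * indicator (ball z r) x \<partial>lborel)"
      proof (rule nn_integral_mono_AE)
        show "AE x in lborel. e2ennreal (ereal (enn2real (g_square f x)) - ?e) * indicator (ball z r) x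
            \<le> L r x * indicator (ball z r) x + ennreal ?M * indicator (ball z r) x"
          using AE by eventually_elim (use pw in \<open>auto simp: indicator_def\<close>)
      qed
      also have "\<dots> = (\<integral>\<^sup>+x\<in>ball z r. L r x \<partial>lborel) + ennreal ?M * emeasure lborel (ball z r)"
        by (subst nn_integral_add) (auto simp: nn_integral_cmult_indicator)
      also have "\<dots> \<le> ennreal (P * a\<^sup>2) * emeasure lborel (ball z r) + ennreal ?M * emeasure lborel (ball z r)"
        by (intro add_right_mono L_int r)
      also have "\<dots> = emeasure lborel (ball z r) * ennreal ((P + Q) * a\<^sup>2)"
        using P(1) Q(1) by (simp add: distrib_left distrib_right ennreal_plus mult.commute)
      finally show ?thesis
        using pos[OF r, of z] by (intro divide_le_posI_ennreal) (auto simp: zero_less_iff_neq_zero)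
    qed
    show "BLO_norm (\<lambda>x. enn2real (g_square f x)) \<le> ennreal ((P + Q) * a\<^sup>2)"
      unfolding BLO_norm_def using ball_le by (intro SUP_least) auto
  qed
  have "P + Q > 0" using P Q by simp
  with main show ?thesis by blast
qed

section \<open>Passage from Lebesgue measurable functions to Borel representatives\<close>

lemma lebesgue_complex_ex_borel:
  fixes f :: "'a::euclidean_space \<Rightarrow> complex"
  assumes f: "f \<in> borel_measurable lebesgue"
  shows "\<exists>f'\<in>borel_measurable borel. AE x in lebesgue. f x = f' x"
proof -
  have "(\<lambda>x. Re (f x)) \<in> borel_measurable lebesgue" "(\<lambda>x. Im (f x)) \<in> borel_measurable lebesgue"
    using f by (auto intro: measurable_compose[OF f])
  then obtain p q where p: "p \<in> borel_measurable lborel" "AE x in lborel. Re (f x) = p x"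
    and q: "q \<in> borel_measurable lborel" "AE x in lborel. Im (f x) = q x"
    using completion_ex_borel_measurable_real by metis
  have "(\<lambda>x. complex_of_real (p x) + \<i> * complex_of_real (q x)) \<in> borel_measurable borel"
    using p(1) q(1) by simp
  moreover have "AE x in lborel. f x = complex_of_real (p x) + \<i> * complex_of_real (q x)"
    using p(2) q(2) by eventually_elim (simp add: complex_eq_iff)
  ultimately show ?thesis
    by (intro bexI[of _ "\<lambda>x. complex_of_real (p x) + \<i> * complex_of_real (q x)"] AE_completion)
qed

text \<open>The truncations to closed balls of integer radius are integrable, and at each point they
  are eventually equal to \<open>f\<close>.\<close>

lemma locally_integrable_measurable:
  fixes f :: "'a::euclidean_space \<Rightarrow> 'b::{banach, second_countable_topology}"
  assumes "locally_integrable f"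
  shows "f \<in> borel_measurable lebesgue"
proof (rule borel_measurable_LIMSEQ_metric)
  show "(\<lambda>x. indicator (cball 0 (real i)) x *\<^sub>R f x) \<in> borel_measurable lebesgue" for i
    using assms by (intro borel_measurable_integrable) (simp add: locally_integrable_def set_integrable_def)
  fix x :: 'a
  obtain n :: nat where n: "norm x < n" using reals_Archimedean2 by blast
  have "eventually (\<lambda>i. indicator (cball 0 (real i)) x *\<^sub>R f x = f x) sequentially"
    using eventually_ge_at_top[of n] by eventually_elim (use n in \<open>auto simp: indicator_def\<close>)
  then show "(\<lambda>i. indicator (cball 0 (real i)) x *\<^sub>R f x) \<longlonglongrightarrow> f x"
    by (rule tendsto_eventually)
qed

text \<open>The strict inequality between the norm and \<open>a\<close> forces \<open>a > 0\<close>
  even when the norm vanishes. Changing \<open>f\<close> on a null set alters neither means nor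
  deviations.\<close>

lemma BMO_imp_bmo_bounded:
  fixes f f' :: "'a::euclidean_space \<Rightarrow> complex"
  assumes f: "f \<in> BMO" and f'[measurable]: "f' \<in> borel_measurable borel"
    and eq: "AE x in lebesgue. f x = f' x" and a: "enn2real (BMO_norm f) < a"
  shows "bmo_bounded f' a"
proof -
  have loc: "locally_integrable f" and fin: "BMO_norm f < \<infinity>" using f by (auto simp: BMO_def)
  have [measurable]: "f \<in> borel_measurable lebesgue" by (rule locally_integrable_measurable[OF loc])
  have f'_leb [measurable]: "f' \<in> borel_measurable lebesgue" by (intro measurable_completion) simp
  have ball [measurable]: "ball z r \<in> sets borel" for z :: 'a and r by simp
  have [measurable]: "ball z r \<in> sets lebesgue" for z :: 'a and r by simp
  have int: "set_integrable lborel (ball z r) f'" for z r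
  proof -
    have "set_integrable lebesgue (cball z r) f"
      using loc by (simp add: locally_integrable_def)
    then have "set_integrable lebesgue (ball z r) f"
      by (rule set_integrable_subset) auto
    then have "integrable lebesgue (\<lambda>x. indicator (ball z r) x *\<^sub>R f' x)"
      unfolding set_integrable_def
      by (rule integrable_cong_AE_imp) (use eq in \<open>auto elim!: eventually_mono\<close>)
    then show ?thesis
      unfolding set_integrable_def by (subst (asm) integrable_completion) auto
  qed
  have avg: "average (ball z r) f = mean_on (ball z r) f'" for z r
  proof -
    have "(LINT x:ball z r|lebesgue. f x) = (LINT x:ball z r|lebesgue. f' x)"
      unfolding set_lebesgue_integral_def
      by (rule integral_cong_AE) (use eq in \<open>auto elim!: eventually_mono\<close>)
    also have "\<dots> = (LINT x:ball z r|lborel. f' x)"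
      unfolding set_lebesgue_integral_def by (rule integral_completion) measurable
    finally show ?thesis by (simp add: average_def mean_on_def measure_completion)
  qed
  have a0: "a > 0" using a enn2real_nonneg[of "BMO_norm f"] by linarith
  have "deviation (ball z r) f' (mean_on (ball z r) f') \<le> a * measure lborel (ball z r)" if r: "r > 0" for z r
  proof -
    let ?m = "mean_on (ball z r) f'"
    have emf: "emeasure lborel (ball z r) < \<infinity>" using emeasure_lborel_ball_finite[of z r] by simp
    have em: "emeasure lborel (ball z r) = ennreal (measure lborel (ball z r))"
      using emf by (simp add: emeasure_eq_ennreal_measure)
    have pos: "measure lborel (ball z r) > 0" using r by simp
    have "ennreal (deviation (ball z r) f' ?m) = (\<integral>\<^sup>+x\<in>ball z r. ennreal (norm (f' x - ?m)) \<partial>lborel)"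
      using nn_integral_eq_deviation[OF int ball emf] by simp
    also have "\<dots> = (\<integral>\<^sup>+x\<in>ball z r. ennreal (norm (f' x - ?m)) \<partial>lebesgue)"
      by (simp add: nn_integral_completion)
    also have "\<dots> = (\<integral>\<^sup>+x\<in>ball z r. ennreal (norm (f x - average (ball z r) f)) \<partial>lebesgue)"
      unfolding avg by (rule nn_integral_cong_AE) (use eq in \<open>auto elim!: eventually_mono\<close>)
    finally have "ennreal (deviation (ball z r) f' ?m) / emeasure lborel (ball z r)
        = (\<integral>\<^sup>+x\<in>ball z r. ennreal (norm (f x - average (ball z r) f)) \<partial>lebesgue) / emeasure lebesgue (ball z r)"
      by simp
    also have "\<dots> \<le> BMO_norm f"
      unfolding BMO_norm_def using r by (intro SUP_upper2[of "(z, r)"]) auto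
    also have "\<dots> = ennreal (enn2real (BMO_norm f))"
      using fin by (simp add: ennreal_enn2real_if)
    also have "\<dots> \<le> ennreal a" using a by (intro ennreal_leI) simp
    finally have "ennreal (deviation (ball z r) f' ?m / measure lborel (ball z r)) \<le> ennreal a"
      unfolding em using pos by (simp add: divide_ennreal)
    then have "deviation (ball z r) f' ?m / measure lborel (ball z r) \<le> a"
      using a0 by (simp add: ennreal_le_iff)
    then show ?thesis using pos by (simp add: divide_le_eq)
  qed
  with int a0 f' show ?thesis by (simp add: bmo_bounded_def)
qed

lemma heat_semigroup_eq_heat:
  fixes f f' :: "real^'n \<Rightarrow> complex"
  assumes [measurable]: "f \<in> borel_measurable lebesgue" "f' \<in> borel_measurable borel"
    and eq: "AE x in lebesgue. f x = f' x"
  shows "heat_semigroup t f x = heat f' t x"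
proof -
  have f'_leb [measurable]: "f' \<in> borel_measurable lebesgue" by (intro measurable_completion) simp
  have k: "(\<lambda>y. heat_kernel t (x - y)) \<in> borel_measurable borel" by measurable
  then have k_leb [measurable]: "(\<lambda>y. heat_kernel t (x - y)) \<in> borel_measurable lebesgue"
    by (intro measurable_completion) simp
  have "heat_semigroup t f x = (LINT y|lebesgue. heat_kernel t (x - y) *\<^sub>R f y)"
    by (simp add: heat_semigroup_def heat_kernel_def)
  also have "\<dots> = (LINT y|lebesgue. heat_kernel t (x - y) *\<^sub>R f' y)"
    by (rule integral_cong_AE) (use eq in \<open>auto elim!: eventually_mono\<close>)
  also have "\<dots> = heat f' t x"
    unfolding heat_def by (rule integral_completion) measurable
  finally show ?thesis .
qed

lemma g_function_eq:
  fixes f f' :: "real^'n \<Rightarrow> complex"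
  assumes "f \<in> borel_measurable lebesgue" "AE x in lebesgue. f x = f' x" and bmo: "bmo_bounded f' a"
  shows "g_function f x = ennreal_sqrt (g_square f' x)"
proof -
  have "(\<integral>\<^sup>+t\<in>{0<..}. ennreal ((norm (t *\<^sub>R vector_derivative (\<lambda>s. heat_semigroup s f x) (at t)))\<^sup>2 / t) \<partial>lebesgue)
      = (\<integral>\<^sup>+t\<in>{0<..}. g_density f' t x \<partial>lebesgue)"
  proof (intro nn_integral_cong)
    fix t :: real
    have "vector_derivative (\<lambda>s. heat_semigroup s f x) (at t) = heat_deriv f' t x" if "t > 0"
      unfolding heat_semigroup_eq_heat[OF assms(1) bmo_measurable[OF bmo] assms(2)]
      by (rule vector_derivative_at[OF heat_has_vector_derivative[OF bmo_tempered[OF bmo] that]])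
    then show "ennreal ((norm (t *\<^sub>R vector_derivative (\<lambda>s. heat_semigroup s f x) (at t)))\<^sup>2 / t) * indicator {0<..} t
        = g_density f' t x * indicator {0<..} t"
      by (auto simp: g_density_def indicator_def)
  qed
  then show ?thesis
    by (simp add: g_function_def g_square_def nn_integral_completion)
qed

lemma ennreal_sqrt_less_top_iff: "ennreal_sqrt u < top \<longleftrightarrow> u < top"
  by (auto simp: ennreal_sqrt_def less_top)

text \<open>Valid at infinity too, where both sides are 0; hence \<open>g_function_sq\<close> agrees
  with the square at every point and not only almost everywhere.\<close>

lemma enn2real_ennreal_sqrt: "(enn2real (ennreal_sqrt u))\<^sup>2 = enn2real u"
  by (auto simp: ennreal_sqrt_def)

theorem theorem2p5:
  shows "\<exists>C::real. C > 0 \<and>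
    (\<forall>f :: real^'n \<Rightarrow> complex.
      f \<in> BMO \<longrightarrow> (AE x in lebesgue. g_function f x < \<infinity>) \<longrightarrow>
        g_function_sq f \<in> BLO \<and>
        BLO_norm (g_function_sq f) \<le> ennreal C * (BMO_norm f)\<^sup>2)"
proof -
  obtain C where C: "C > 0" and main: "\<forall>f::real^'n \<Rightarrow> complex. \<forall>a. bmo_bounded f a \<longrightarrow>
     (AE x in lborel. g_square f x < \<infinity>) \<longrightarrow>
     locally_integrable (\<lambda>x. enn2real (g_square f x)) \<and> BLO_norm (\<lambda>x. enn2real (g_square f x)) \<le> ennreal (C * a\<^sup>2)"
    using bmo_g_square_blo[where 'a = "real^'n" and 'b = complex] by blast
  have "g_function_sq f \<in> BLO \<and> BLO_norm (g_function_sq f) \<le> ennreal C * (BMO_norm f)\<^sup>2"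
    if f: "f \<in> BMO" and AE: "AE x in lebesgue. g_function f x < \<infinity>" for f :: "real^'n \<Rightarrow> complex"
  proof -
    define N where "N = enn2real (BMO_norm f)"
    have N: "BMO_norm f = ennreal N" "N \<ge> 0"
      using f by (auto simp: BMO_def N_def ennreal_enn2real_if)
    have meas: "f \<in> borel_measurable lebesgue"
      using f by (intro locally_integrable_measurable) (simp add: BMO_def)
    obtain f' where f': "f' \<in> borel_measurable borel" "AE x in lebesgue. f x = f' x"
      using lebesgue_complex_ex_borel[OF meas] by blast
    have bmo: "bmo_bounded f' a" if "N < a" for a
      using BMO_imp_bmo_bounded[OF f f'] that by (simp add: N_def)
    have g: "g_function f x = ennreal_sqrt (g_square f' x)" for x
      by (rule g_function_eq[OF meas f'(2) bmo[of "N + 1"]]) simp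
    have gsq: "g_function_sq f = (\<lambda>x. enn2real (g_square f' x))"
      by (simp add: fun_eq_iff g_function_sq_def g enn2real_ennreal_sqrt)
    have AE': "AE x in lborel. g_square f' x < \<infinity>"
      using AE by (simp add: g ennreal_sqrt_less_top_iff AE_completion_iff)
    have loc: "locally_integrable (g_function_sq f)"
      unfolding gsq using main bmo[of "N + 1"] AE' by auto
    \<comment> \<open>\<open>bmo_bounded\<close> is available only for bounds strictly above the
      norm \<open>N\<close>, so these decrease to \<open>N\<close> along a sequence; this includes
      \<open>N = 0\<close>.\<close>
    have "BLO_norm (g_function_sq f) \<le> ennreal (C * (N + inverse (real (Suc n)))\<^sup>2)" for n
      unfolding gsq using main bmo[of "N + inverse (real (Suc n))"] AE' by auto
    moreover have "(\<lambda>n. ennreal (C * (N + inverse (real (Suc n)))\<^sup>2)) \<longlonglongrightarrow> ennreal (C * (N + 0)\<^sup>2)"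
      by (intro tendsto_intros LIMSEQ_inverse_real_of_nat)
    ultimately have "BLO_norm (g_function_sq f) \<le> ennreal (C * (N + 0)\<^sup>2)"
      by (intro LIMSEQ_le_const[of _ _ "BLO_norm (g_function_sq f)"]) auto
    then have le: "BLO_norm (g_function_sq f) \<le> ennreal C * (BMO_norm f)\<^sup>2"
      using C N by (simp add: ennreal_mult ennreal_power)
    moreover have "BLO_norm (g_function_sq f) < \<infinity>"
      using le by (rule le_less_trans) (simp add: N ennreal_mult_less_top ennreal_power)
    ultimately show ?thesis using loc by (simp add: BLO_def)
  qed
  with C show ?thesis by blast
qed

end
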